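(* Let $\Gamma$ be an index set and let $\{K_\gamma\}_{\gamma\in\Gamma}$ be a collection of Markov transition kernels from $\Omega$ to $\Omega$, where $\Omega$ is a (possibly continuous) state space. For $1\le i<n$, $x\in\Omega$ and $\gamma'\in\Gamma$, let $g_i(\cdot\mid x,\gamma')$ be a probability measure on $\Gamma$. Let $Q$ be the adaptive Markov measure on $\Omega^n$ defined by $\{K_\gamma\}$ and $\{g_i\}$ (and an initial distribution $p_0$ on $\Omega\times\Gamma$): $$dQ(x)=\int_{\Gamma^n}p_0(dx_1,d\gamma_1)\prod_{i=1}^{n-1}\big[g_i(d\gamma_{i+1}\mid x_i,\gamma_i)\,K_{\gamma_i}(x_i,dx_{i+1})\big].$$ Define the contraction coefficients $$\kappa=\sup_{w,w'\in\Omega,\ \gamma,\gamma'\in\Gamma}\|K_\gamma(w,\cdot)-K_{\gamma'}(w',\cdot)\|_{TV},\qquad \lambda_i=\sup_{w,w'\in\Omega,\ \gamma,\gamma'\in\Gamma}\|g_i(\cdot\mid w,\gamma)-g_i(\cdot\mid w',\gamma')\|_{TV}.$$ Then the $\eta$-mixing coefficients of the adaptive Markov measure $Q$ satisfy, for $1\le i<j\le n$, $$\bar\eta_{ij}\;\le\;\theta_i\theta_{i+1}\cdots\theta_{j-1},\qquad\text{where }\ \theta_i=\kappa+\lambda_i-\kappa\lambda_i .$$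
   Context: For a signed measure $\tau$, $\|\tau\|_{TV}=\frac12[\sup_A\tau(A)-\inf_A\tau(A)]$. All sets are assumed Borel-measurable. $\eta$-mixing coefficients of $Q$: let $(X_1,\ldots,X_n)$ have law $Q$, write $X_{j:n}=(X_j,\ldots,X_n)$, and let $\mathcal{L}(X_{j:n}\mid X_{1:i}=x)$ be the law of $X_{j:n}$ conditioned on $X_{1:i}=x$. For $1\le i<j\le n$, $$\bar\eta_{ij}=\sup_{y\in\Omega^{i-1},\ w,w'\in\Omega}\big\|\mathcal{L}(X_{j:n}\mid X_{1:i}=(y,w))-\mathcal{L}(X_{j:n}\mid X_{1:i}=(y,w'))\big\|_{TV}.$$ Convention for conditioning on sets of measure zero: for an arbitrary probability measure $m$ on $\Omega^n$, $\bar\eta_{ij}(m)=\inf\lim_{k\to\infty}\bar\eta_{ij}(m_k)$, the infimum being over all sequences $\{m_k\}$ of strictly positive probability measures on $\Omega^n$ ($m_k(x)>0$ for all $x\in\Omega^n$) with $\|m_k-m\|_{TV}\to0$.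
   Formalization: Ω is Polish. For uncountable Ω no measure has m(x)>0 at every x and conditional laws at null points are undefined, so strictly positive means every nonempty open set has positive measure, and the coefficient of a measure is the infimum over versions of the conditional law. *)

theory Defs
  imports "HOL-Probability.Probability"
begin

text \<open>
  Conventions. The state space is a Polish type \<^typ>\<open>'a\<close> with its Borel sets, and
  \<open>\<Omega>\<^sup>n\<close> is \<open>Pi\<^sub>M {1..n} (\<lambda>_. borel)\<close>, so that a segment \<open>X\<^sub>a, \<dots>, X\<^sub>b\<close> of the process is
  the restriction of a point of \<open>\<Omega>\<^sup>n\<close> to \<open>{a..b}\<close>. The index set \<open>\<Gamma>\<close> is the space of an
  arbitrary measurable space \<open>G\<close>.
\<close>

definition state_seqs :: "nat set \<Rightarrow> (nat \<Rightarrow> 'a::polish_space) measure" where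
  "state_seqs I = Pi\<^sub>M I (\<lambda>_. borel)"

text \<open>The norm of a signed measure \<open>\<tau>\<close>, given as a set function on the \<open>\<sigma>\<close>-algebra \<open>F\<close>.\<close>

definition tv_norm :: "'b set set \<Rightarrow> ('b set \<Rightarrow> real) \<Rightarrow> real" where
  "tv_norm F \<tau> = ((SUP A\<in>F. \<tau> A) - (INF A\<in>F. \<tau> A)) / 2"

definition tv_dist :: "'b measure \<Rightarrow> 'b measure \<Rightarrow> real" where
  "tv_dist \<mu> \<nu> = tv_norm (sets \<mu>) (\<lambda>A. measure \<mu> A - measure \<nu> A)"

text \<open>
  \<open>L\<close> is a (regular) conditional law of \<open>X\<^sub>j, \<dots>, X\<^sub>n\<close> given \<open>X\<^sub>1, \<dots>, X\<^sub>i\<close> under \<open>m\<close>.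
  It is determined at every point whose segment \<open>X\<^sub>1, \<dots>, X\<^sub>i\<close> has positive probability, and in
  general up to a null set.
\<close>

definition is_cond_law ::
  "nat \<Rightarrow> (nat \<Rightarrow> 'a::polish_space) measure \<Rightarrow> nat \<Rightarrow> nat
    \<Rightarrow> ((nat \<Rightarrow> 'a) \<Rightarrow> (nat \<Rightarrow> 'a) measure) \<Rightarrow> bool" where
  "is_cond_law n m i j L \<longleftrightarrow>
     L \<in> state_seqs {1..i} \<rightarrow>\<^sub>M prob_algebra (state_seqs {j..n}) \<and>
     (\<forall>A\<in>sets (state_seqs {1..i}). \<forall>B\<in>sets (state_seqs {j..n}).
        emeasure m {x \<in> space m. restrict x {1..i} \<in> A \<and> restrict x {j..n} \<in> B} =
        (\<integral>\<^sup>+x\<in>A. emeasure (L x) B \<partial>(distr m (state_seqs {1..i}) (\<lambda>x. restrict x {1..i}))))"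

text \<open>
  The mixing coefficient computed directly from conditional laws. For countable state space and
  strictly positive \<open>m\<close> the conditional law is unique and the outer infimum ranges over a single
  value; otherwise it selects the best version. The infimum is taken in the extended reals, so
  it would be infinite if there were no conditional law.
\<close>

definition eta_sup ::
  "nat \<Rightarrow> ((nat \<Rightarrow> 'a::polish_space) \<Rightarrow> (nat \<Rightarrow> 'a) measure) \<Rightarrow> ereal" where
  "eta_sup i L =
     (SUP y\<in>space (state_seqs {1..<i}). SUP w. SUP w'.
        ereal (tv_dist (L (y(i := w))) (L (y(i := w')))))"

definition eta_direct ::
  "nat \<Rightarrow> (nat \<Rightarrow> 'a::polish_space) measure \<Rightarrow> nat \<Rightarrow> nat \<Rightarrow> ereal" where
  "eta_direct n m i j = Inf {eta_sup i L | L. is_cond_law n m i j L}"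

text \<open>
  For countable state space every point must be an atom. On an uncountable one no probability
  measure has this property, and strictly positive has its usual topological meaning: every
  nonempty open set has positive measure. The two agree on countable discrete spaces.
\<close>

definition strictly_positive :: "nat \<Rightarrow> (nat \<Rightarrow> 'a::polish_space) measure \<Rightarrow> bool" where
  "strictly_positive n m \<longleftrightarrow>
     (if countable (UNIV :: 'a set)
      then \<forall>x\<in>space (state_seqs {1..n} :: (nat \<Rightarrow> 'a) measure). measure m {x} > 0
      else \<forall>U. openin (product_topology (\<lambda>_. euclidean) {1..n}) U \<and> U \<noteq> {} \<longrightarrow> measure m U > 0)"

text \<open>Only sequences along which the coefficients converge contribute to the infimum.\<close>

definition eta_bar ::
  "nat \<Rightarrow> (nat \<Rightarrow> 'a::polish_space) measure \<Rightarrow> nat \<Rightarrow> nat \<Rightarrow> ereal" where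
  "eta_bar n m i j =
     Inf {l. \<exists>M :: nat \<Rightarrow> (nat \<Rightarrow> 'a) measure.
            (\<forall>k. M k \<in> space (prob_algebra (state_seqs {1..n})) \<and> strictly_positive n (M k)) \<and>
            (\<lambda>k. tv_dist (M k) m) \<longlonglongrightarrow> 0 \<and>
            (\<lambda>k. eta_direct n (M k) i j) \<longlonglongrightarrow> l}"

text \<open>
  \<open>adaptive_joint G p0 K g t\<close> is the law of the pairs \<open>(X\<^sub>s, \<gamma>\<^sub>s)\<close> for \<open>1 \<le> s \<le> t + 1\<close>:
  given the past, \<open>X\<close> and \<open>\<gamma>\<close> at time \<open>s + 1\<close> are independent with laws
  \<open>K \<gamma>\<^sub>s X\<^sub>s\<close> and \<open>g s X\<^sub>s \<gamma>\<^sub>s\<close>.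
\<close>

primrec adaptive_joint ::
  "'c measure \<Rightarrow> ('a::polish_space \<times> 'c) measure \<Rightarrow> ('c \<Rightarrow> 'a \<Rightarrow> 'a measure)
    \<Rightarrow> (nat \<Rightarrow> 'a \<Rightarrow> 'c \<Rightarrow> 'c measure) \<Rightarrow> nat \<Rightarrow> (nat \<Rightarrow> 'a \<times> 'c) measure" where
  "adaptive_joint G p0 K g 0 =
     distr p0 (Pi\<^sub>M {1..Suc 0} (\<lambda>_. borel \<Otimes>\<^sub>M G)) (\<lambda>z. \<lambda>s\<in>{1..Suc 0}. z)"
| "adaptive_joint G p0 K g (Suc t) =
     adaptive_joint G p0 K g t \<bind> (\<lambda>h. case h (Suc t) of (x, \<gamma>) \<Rightarrow>
       distr (K \<gamma> x \<Otimes>\<^sub>M g (Suc t) x \<gamma>) (Pi\<^sub>M {1..Suc (Suc t)} (\<lambda>_. borel \<Otimes>\<^sub>M G))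
         (\<lambda>z. h(Suc (Suc t) := z)))"

definition adaptive_markov ::
  "'c measure \<Rightarrow> ('a::polish_space \<times> 'c) measure \<Rightarrow> ('c \<Rightarrow> 'a \<Rightarrow> 'a measure)
    \<Rightarrow> (nat \<Rightarrow> 'a \<Rightarrow> 'c \<Rightarrow> 'c measure) \<Rightarrow> nat \<Rightarrow> (nat \<Rightarrow> 'a) measure" where
  "adaptive_markov G p0 K g n =
     distr (adaptive_joint G p0 K g (n - 1)) (state_seqs {1..n}) (\<lambda>h. \<lambda>s\<in>{1..n}. fst (h s))"

definition kernel_contraction ::
  "'c measure \<Rightarrow> ('c \<Rightarrow> 'a::polish_space \<Rightarrow> 'a measure) \<Rightarrow> real" where
  "kernel_contraction G K =
     (SUP (w, w', \<gamma>, \<gamma>') \<in> UNIV \<times> UNIV \<times> space G \<times> space G. tv_dist (K \<gamma> w) (K \<gamma>' w'))"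

definition index_contraction ::
  "'c measure \<Rightarrow> (nat \<Rightarrow> 'a::polish_space \<Rightarrow> 'c \<Rightarrow> 'c measure) \<Rightarrow> nat \<Rightarrow> real" where
  "index_contraction G g i =
     (SUP (w, w', \<gamma>, \<gamma>') \<in> UNIV \<times> UNIV \<times> space G \<times> space G. tv_dist (g i w \<gamma>) (g i w' \<gamma>'))"

definition theta ::
  "'c measure \<Rightarrow> ('c \<Rightarrow> 'a::polish_space \<Rightarrow> 'a measure) \<Rightarrow> (nat \<Rightarrow> 'a \<Rightarrow> 'c \<Rightarrow> 'c measure)
    \<Rightarrow> nat \<Rightarrow> real" where
  "theta G K g i =
     kernel_contraction G K + index_contraction G g i
       - kernel_contraction G K * index_contraction G g i"

end

theory Submission
  imports Defs
begin

text \<open>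
  The pairs \<open>(X\<^sub>k, \<gamma>\<^sub>k)\<close> form an inhomogeneous Markov chain with product kernels
  \<open>K \<gamma> x \<Otimes> g k x \<gamma>\<close>. Two such product measures share mass at least
  \<open>(1 - \<kappa>) (1 - \<lambda>\<^sub>k) = 1 - \<theta>\<^sub>k\<close>, so one step of the chain shrinks the oscillation of
  a bounded function by the factor \<open>\<theta>\<^sub>k\<close>. Hence, for each event \<open>B\<close>, the probability of
  \<open>X\<^sub>j, \<dots>, X\<^sub>n \<in> B\<close> given \<open>(X\<^sub>i, \<gamma>\<^sub>i)\<close> oscillates by at most
  \<open>\<theta>\<^sub>i \<cdots> \<theta>\<^sub>j\<^sub>-\<^sub>1\<close>, and so does, almost surely, its average over \<open>\<gamma>\<^sub>i\<close>, the
  probability given \<open>X\<^sub>1, \<dots>, X\<^sub>i\<close>. As \<open>\<Gamma>\<close> is an arbitrary measurable space, \<open>\<gamma>\<^sub>i\<close> need not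
  have a conditional law, but \<open>X\<^sub>j, \<dots>, X\<^sub>n\<close> does because the state space is Polish; a countable
  family of sets \<open>B\<close> controls the total variation, so the conditional law can be corrected on a
  single null set.

  Strictly positive approximations of \<open>Q\<close> that keep the bound are obtained by perturbing the
  kernels and not \<open>Q\<close> itself: replace \<open>K \<gamma> x\<close> by \<open>\<epsilon> \<rho> + (1 - \<epsilon>) K \<gamma> x\<close> with a fixed \<open>\<rho>\<close>
  charging every open set, and \<open>p0\<close> similarly. This does not increase \<open>\<kappa>\<close>, leaves \<open>\<lambda>\<^sub>k\<close>
  unchanged and moves \<open>Q\<close> by at most \<open>1 - (1 - \<epsilon>)\<^sup>n\<close>.
\<close>

section \<open>Total variation and mixtures\<close>

text \<open>The mixing coefficient compares laws at every pair of points, whereas conditional laws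
  are determined only almost everywhere. So the bound is first put in integrated form: for each
  event B there is a number a with a P(A) \<le> P(A, B) \<le> (a + c) P(A) for all A. This mentions
  neither a version of the conditional law nor a law of the index given the states. A version
  obeying the bound pointwise is built afterwards, and the infimum in \<open>eta_direct\<close> lets
  that version count. Since the future depends on the past only through the pair at time i, the
  bound even compares pasts that differ in all coordinates. Each of the j - i steps from i to j
  contributes one factor; at time j itself only the trivial bound 1, the empty product, is left.
  Mixing Q itself with a positive law would not do: the conditional laws of a mixture weigh its
  components according to the past, and may differ far more than those of Q. The initial law has to
  be perturbed as well because the first state, too, must charge every open set.\<close>

lemma prob_diff_le_1:
  assumes "prob_space \<mu>"
  shows "measure \<mu> A - measure \<nu> A \<le> 1"
  using prob_space.prob_le_1[OF assms, of A] measure_nonneg[of \<nu> A] by linarith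

text \<open>Both total masses are 1, so passing to the complement changes the sign of the
  difference. Its set of values is therefore symmetric, and half its range is its supremum. This
  makes one-sided estimates sufficient throughout.\<close>

lemma tv_dist_eq_SUP:
  assumes "prob_space \<mu>" "prob_space \<nu>" "sets \<nu> = sets \<mu>"
  shows "tv_dist \<mu> \<nu> = (SUP A\<in>sets \<mu>. measure \<mu> A - measure \<nu> A)"
proof -
  interpret \<mu>: prob_space \<mu> by fact
  interpret \<nu>: prob_space \<nu> by fact
  let ?d = "\<lambda>A. measure \<mu> A - measure \<nu> A"
  have sp: "space \<nu> = space \<mu>" by (rule sets_eq_imp_space_eq) fact
  have b: "bdd_above (?d ` sets \<mu>)"
    by (rule bdd_aboveI[of _ 1]) (auto intro!: prob_diff_le_1 assms)
  have compl: "?d (space \<mu> - A) = - ?d A" if "A \<in> sets \<mu>" for A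
    using that \<mu>.prob_compl[of A] \<nu>.prob_compl[of A] assms(3) by (simp add: sp)
  have "(\<lambda>A. - ?d A) ` sets \<mu> = ?d ` sets \<mu>"
  proof safe
    fix A assume "A \<in> sets \<mu>"
    then show "- ?d A \<in> ?d ` sets \<mu>"
      by (intro image_eqI[of _ _ "space \<mu> - A"]) (auto simp: compl)
  next
    fix A assume "A \<in> sets \<mu>"
    then show "?d A \<in> (\<lambda>A. - ?d A) ` sets \<mu>"
      by (intro image_eqI[of _ _ "space \<mu> - A"]) (auto simp: compl)
  qed
  then have "(INF A\<in>sets \<mu>. ?d A) = - (SUP A\<in>sets \<mu>. ?d A)"
    by (simp add: Inf_real_def image_image)
  then show ?thesis by (simp add: tv_dist_def tv_norm_def)
qed

lemma measure_diff_le_tv_dist: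
  assumes "prob_space \<mu>" "prob_space \<nu>" "sets \<nu> = sets \<mu>" "A \<in> sets \<mu>"
  shows "measure \<mu> A - measure \<nu> A \<le> tv_dist \<mu> \<nu>"
proof -
  interpret \<mu>: prob_space \<mu> by fact
  show ?thesis unfolding tv_dist_eq_SUP[OF assms(1-3)]
    by (rule cSUP_upper[OF assms(4)], rule bdd_aboveI[of _ 1])
       (auto intro!: prob_diff_le_1 assms)
qed

lemma tv_dist_leI:
  assumes "prob_space \<mu>" "prob_space \<nu>" "sets \<nu> = sets \<mu>"
    and "\<And>A. A \<in> sets \<mu> \<Longrightarrow> measure \<mu> A - measure \<nu> A \<le> c"
  shows "tv_dist \<mu> \<nu> \<le> c"
  unfolding tv_dist_eq_SUP[OF assms(1-3)] by (rule cSUP_least) (use assms(4) in auto)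

lemma tv_dist_nonneg:
  assumes "prob_space \<mu>" "prob_space \<nu>" "sets \<nu> = sets \<mu>"
  shows "0 \<le> tv_dist \<mu> \<nu>"
  using measure_diff_le_tv_dist[OF assms, of "{}"] by simp

lemma tv_dist_le_1:
  assumes "prob_space \<mu>" "prob_space \<nu>" "sets \<nu> = sets \<mu>"
  shows "tv_dist \<mu> \<nu> \<le> 1"
  by (rule tv_dist_leI[OF assms]) (rule prob_diff_le_1[OF assms(1)])

text \<open>The convex combination of \<open>\<mu>\<close> and \<open>\<nu>\<close> with weights
  \<open>\<epsilon>\<close> and \<open>1 - \<epsilon>\<close>. Written as a coin toss followed by a
  draw, it is a probability measure by the general facts on \<open>bind\<close>.\<close>

definition mix :: "real \<Rightarrow> 'b measure \<Rightarrow> 'b measure \<Rightarrow> 'b measure" where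
  "mix \<epsilon> \<mu> \<nu> = measure_pmf (bernoulli_pmf \<epsilon>) \<bind> (\<lambda>b. if b then \<mu> else \<nu>)"

context
  fixes \<epsilon> :: real and M \<mu> \<nu> :: "'b measure"
  assumes eps: "0 \<le> \<epsilon>" "\<epsilon> \<le> 1"
    and \<mu>: "\<mu> \<in> space (prob_algebra M)" and \<nu>: "\<nu> \<in> space (prob_algebra M)"
begin

private lemma mix_kernel: "(\<lambda>b. if b then \<mu> else \<nu>) \<in> measure_pmf (bernoulli_pmf \<epsilon>) \<rightarrow>\<^sub>M prob_algebra M"
  using \<mu> \<nu> by auto

lemma mix_in_prob_algebra: "mix \<epsilon> \<mu> \<nu> \<in> space (prob_algebra M)"
proof -
  have "measure_pmf (bernoulli_pmf \<epsilon>) \<in> space (prob_algebra (measure_pmf (bernoulli_pmf \<epsilon>)))"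
    by (auto simp: space_prob_algebra measure_pmf.prob_space_axioms)
  from sets_bind'[OF this mix_kernel] prob_space_bind'[OF this mix_kernel]
  show ?thesis by (simp add: mix_def space_prob_algebra)
qed

lemma emeasure_mix:
  assumes "A \<in> sets M"
  shows "emeasure (mix \<epsilon> \<mu> \<nu>) A = ennreal \<epsilon> * emeasure \<mu> A + ennreal (1 - \<epsilon>) * emeasure \<nu> A"
  unfolding mix_def
  by (subst emeasure_bind[OF _ measurable_prob_algebraD[OF mix_kernel] assms])
     (auto simp: nn_integral_measure_pmf_support[of UNIV] UNIV_bool eps mult.commute)

lemma measure_mix:
  assumes "A \<in> sets M"
  shows "measure (mix \<epsilon> \<mu> \<nu>) A = \<epsilon> * measure \<mu> A + (1 - \<epsilon>) * measure \<nu> A"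
proof -
  have "prob_space \<mu>" "prob_space \<nu>" "prob_space (mix \<epsilon> \<mu> \<nu>)"
    using \<mu> \<nu> mix_in_prob_algebra by (auto simp: space_prob_algebra)
  then have "ennreal (measure (mix \<epsilon> \<mu> \<nu>) A) = ennreal (\<epsilon> * measure \<mu> A + (1 - \<epsilon>) * measure \<nu> A)"
    using emeasure_mix[OF assms] eps
    by (simp add: finite_measure.emeasure_eq_measure prob_space_def ennreal_mult)
  then show ?thesis using eps by (subst (asm) ennreal_inj) auto
qed

end

lemma measurable_mix:
  assumes "0 \<le> \<epsilon>" "\<epsilon> \<le> 1" and f: "f \<in> N \<rightarrow>\<^sub>M prob_algebra M" and g: "g \<in> N \<rightarrow>\<^sub>M prob_algebra M"
  shows "(\<lambda>x. mix \<epsilon> (f x) (g x)) \<in> N \<rightarrow>\<^sub>M prob_algebra M"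
proof (rule measurable_prob_algebraI)
  note [measurable] = measurable_prob_algebraD[OF f] measurable_prob_algebraD[OF g]
  have in_space: "f x \<in> space (prob_algebra M)" "g x \<in> space (prob_algebra M)" if "x \<in> space N" for x
    using measurable_space[OF f that] measurable_space[OF g that] by auto
  note mix = mix_in_prob_algebra[OF assms(1,2) in_space]
  show "prob_space (mix \<epsilon> (f x) (g x))" if "x \<in> space N" for x
    using mix[OF that that] by (simp add: space_prob_algebra)
  show "(\<lambda>x. mix \<epsilon> (f x) (g x)) \<in> N \<rightarrow>\<^sub>M subprob_algebra M"
  proof (rule measurable_subprob_algebra)
    show "subprob_space (mix \<epsilon> (f x) (g x))" "sets (mix \<epsilon> (f x) (g x)) = sets M" if "x \<in> space N" for x
      using mix[OF that that] by (auto simp: space_prob_algebra prob_space_imp_subprob_space)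
    fix A assume [measurable]: "A \<in> sets M"
    have "(\<lambda>x. ennreal \<epsilon> * emeasure (f x) A + ennreal (1 - \<epsilon>) * emeasure (g x) A) \<in> borel_measurable N"
      by measurable
    then show "(\<lambda>x. emeasure (mix \<epsilon> (f x) (g x)) A) \<in> borel_measurable N"
      by (subst measurable_cong[OF emeasure_mix[OF assms(1,2) in_space]]) auto
  qed
qed

text \<open>The common component cancels in every difference and leaves the factor
  \<open>1 - \<epsilon>\<close>. For this reason the perturbed kernels inherit the bound
  \<open>\<kappa>\<close>.\<close>

lemma tv_dist_mix_le:
  assumes eps: "0 \<le> \<epsilon>" "\<epsilon> \<le> 1"
    and "\<rho> \<in> space (prob_algebra M)" "\<mu> \<in> space (prob_algebra M)" "\<nu> \<in> space (prob_algebra M)"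
  shows "tv_dist (mix \<epsilon> \<rho> \<mu>) (mix \<epsilon> \<rho> \<nu>) \<le> tv_dist \<mu> \<nu>"
proof (rule tv_dist_leI)
  note mix = mix_in_prob_algebra[OF eps assms(3,4)] mix_in_prob_algebra[OF eps assms(3,5)]
  show "prob_space (mix \<epsilon> \<rho> \<mu>)" "prob_space (mix \<epsilon> \<rho> \<nu>)" "sets (mix \<epsilon> \<rho> \<nu>) = sets (mix \<epsilon> \<rho> \<mu>)"
    using mix by (auto simp: space_prob_algebra)
  fix A assume "A \<in> sets (mix \<epsilon> \<rho> \<mu>)"
  then have A: "A \<in> sets M" "A \<in> sets \<mu>"
    using mix assms by (auto simp: space_prob_algebra)
  have p: "prob_space \<mu>" "prob_space \<nu>" "sets \<nu> = sets \<mu>" using assms by (auto simp: space_prob_algebra)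
  have "measure (mix \<epsilon> \<rho> \<mu>) A - measure (mix \<epsilon> \<rho> \<nu>) A = (1 - \<epsilon>) * (measure \<mu> A - measure \<nu> A)"
    by (simp add: measure_mix[OF eps assms(3,4) A(1)] measure_mix[OF eps assms(3,5) A(1)] algebra_simps)
  also have "\<dots> \<le> (1 - \<epsilon>) * tv_dist \<mu> \<nu>"
    using eps measure_diff_le_tv_dist[OF p A(2)] by (intro mult_left_mono) auto
  also have "\<dots> \<le> 1 * tv_dist \<mu> \<nu>"
    using eps tv_dist_nonneg[OF p] by (intro mult_right_mono) auto
  finally show "measure (mix \<epsilon> \<rho> \<mu>) A - measure (mix \<epsilon> \<rho> \<nu>) A \<le> tv_dist \<mu> \<nu>" by simp
qed

text \<open>The common part is the minimum of the densities with respect to \<open>(\<mu> + \<nu>) / 2\<close>.\<close>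

lemma tv_dist_common_part:
  assumes "prob_space \<mu>" "prob_space \<nu>" and s: "sets \<nu> = sets \<mu>" and tv: "tv_dist \<mu> \<nu> \<le> a"
  obtains \<sigma> where "sets \<sigma> = sets \<mu>" "\<sigma> \<le> \<mu>" "\<sigma> \<le> \<nu>" "1 - a \<le> measure \<sigma> (space \<sigma>)"
proof -
  interpret \<mu>: prob_space \<mu> by fact
  interpret \<nu>: prob_space \<nu> by fact
  define \<beta> where "\<beta> = mix (1/2) \<mu> \<nu>"
  have sp: "space \<nu> = space \<mu>" by (rule sets_eq_imp_space_eq) fact
  have in_sp: "\<mu> \<in> space (prob_algebra \<mu>)" "\<nu> \<in> space (prob_algebra \<mu>)"
    using s by (auto simp: space_prob_algebra \<mu>.prob_space_axioms \<nu>.prob_space_axioms)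
  have \<beta>: "\<beta> \<in> space (prob_algebra \<mu>)"
    unfolding \<beta>_def by (rule mix_in_prob_algebra) (use in_sp in auto)
  then interpret \<beta>: prob_space \<beta> by (simp add: space_prob_algebra)
  have [simp]: "sets \<beta> = sets \<mu>" using \<beta> by (simp add: space_prob_algebra)
  then have [simp]: "space \<beta> = space \<mu>" by (rule sets_eq_imp_space_eq)
  have em: "emeasure \<beta> A = ennreal (1/2) * emeasure \<mu> A + ennreal (1 - 1/2) * emeasure \<nu> A" if "A \<in> sets \<mu>" for A
    unfolding \<beta>_def by (rule emeasure_mix) (use in_sp that in auto)
  have ac: "absolutely_continuous \<beta> \<mu>" "absolutely_continuous \<beta> \<nu>"
    unfolding absolutely_continuous_def by (auto simp: null_sets_def em s)
  define f where "f = RN_deriv \<beta> \<mu>"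
  define f' where "f' = RN_deriv \<beta> \<nu>"
  have [measurable]: "f \<in> borel_measurable \<beta>" "f' \<in> borel_measurable \<beta>" by (auto simp: f_def f'_def)
  have df: "density \<beta> f = \<mu>" "density \<beta> f' = \<nu>"
    unfolding f_def f'_def by (auto intro!: \<beta>.density_RN_deriv ac simp: s)
  have ef: "emeasure \<mu> A = (\<integral>\<^sup>+x. f x * indicator A x \<partial>\<beta>)" "emeasure \<nu> A = (\<integral>\<^sup>+x. f' x * indicator A x \<partial>\<beta>)"
    if "A \<in> sets \<mu>" for A
    using that by (subst df[symmetric], subst emeasure_density; simp)+
  define \<sigma> where "\<sigma> = density \<beta> (\<lambda>x. min (f x) (f' x))"
  have s\<sigma>: "sets \<sigma> = sets \<mu>" "space \<sigma> = space \<mu>" by (auto simp: \<sigma>_def)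
  have es: "emeasure \<sigma> A = (\<integral>\<^sup>+x. min (f x) (f' x) * indicator A x \<partial>\<beta>)" if "A \<in> sets \<mu>" for A
    unfolding \<sigma>_def using that by (subst emeasure_density) auto
  have le1: "emeasure \<sigma> A \<le> emeasure \<mu> A" for A
    by (cases "A \<in> sets \<mu>")
       (auto simp: es ef emeasure_notin_sets s\<sigma> intro!: nn_integral_mono mult_right_mono)
  have le2: "emeasure \<sigma> A \<le> emeasure \<nu> A" for A
    by (cases "A \<in> sets \<mu>")
       (auto simp: es ef emeasure_notin_sets s\<sigma> intro!: nn_integral_mono mult_right_mono)
  \<comment> \<open>On \<open>D\<close> the minimum is \<open>f\<close>, off \<open>D\<close> it is
    \<open>f'\<close>. So \<open>\<sigma>\<close> has mass
    \<open>\<mu> D + \<nu> ?E = 1 - (\<mu> ?E - \<nu> ?E)\<close>, and the difference in brackets is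
    at most the total variation.\<close>
  define D where "D = {x \<in> space \<beta>. f x \<le> f' x}"
  have D[measurable]: "D \<in> sets \<mu>"
  proof -
    have "D \<in> sets \<beta>" unfolding D_def by measurable
    then show ?thesis by simp
  qed
  let ?E = "space \<mu> - D"
  have "emeasure \<sigma> (space \<mu>) = (\<integral>\<^sup>+x. f x * indicator D x + f' x * indicator ?E x \<partial>\<beta>)"
    unfolding es[OF sets.top] by (rule nn_integral_cong) (auto simp: D_def indicator_def min_def)
  also have "\<dots> = emeasure \<mu> D + emeasure \<nu> ?E"
  proof (subst nn_integral_add)
    have [measurable]: "D \<in> sets \<beta>" "?E \<in> sets \<beta>" using D by auto
    show "(\<lambda>x. f x * indicator D x) \<in> borel_measurable \<beta>"
      "(\<lambda>x. f' x * indicator ?E x) \<in> borel_measurable \<beta>" by measurable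
  qed (use D in \<open>auto simp: ef\<close>)
  finally have "emeasure \<sigma> (space \<sigma>) = ennreal (measure \<mu> D + measure \<nu> ?E)"
    by (simp add: s\<sigma> \<mu>.emeasure_eq_measure \<nu>.emeasure_eq_measure)
  then have "measure \<sigma> (space \<sigma>) = measure \<mu> D + measure \<nu> ?E"
    by (intro measure_eq_emeasure_eq_ennreal) auto
  moreover have "measure \<mu> ?E - measure \<nu> ?E \<le> a"
    using measure_diff_le_tv_dist[OF assms(1,2,3), of ?E] D tv by auto
  moreover have "measure \<mu> ?E = 1 - measure \<mu> D" by (rule \<mu>.prob_compl[OF D])
  ultimately have "1 - a \<le> measure \<sigma> (space \<sigma>)" by simp
  moreover have "\<sigma> \<le> \<mu>" "\<sigma> \<le> \<nu>"
    using le1 le2 by (auto simp: le_measure_iff s\<sigma> sp s le_fun_def)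
  ultimately show thesis using that s\<sigma>(1) by blast
qed

section \<open>Comparison of measures and contraction by product kernels\<close>

lemma measure_leI:
  assumes "sets M = sets N" "\<And>A. A \<in> sets M \<Longrightarrow> emeasure M A \<le> emeasure N A"
  shows "M \<le> N"
proof -
  have "emeasure M A \<le> emeasure N A" for A
    using assms by (cases "A \<in> sets M") (auto simp: emeasure_notin_sets)
  then show ?thesis
    using assms(1) sets_eq_imp_space_eq[OF assms(1)] by (simp add: le_measure_iff le_fun_def)
qed

lemma emeasure_le_of_measure_le:
  assumes "sets M = sets N" "M \<le> N"
  shows "emeasure M A \<le> emeasure N A"
  using assms sets_eq_imp_space_eq[OF assms(1)] by (simp add: le_measure_iff le_fun_def)

lemma finite_measure_of_le:
  assumes "sets M = sets N" "M \<le> N" "finite_measure N"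
  shows "finite_measure M"
  using emeasure_le_of_measure_le[OF assms(1,2), of "space N"] sets_eq_imp_space_eq[OF assms(1)]
    finite_measure.emeasure_finite[OF assms(3), of "space N"]
  by (intro finite_measureI) (auto simp: top_unique)

text \<open>Lets the product of two common parts serve as a common part of two product measures. The
  factors are enlarged one at a time in the iterated integral.\<close>

lemma pair_measure_mono:
  assumes s: "sets M = sets M'" "sets N = sets N'" and le: "M \<le> M'" "N \<le> N'"
    and fin: "finite_measure M'" "finite_measure N'"
  shows "M \<Otimes>\<^sub>M N \<le> M' \<Otimes>\<^sub>M N'"
proof (rule measure_leI)
  show sp: "sets (M \<Otimes>\<^sub>M N) = sets (M' \<Otimes>\<^sub>M N')" by (rule sets_pair_measure_cong[OF s])
  interpret N: finite_measure N by (rule finite_measure_of_le[OF s(2) le(2) fin(2)])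
  interpret N': finite_measure N' by fact
  fix A assume A: "A \<in> sets (M \<Otimes>\<^sub>M N)"
  have "emeasure (M \<Otimes>\<^sub>M N) A = (\<integral>\<^sup>+x. \<integral>\<^sup>+y. indicator A (x, y) \<partial>N \<partial>M)"
    by (rule N.emeasure_pair_measure[OF A])
  also have "\<dots> \<le> (\<integral>\<^sup>+x. \<integral>\<^sup>+y. indicator A (x, y) \<partial>N' \<partial>M)"
    by (intro nn_integral_mono nn_integral_mono_measure s le)
  also have "\<dots> \<le> (\<integral>\<^sup>+x. \<integral>\<^sup>+y. indicator A (x, y) \<partial>N' \<partial>M')"
    by (intro nn_integral_mono_measure s le)
  also have "\<dots> = emeasure (M' \<Otimes>\<^sub>M N') A"
    using A sp by (intro N'.emeasure_pair_measure[symmetric]) simp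
  finally show "emeasure (M \<Otimes>\<^sub>M N) A \<le> emeasure (M' \<Otimes>\<^sub>M N') A" .
qed

lemma integral_mono_measure_real:
  fixes u :: "'b \<Rightarrow> real"
  assumes s: "sets M = sets N" and le: "M \<le> N" and u: "u \<in> borel_measurable N" "\<And>x. x \<in> space N \<Longrightarrow> 0 \<le> u x"
    and int: "integrable N u"
  shows "integral\<^sup>L M u \<le> integral\<^sup>L N u"
proof -
  note sp = sets_eq_imp_space_eq[OF s]
  have um: "u \<in> borel_measurable M" using u(1) measurable_cong_sets[OF s refl] by blast
  have "integral\<^sup>L M u = enn2real (\<integral>\<^sup>+x. ennreal (u x) \<partial>M)"
    using u um sp by (intro integral_eq_nn_integral) (auto intro!: AE_I2)
  \<comment> \<open>\<open>enn2real\<close> is monotone only below \<open>top\<close>, which it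
    sends to 0. Integrability under \<open>N\<close> excludes that value.\<close>
  also have "\<dots> \<le> enn2real (\<integral>\<^sup>+x. ennreal (u x) \<partial>N)"
  proof (rule enn2real_mono)
    have "(\<integral>\<^sup>+x. ennreal (u x) \<partial>N) = (\<integral>\<^sup>+x. ennreal (norm (u x)) \<partial>N)"
      using u by (intro nn_integral_cong) auto
    then show "(\<integral>\<^sup>+x. ennreal (u x) \<partial>N) < top"
      using int by (auto simp: integrable_iff_bounded)
  qed (intro nn_integral_mono_measure s le)
  also have "\<dots> = integral\<^sup>L N u"
    using u by (intro integral_eq_nn_integral[symmetric]) (auto intro!: AE_I2)
  finally show ?thesis .
qed

text \<open>With \<open>a\<close> the infimum of \<open>h\<close>, both \<open>a + d - h\<close> and
  \<open>h - a\<close> are nonnegative. The first integrates to no more under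
  \<open>\<sigma>\<close> than under \<open>P\<close>, the second to no more than under
  \<open>P'\<close>. Adding the two inequalities cancels the integral of \<open>h\<close> under
  \<open>\<sigma>\<close> and leaves \<open>d\<close> times the mass that \<open>\<sigma>\<close>
  lacks.\<close>

lemma integral_diff_le_common_part:
  fixes h :: "'b \<Rightarrow> real"
  assumes "prob_space P" "prob_space P'" and s: "sets P' = sets P" "sets \<sigma> = sets P"
    and le: "\<sigma> \<le> P" "\<sigma> \<le> P'" and mass: "1 - t \<le> measure \<sigma> (space \<sigma>)"
    and h: "h \<in> borel_measurable P" "\<And>z. z \<in> space P \<Longrightarrow> 0 \<le> h z"
    and d: "\<And>z z'. z \<in> space P \<Longrightarrow> z' \<in> space P \<Longrightarrow> h z - h z' \<le> d"
  shows "integral\<^sup>L P h - integral\<^sup>L P' h \<le> t * d"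
proof -
  interpret P: prob_space P by fact
  interpret P': prob_space P' by fact
  interpret \<sigma>: finite_measure \<sigma>
    by (rule finite_measure_of_le[OF s(2) le(1)]) unfold_locales
  note sp = sets_eq_imp_space_eq[OF s(1)] sets_eq_imp_space_eq[OF s(2)]
  obtain z0 where z0: "z0 \<in> space P" using P.not_empty by auto
  define a where "a = (INF z\<in>space P. h z)"
  have "bdd_below (h ` space P)" using h by (auto intro!: bdd_belowI[of _ 0])
  then have ah: "a \<le> h z" if "z \<in> space P" for z
    unfolding a_def using that by (rule cINF_lower)
  have hd: "h z \<le> a + d" if "z \<in> space P" for z
  proof -
    have "h z - d \<le> a"
      unfolding a_def using z0 that d by (intro cINF_greatest) (auto simp: algebra_simps)
    then show ?thesis by simp
  qed
  have d0: "0 \<le> d" using d[OF z0 z0] by simp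
  have hm: "h \<in> borel_measurable P" "h \<in> borel_measurable P'" "h \<in> borel_measurable \<sigma>"
    using h(1) measurable_cong_sets[OF s(1) refl] measurable_cong_sets[OF s(2) refl] by blast+
  have bd: "\<bar>h z\<bar> \<le> a + d" if "z \<in> space P" for z
    using h(2)[OF that] hd[OF that] by simp
  have int: "integrable P h" "integrable P' h" "integrable \<sigma> h"
    using hm bd sp
    by (auto intro!: P.integrable_const_bound[of _ "a + d"] P'.integrable_const_bound[of _ "a + d"]
        \<sigma>.integrable_const_bound[of _ "a + d"] AE_I2)
  let ?m = "measure \<sigma> (space \<sigma>)"
  have "integral\<^sup>L \<sigma> (\<lambda>z. a + d - h z) \<le> integral\<^sup>L P (\<lambda>z. a + d - h z)"
    using int hm hd by (intro integral_mono_measure_real s le) auto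
  then have "(a + d) * ?m - integral\<^sup>L \<sigma> h \<le> a + d - integral\<^sup>L P h"
    using int by (simp add: P.prob_space mult.commute)
  moreover have "integral\<^sup>L \<sigma> (\<lambda>z. h z - a) \<le> integral\<^sup>L P' (\<lambda>z. h z - a)"
    using int hm ah s sp by (intro integral_mono_measure_real le) auto
  then have "integral\<^sup>L \<sigma> h - a * ?m \<le> integral\<^sup>L P' h - a"
    using int by (simp add: P'.prob_space mult.commute)
  ultimately have "integral\<^sup>L P h - integral\<^sup>L P' h \<le> (1 - ?m) * d" by (simp add: algebra_simps)
  also have "\<dots> \<le> t * d" using mass d0 by (intro mult_right_mono) auto
  finally show ?thesis .
qed

text \<open>The origin of \<open>theta\<close>: the product of the two common parts has mass at
  least \<open>(1 - a) * (1 - b)\<close>, so it lacks at most \<open>a + b - a * b\<close>.\<close>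

lemma pair_integral_diff_le:
  fixes h :: "'b \<times> 'c \<Rightarrow> real"
  assumes p: "prob_space \<mu>" "prob_space \<mu>'" "sets \<mu>' = sets \<mu>" "tv_dist \<mu> \<mu>' \<le> a" "a \<le> 1"
    and q: "prob_space \<nu>" "prob_space \<nu>'" "sets \<nu>' = sets \<nu>" "tv_dist \<nu> \<nu>' \<le> b" "b \<le> 1"
    and h: "h \<in> borel_measurable (\<mu> \<Otimes>\<^sub>M \<nu>)" "\<And>z. z \<in> space (\<mu> \<Otimes>\<^sub>M \<nu>) \<Longrightarrow> 0 \<le> h z"
    and d: "\<And>z z'. z \<in> space (\<mu> \<Otimes>\<^sub>M \<nu>) \<Longrightarrow> z' \<in> space (\<mu> \<Otimes>\<^sub>M \<nu>) \<Longrightarrow> h z - h z' \<le> d"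
  shows "integral\<^sup>L (\<mu> \<Otimes>\<^sub>M \<nu>) h - integral\<^sup>L (\<mu>' \<Otimes>\<^sub>M \<nu>') h \<le> (a + b - a * b) * d"
proof -
  interpret \<mu>: prob_space \<mu> by fact
  interpret \<mu>': prob_space \<mu>' by fact
  interpret \<nu>: prob_space \<nu> by fact
  interpret \<nu>': prob_space \<nu>' by fact
  interpret pair_prob_space \<mu> \<nu> ..
  interpret p': pair_prob_space \<mu>' \<nu>' ..
  obtain \<sigma> where \<sigma>: "sets \<sigma> = sets \<mu>" "\<sigma> \<le> \<mu>" "\<sigma> \<le> \<mu>'" "1 - a \<le> measure \<sigma> (space \<sigma>)"
    by (rule tv_dist_common_part[OF p(1-4)])
  obtain \<tau> where \<tau>: "sets \<tau> = sets \<nu>" "\<tau> \<le> \<nu>" "\<tau> \<le> \<nu>'" "1 - b \<le> measure \<tau> (space \<tau>)"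
    by (rule tv_dist_common_part[OF q(1-4)])
  interpret \<sigma>: finite_measure \<sigma> by (rule finite_measure_of_le[OF \<sigma>(1,2)]) unfold_locales
  interpret \<tau>: finite_measure \<tau> by (rule finite_measure_of_le[OF \<tau>(1,2)]) unfold_locales
  have "(1 - a) * (1 - b) \<le> measure \<sigma> (space \<sigma>) * measure \<tau> (space \<tau>)"
    using p(5) q(5) \<sigma>(4) \<tau>(4) by (intro mult_mono) auto
  also have "\<dots> = measure (\<sigma> \<Otimes>\<^sub>M \<tau>) (space \<sigma> \<times> space \<tau>)"
    by (simp add: measure_def \<tau>.emeasure_pair_measure_Times enn2real_mult)
  finally have m: "1 - (a + b - a * b) \<le> measure (\<sigma> \<Otimes>\<^sub>M \<tau>) (space (\<sigma> \<Otimes>\<^sub>M \<tau>))"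
    by (simp add: space_pair_measure algebra_simps)
  show ?thesis
    by (rule integral_diff_le_common_part[OF _ _ _ _ _ _ m])
       (use h d \<sigma> \<tau> p q in \<open>auto intro!: pair_measure_mono sets_pair_measure_cong
         prob_space_axioms p'.prob_space_axioms \<mu>.finite_measure_axioms \<mu>'.finite_measure_axioms
         \<nu>.finite_measure_axioms \<nu>'.finite_measure_axioms\<close>)
qed

section \<open>Disintegration over a Polish space\<close>

text \<open>Close up in countably many stages; the stages increase, so any two members lie in a
  common one. It is used to make a countable algebra that also contains chosen compact approximants
  of its members.\<close>

lemma countable_closed_family:
  fixes F :: "nat \<Rightarrow> 'b \<Rightarrow> 'b \<Rightarrow> 'b"
  assumes "countable S" "S \<subseteq> T" and F: "\<And>k a b. a \<in> T \<Longrightarrow> b \<in> T \<Longrightarrow> F k a b \<in> T"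
  obtains \<A> where "countable \<A>" "S \<subseteq> \<A>" "\<A> \<subseteq> T" "\<And>k a b. a \<in> \<A> \<Longrightarrow> b \<in> \<A> \<Longrightarrow> F k a b \<in> \<A>"
proof -
  define C where "C = rec_nat S (\<lambda>_ X. X \<union> (\<lambda>(k, a, b). F k a b) ` (UNIV \<times> X \<times> X))"
  have C: "C 0 = S" "C (Suc t) = C t \<union> (\<lambda>(k, a, b). F k a b) ` (UNIV \<times> C t \<times> C t)" for t
    by (simp_all add: C_def)
  have cnt: "countable (C t)" for t
    by (induction t) (auto simp: C assms(1))
  have sub: "C t \<subseteq> T" for t
  proof (induction t)
    case (Suc t)
    then show ?case using F by (auto simp: C subset_iff)
  qed (use assms(2) in \<open>simp add: C\<close>)
  have "mono C" by (rule monoI, rule lift_Suc_mono_le[of C]) (auto simp: C)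
  then have mono: "C s \<subseteq> C t" if "s \<le> t" for s t using that by (auto dest: monoD)
  show thesis
  proof
    show "countable (\<Union>t. C t)" using cnt by auto
    show "S \<subseteq> (\<Union>t. C t)" using C(1) by blast
    show "(\<Union>t. C t) \<subseteq> T" using sub by blast
    fix k a b assume "a \<in> (\<Union>t. C t)" "b \<in> (\<Union>t. C t)"
    then obtain s t where "a \<in> C s" "b \<in> C t" by blast
    then have "a \<in> C (max s t)" "b \<in> C (max s t)"
      using mono[of s "max s t"] mono[of t "max s t"] by auto
    then have "F k a b \<in> C (Suc (max s t))" by (force simp: C)
    then show "F k a b \<in> (\<Union>t. C t)" by blast
  qed
qed

text \<open>Compact inner approximation within the algebra gives continuity at the empty set, hence
  Caratheodory's theorem applies.\<close>

lemma prob_measure_extension_compact: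
  fixes p :: "'y::t2_space set \<Rightarrow> ennreal"
  assumes alg: "algebra UNIV \<A>" and gen: "sets borel = sigma_sets UNIV \<A>"
    and add: "\<And>A B. A \<in> \<A> \<Longrightarrow> B \<in> \<A> \<Longrightarrow> A \<inter> B = {} \<Longrightarrow> p (A \<union> B) = p A + p B"
    and one: "p UNIV = 1"
    and cpt: "\<And>A e. A \<in> \<A> \<Longrightarrow> 0 < e \<Longrightarrow> \<exists>C\<in>\<A>. C \<subseteq> A \<and> compact C \<and> p (A - C) \<le> ennreal e"
  obtains \<nu> where "sets \<nu> = sets borel" "prob_space \<nu>" "\<And>A. A \<in> \<A> \<Longrightarrow> emeasure \<nu> A = p A"
proof -
  interpret algebra UNIV \<A> by fact
  have le1: "p A \<le> 1" if "A \<in> \<A>" for A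
  proof -
    have "p A + p (UNIV - A) = 1" using add[OF that compl_sets[OF that]] one by (simp add: Un_Diff_cancel)
    moreover have "p A \<le> p A + p (UNIV - A)" by simp
    ultimately show ?thesis by simp
  qed
  have p0: "p {} = 0"
  proof -
    have "p {} = p {} + p {}" using add[of "{}" "{}"] by simp
    moreover have "p {} \<noteq> top" using le1[of "{}"] by (auto simp: top_unique)
    ultimately show ?thesis using ennreal_add_left_cancel[of "p {}" 0 "p {}"] by simp
  qed
  have pos: "positive \<A> p" by (simp add: positive_def p0)
  have addp: "additive \<A> p" by (auto simp: additive_def add)
  have incr: "increasing \<A> p" by (rule additive_increasing[OF pos addp])
  have "\<exists>\<mu>. (\<forall>s\<in>\<A>. \<mu> s = p s) \<and> measure_space UNIV (sigma_sets UNIV \<A>) \<mu>"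
  proof (rule caratheodory_empty_continuous[OF pos addp])
    show "p A \<noteq> \<infinity>" if "A \<in> \<A>" for A using le1[OF that] by (auto simp: top_unique)
    fix A :: "nat \<Rightarrow> 'y set" assume A: "range A \<subseteq> \<A>" "decseq A" "(\<Inter>i. A i) = {}"
    show "(\<lambda>i. p (A i)) \<longlonglongrightarrow> 0"
    proof (rule order_tendstoI)
      fix a :: ennreal assume "0 < a"
      then obtain e' where e': "0 < e'" "e' < a" using dense by blast
      then obtain e where e: "e' = ennreal e" "0 < e" by (cases e') auto
      \<comment> \<open>The tolerances are halved from set to set so that finitely many of them
        always add up to at most \<open>e\<close>.\<close>
      have "\<exists>C\<in>\<A>. C \<subseteq> A i \<and> compact C \<and> p (A i - C) \<le> ennreal (e * (1/2) ^ Suc i)" for i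
        using A(1) e by (intro cpt) auto
      then obtain C where C: "\<And>i. C i \<in> \<A>" "\<And>i. C i \<subseteq> A i" "\<And>i. compact (C i)"
          "\<And>i. p (A i - C i) \<le> ennreal (e * (1/2) ^ Suc i)" by metis
      \<comment> \<open>The whole intersection of the compact sets lies in that of the
        \<open>A i\<close>, which is empty; by compactness a finite intersection is empty
        already.\<close>
      have "\<exists>N. (\<Inter>i\<le>N. C i) = {}"
      proof (rule ccontr)
        assume none: "\<not> ?thesis"
        have "C 0 \<inter> (\<Inter>i. C i) \<noteq> {}"
        proof (rule compact_imp_fip_image)
          show "compact (C 0)" "\<And>i. i \<in> UNIV \<Longrightarrow> closed (C i)" using C(3) compact_imp_closed by auto
          fix I :: "nat set" assume "finite I"
          then obtain N where "\<forall>i\<in>I. i \<le> N" using finite_nat_set_iff_bounded_le by blast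
          then have "(\<Inter>i\<le>N. C i) \<subseteq> C 0 \<inter> (\<Inter>i\<in>I. C i)" by auto
          then show "C 0 \<inter> (\<Inter>i\<in>I. C i) \<noteq> {}" using none by blast
        qed
        moreover have "(\<Inter>i. C i) \<subseteq> (\<Inter>i. A i)" using C(2) by (rule INF_mono')
        ultimately show False unfolding A(3) by simp
      qed
      then obtain N where N: "(\<Inter>i\<le>N. C i) = {}" by blast
      have "p (A n) < a" if "n \<ge> N" for n
      proof -
        have "A n \<subseteq> A N" using A(2) that by (auto dest: decseqD)
        \<comment> \<open>Every point misses some \<open>C i\<close> with \<open>i \<le> N\<close>,
          and a point of \<open>A N\<close> belongs to that \<open>A i\<close>.\<close>
        also have "A N \<subseteq> (\<Union>i\<le>N. A i - C i)"
        proof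
          fix x assume x: "x \<in> A N"
          from N obtain i where "i \<le> N" "x \<notin> C i" by blast
          moreover have "x \<in> A i" using decseqD[OF A(2) \<open>i \<le> N\<close>] x by blast
          ultimately show "x \<in> (\<Union>i\<le>N. A i - C i)" by blast
        qed
        finally have sub: "A n \<subseteq> (\<Union>i\<le>N. A i - C i)" .
        have AC: "A i - C i \<in> \<A>" for i using A(1) C(1) by (intro Diff) auto
        have "p (A n) \<le> p (\<Union>i\<le>N. A i - C i)"
          using A(1) AC by (intro increasingD[OF incr sub] finite_UN) auto
        also have "\<dots> \<le> (\<Sum>i\<le>N. p (A i - C i))"
          using AC by (intro subadditive pos addp) auto
        also have "\<dots> \<le> (\<Sum>i\<le>N. ennreal (e * (1/2) ^ Suc i))"
          by (intro sum_mono C)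
        also have "\<dots> = ennreal (e * (\<Sum>i\<le>N. (1/2) ^ Suc i))"
          using e by (subst sum_ennreal) (auto simp: sum_distrib_left)
        also have "\<dots> \<le> ennreal (e * 1)"
        proof (intro ennreal_leI mult_left_mono)
          have "(\<Sum>i\<in>{..N}. (1/2::real) ^ Suc i) \<le> (\<Sum>i. (1/2) ^ Suc i)"
            by (rule sum_le_suminf) (use power_half_series in \<open>auto simp: sums_iff\<close>)
          then show "(\<Sum>i\<le>N. (1/2::real) ^ Suc i) \<le> 1" using power_half_series by (simp add: sums_iff)
        qed (use e in auto)
        also have "\<dots> < a" using e e' by simp
        finally show ?thesis .
      qed
      then show "eventually (\<lambda>n. p (A n) < a) sequentially"
        by (auto simp: eventually_sequentially)
    qed auto
  qed
  then obtain \<mu> where \<mu>: "\<And>s. s \<in> \<A> \<Longrightarrow> \<mu> s = p s" "measure_space UNIV (sigma_sets UNIV \<A>) \<mu>" by blast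
  define \<nu> where "\<nu> = measure_of UNIV (sigma_sets UNIV \<A>) \<mu>"
  have s: "sets \<nu> = sets borel" "space \<nu> = UNIV"
    by (auto simp: \<nu>_def gen sigma_sets_sigma_sets_eq)
  have em: "emeasure \<nu> A = \<mu> A" if "A \<in> sigma_sets UNIV \<A>" for A
    unfolding \<nu>_def using \<mu>(2) that
    by (intro emeasure_measure_of_sigma) (auto simp: measure_space_def)
  show thesis
  proof
    show "prob_space \<nu>" using em[of UNIV] \<mu>(1)[of UNIV] one
      by (intro prob_spaceI) (auto simp: s sigma_sets_top)
    show "emeasure \<nu> A = p A" if "A \<in> \<A>" for A using em[of A] \<mu>(1)[OF that] that by auto
  qed fact
qed

lemma compact_inner_approximation:
  fixes \<nu> :: "'y::polish_space measure"
  assumes "finite_measure \<nu>" "sets \<nu> = sets borel" "B \<in> sets borel" "0 < e"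
  obtains C where "compact C" "C \<subseteq> B" "emeasure \<nu> (B - C) \<le> ennreal e"
proof -
  interpret finite_measure \<nu> by fact
  have ir: "emeasure \<nu> B = (SUP K \<in> {K. K \<subseteq> B \<and> compact K}. emeasure \<nu> K)"
    by (rule inner_regular) (use assms in auto)
  have "\<exists>C. C \<subseteq> B \<and> compact C \<and> measure \<nu> B - e \<le> measure \<nu> C"
  proof (cases "measure \<nu> B - e < 0")
    case True
    then show ?thesis by (intro exI[of _ "{}"]) auto
  next
    case False
    have "ennreal (measure \<nu> B - e) < ennreal (measure \<nu> B)"
      using False assms(4) by (subst ennreal_less_iff) auto
    then have "ennreal (measure \<nu> B - e) < (SUP K \<in> {K. K \<subseteq> B \<and> compact K}. emeasure \<nu> K)"
      using ir by (simp add: emeasure_eq_measure)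
    then obtain C where C: "C \<subseteq> B" "compact C" "ennreal (measure \<nu> B - e) < emeasure \<nu> C"
      by (auto simp: less_SUP_iff)
    then show ?thesis using False by (intro exI[of _ C]) (auto simp: emeasure_eq_measure ennreal_less_iff)
  qed
  then obtain C where C: "C \<subseteq> B" "compact C" "measure \<nu> B - e \<le> measure \<nu> C" by blast
  have "C \<in> sets borel" using C(2) by (simp add: borel_compact)
  then have "measure \<nu> (B - C) = measure \<nu> B - measure \<nu> C"
    using assms C by (intro finite_measure_Diff) auto
  then have "emeasure \<nu> (B - C) \<le> ennreal e"
    using C(3) by (auto simp: emeasure_eq_measure intro!: ennreal_leI)
  then show thesis using that C by blast
qed

text \<open>For fixed \<open>B\<close> the conditional probability is a Radon-Nikodym density
  \<open>p B\<close> with respect to the first marginal. These densities are chosen separately, so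
  they fit together only almost surely. On a countable generating algebra all the exceptional sets
  merge into one null set, off which \<open>p\<close> extends to a measure in each fibre.\<close>

lemma disintegration:
  fixes m :: "('x \<times> 'y::polish_space) measure" and M :: "'x measure"
  assumes "prob_space m" and sm: "sets m = sets (M \<Otimes>\<^sub>M borel)"
  obtains L where "L \<in> M \<rightarrow>\<^sub>M prob_algebra borel"
    "\<And>A B. A \<in> sets M \<Longrightarrow> B \<in> sets borel \<Longrightarrow>
      emeasure m (A \<times> B) = (\<integral>\<^sup>+x\<in>A. emeasure (L x) B \<partial>distr m M fst)"
proof -
  interpret m: prob_space m by fact
  have spm: "space m = space M \<times> UNIV"
    using sets_eq_imp_space_eq[OF sm] by (simp add: space_pair_measure)
  have fst_m[measurable]: "fst \<in> m \<rightarrow>\<^sub>M M" and snd_m[measurable]: "snd \<in> m \<rightarrow>\<^sub>M borel"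
    by (auto simp: measurable_cong_sets[OF sm refl])
  define \<mu> where "\<mu> = distr m M fst"
  have s\<mu>[measurable_cong, simp]: "sets \<mu> = sets M" by (simp add: \<mu>_def)
  have sp\<mu>[simp]: "space \<mu> = space M" by (simp add: \<mu>_def)
  interpret \<mu>: prob_space \<mu> unfolding \<mu>_def by (rule m.prob_space_distr) measurable
  define \<nu>0 where "\<nu>0 = distr m borel snd"
  interpret \<nu>0: prob_space \<nu>0 unfolding \<nu>0_def by (rule m.prob_space_distr) measurable
  have em_times: "A \<times> B \<in> sets m" if "A \<in> sets M" "B \<in> sets borel" for A B
    using that by (simp add: sm)
  have em_\<mu>: "emeasure \<mu> A = emeasure m (A \<times> UNIV)" if "A \<in> sets M" for A
    unfolding \<mu>_def using that sets.sets_into_space[OF that] by (subst emeasure_distr) (auto simp: spm intro!: arg_cong[where f = "emeasure m"])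
  have em_\<nu>0: "emeasure \<nu>0 B = emeasure m (space M \<times> B)" if "B \<in> sets borel" for B
    unfolding \<nu>0_def using that by (subst emeasure_distr) (auto simp: spm intro!: arg_cong[where f = "emeasure m"])
  have "\<exists>p\<in>borel_measurable M. \<forall>A\<in>sets M. emeasure m (A \<times> B) = (\<integral>\<^sup>+x\<in>A. p x \<partial>\<mu>)"
    if B[measurable]: "B \<in> sets borel" for B
  proof -
    \<comment> \<open>This is the measure sending \<open>A\<close> to
      \<open>m (A \<times> B)\<close>, realised as the image of \<open>m\<close> cut down to
      \<open>B\<close> in the second component.\<close>
    define \<nu> where "\<nu> = distr (density m (\<lambda>z. indicator B (snd z))) M fst"
    have em: "emeasure \<nu> A = emeasure m (A \<times> B)" if A[measurable]: "A \<in> sets M" for A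
    proof -
      have "emeasure \<nu> A = (\<integral>\<^sup>+z. indicator B (snd z) * indicator (fst -` A \<inter> space m) z \<partial>m)"
        unfolding \<nu>_def by (subst emeasure_distr) (auto simp: emeasure_density)
      also have "\<dots> = (\<integral>\<^sup>+z. indicator (A \<times> B) z \<partial>m)"
        by (rule nn_integral_cong) (auto simp: indicator_def)
      finally show ?thesis using em_times[OF A B] by simp
    qed
    have "absolutely_continuous \<mu> \<nu>"
      unfolding absolutely_continuous_def
    proof
      fix N assume N: "N \<in> null_sets \<mu>"
      then have NM: "N \<in> sets M" and "emeasure m (N \<times> UNIV) = 0" by (auto simp: null_sets_def em_\<mu>)
      moreover have "emeasure m (N \<times> B) \<le> emeasure m (N \<times> UNIV)"
        using NM by (intro emeasure_mono em_times) auto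
      ultimately show "N \<in> null_sets \<nu>" by (auto simp: null_sets_def em \<nu>_def[THEN arg_cong[where f=sets]])
    qed
    then have d: "density \<mu> (RN_deriv \<mu> \<nu>) = \<nu>"
      by (rule \<mu>.density_RN_deriv) (simp add: \<nu>_def)
    show ?thesis
    proof (intro bexI[of _ "RN_deriv \<mu> \<nu>"] ballI)
      show "RN_deriv \<mu> \<nu> \<in> borel_measurable M" using borel_measurable_RN_deriv[of \<mu> \<nu>] by simp
      fix A assume "A \<in> sets M"
      then show "emeasure m (A \<times> B) = (\<integral>\<^sup>+x\<in>A. RN_deriv \<mu> \<nu> x \<partial>\<mu>)"
        by (subst em[symmetric], simp, subst d[symmetric], subst emeasure_density) auto
    qed
  qed
  then obtain p where pm[measurable]: "\<And>B. B \<in> sets borel \<Longrightarrow> p B \<in> borel_measurable M"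
    and p: "\<And>A B. A \<in> sets M \<Longrightarrow> B \<in> sets borel \<Longrightarrow> emeasure m (A \<times> B) = (\<integral>\<^sup>+x\<in>A. p B x \<partial>\<mu>)"
    by metis
  have AE_eq: "AE x in \<mu>. f x = f' x"
    if "f \<in> borel_measurable M" "f' \<in> borel_measurable M"
      "\<And>A. A \<in> sets M \<Longrightarrow> (\<integral>\<^sup>+x\<in>A. f x \<partial>\<mu>) = (\<integral>\<^sup>+x\<in>A. f' x \<partial>\<mu>)" for f f' :: "'x \<Rightarrow> ennreal"
    using that by (intro \<mu>.density_unique_finite_measure) auto
  have add: "AE x in \<mu>. p (B \<union> C) x = p B x + p C x"
    if [measurable]: "B \<in> sets borel" "C \<in> sets borel" and "B \<inter> C = {}" for B C
  proof (rule AE_eq)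
    fix A assume [measurable]: "A \<in> sets M"
    have "(\<integral>\<^sup>+x\<in>A. p (B \<union> C) x \<partial>\<mu>) = emeasure m (A \<times> B \<union> A \<times> C)"
      by (subst p[symmetric]) (auto simp: Sigma_Un_distrib2)
    also have "\<dots> = emeasure m (A \<times> B) + emeasure m (A \<times> C)"
      using that by (intro plus_emeasure[symmetric] em_times) auto
    also have "\<dots> = (\<integral>\<^sup>+x\<in>A. (p B x + p C x) \<partial>\<mu>)"
      by (simp add: p distrib_right nn_integral_add)
    finally show "(\<integral>\<^sup>+x\<in>A. p (B \<union> C) x \<partial>\<mu>) = (\<integral>\<^sup>+x\<in>A. (p B x + p C x) \<partial>\<mu>)" .
  qed (auto simp: that)
  have one: "AE x in \<mu>. p UNIV x = 1"
    by (rule AE_eq) (auto simp: p[symmetric] em_\<mu>[symmetric])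
  \<comment> \<open>The approximants are chosen once, for the second marginal \<open>\<nu>0\<close>,
    before any fibre is considered. Inner regularity on the Polish space enters here.\<close>
  have "\<exists>C. compact C \<and> C \<subseteq> B \<and> emeasure \<nu>0 (B - C) \<le> ennreal (1 / Suc k)" if "B \<in> sets borel" for B k
    by (rule compact_inner_approximation[of \<nu>0 B "1 / Suc k"]) (use that in \<open>auto simp: \<nu>0_def[THEN arg_cong[where f=sets]] \<nu>0.finite_measure_axioms\<close>)
  then obtain C where C: "\<And>B k. B \<in> sets borel \<Longrightarrow> compact (C B k)" "\<And>B k. B \<in> sets borel \<Longrightarrow> C B k \<subseteq> B"
    "\<And>B k. B \<in> sets borel \<Longrightarrow> emeasure \<nu>0 (B - C B k) \<le> ennreal (1 / Suc k)" by metis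
  have Cs[measurable]: "C B k \<in> sets borel" if "B \<in> sets borel" for B k
    using C(1)[OF that] by (simp add: borel_compact)
  \<comment> \<open>Transfers the approximation from \<open>\<nu>0\<close> to almost every fibre:
    the integral of \<open>p (B - C B k)\<close> is the \<open>\<nu>0\<close>-measure of
    \<open>B - C B k\<close>, hence at most \<open>1 / Suc k\<close>, and the infimum over
    \<open>k\<close> lies below all of them.\<close>
  have inf0: "AE x in \<mu>. (INF k. p (B - C B k) x) = 0" if B[measurable]: "B \<in> sets borel" for B
  proof -
    have "(\<integral>\<^sup>+x. (INF k. p (B - C B k) x) \<partial>\<mu>) \<le> ennreal (1 / Suc k)" for k
    proof -
      have "(\<integral>\<^sup>+x. (INF k. p (B - C B k) x) \<partial>\<mu>) \<le> (\<integral>\<^sup>+x\<in>space M. p (B - C B k) x \<partial>\<mu>)"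
        by (rule nn_integral_mono) (auto intro: INF_lower)
      also have "\<dots> \<le> ennreal (1 / Suc k)"
        using C(3)[OF B] by (simp add: p[symmetric] em_\<nu>0)
      finally show ?thesis .
    qed
    moreover have "(\<lambda>k. ennreal (1 / Suc k)) \<longlonglongrightarrow> ennreal 0"
      by (intro tendsto_ennrealI LIMSEQ_Suc lim_1_over_n)
    ultimately have "(\<integral>\<^sup>+x. (INF k. p (B - C B k) x) \<partial>\<mu>) \<le> 0"
      by (intro LIMSEQ_le_const[of "\<lambda>k. ennreal (1 / Suc k)"]) auto
    then show ?thesis by (subst nn_integral_0_iff_AE[symmetric]) auto
  qed
  obtain S :: "'y set set" where S: "countable S" "topological_basis S" using ex_countable_basis by blast
  \<comment> \<open>One numbered family codes all closure operations: 0 is union, 1 is difference,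
    and \<open>k + 2\<close> is the \<open>k\<close>-th compact approximant of the first
    argument.\<close>
  define F where "F k a b = (if k = 0 then a \<union> b else if k = 1 then a - b else C a (k - 2))" for k :: nat and a b :: "'y set"
  have "S \<subseteq> sets borel" using S(2) by (auto simp: topological_basis_open)
  then obtain \<A> where \<A>: "countable \<A>" "insert UNIV S \<subseteq> \<A>" "\<A> \<subseteq> sets borel"
    and F: "\<And>k a b. a \<in> \<A> \<Longrightarrow> b \<in> \<A> \<Longrightarrow> F k a b \<in> \<A>"
    using S(1) by (rule_tac countable_closed_family[of "insert UNIV S" "sets borel" F]) (auto simp: F_def)
  have \<A>_Un: "a \<union> b \<in> \<A>" and \<A>_Diff: "a - b \<in> \<A>" and \<A>_C: "C a k \<in> \<A>" if "a \<in> \<A>" "b \<in> \<A>" for a b k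
    using F[OF that, of 0] F[OF that, of 1] F[OF that, of "k + 2"] by (auto simp: F_def)
  have \<A>b[measurable]: "a \<in> sets borel" if "a \<in> \<A>" for a using that \<A>(3) by auto
  have alg: "algebra UNIV \<A>"
  proof -
    have "{} \<in> \<A>" using \<A>_Diff[of UNIV UNIV] \<A>(2) by auto
    then show ?thesis using \<A>_Un \<A>_Diff \<A>(2) by (auto simp: algebra_iff_Un)
  qed
  then interpret \<A>: algebra UNIV \<A> .
  have gen: "sets borel = sigma_sets UNIV \<A>"
  proof
    have "sets (borel :: 'y measure) = sigma_sets UNIV S"
      unfolding borel_eq_countable_basis[OF S] by (rule sets_measure_of) simp
    also have "\<dots> \<subseteq> sigma_sets UNIV \<A>" using \<A>(2) by (intro sigma_sets_mono) auto
    finally show "sets borel \<subseteq> sigma_sets UNIV \<A>" .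
    show "sigma_sets UNIV \<A> \<subseteq> sets borel" using sets.sigma_sets_subset[of \<A> borel] \<A>(3) by simp
  qed
  \<comment> \<open>Exactly what the extension theorem asks of a fibre. Since \<open>\<A>\<close> is
    countable, these are countably many almost sure conditions.\<close>
  define good where "good x \<longleftrightarrow> (\<forall>B\<in>\<A>. \<forall>C\<in>\<A>. B \<inter> C = {} \<longrightarrow> p (B \<union> C) x = p B x + p C x) \<and>
      p UNIV x = 1 \<and> (\<forall>B\<in>\<A>. (INF k. p (B - C B k) x) = 0)" for x
  have "AE x in \<mu>. good x"
    unfolding good_def using add one inf0
    by (intro AE_conjI AE_ball_countable[THEN iffD2] ballI \<A>(1)) (auto intro: AE_mp)
  then obtain N where N: "N \<in> null_sets \<mu>" "\<And>x. x \<in> space \<mu> - N \<Longrightarrow> good x" by (rule AE_E3) blast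
  have "\<exists>\<nu>. sets \<nu> = sets borel \<and> prob_space \<nu> \<and> (\<forall>A\<in>\<A>. emeasure \<nu> A = p A x)"
    if "x \<in> space M - N" for x
  proof -
    have x: "good x" by (rule N(2)) (use that in simp)
    have cpt: "\<exists>C\<in>\<A>. C \<subseteq> A \<and> compact C \<and> p (A - C) x \<le> ennreal e" if "A \<in> \<A>" "0 < e" for A e
    proof -
      have "(INF k. p (A - C A k) x) < ennreal e" using x that by (auto simp: good_def)
      then obtain k where "p (A - C A k) x < ennreal e" by (auto simp: INF_less_iff)
      then show ?thesis using \<A>_C[OF that(1) that(1)] C that by (intro bexI[of _ "C A k"]) auto
    qed
    show ?thesis
      by (rule prob_measure_extension_compact[OF alg gen, of "\<lambda>A. p A x"])
         (use x cpt in \<open>auto simp: good_def\<close>)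
  qed
  then obtain l where l: "\<And>x. x \<in> space M - N \<Longrightarrow> sets (l x) = sets borel"
      "\<And>x. x \<in> space M - N \<Longrightarrow> prob_space (l x)"
      "\<And>x A. x \<in> space M - N \<Longrightarrow> A \<in> \<A> \<Longrightarrow> emeasure (l x) A = p A x" by metis
  \<comment> \<open>The value \<open>\<nu>0\<close> on \<open>N\<close> only serves to make
    \<open>L\<close> a probability kernel at every point.\<close>
  define L where "L x = (if x \<in> N then \<nu>0 else l x)" for x
  have N_M[measurable]: "N \<in> sets M" using N by auto
  have L: "L \<in> M \<rightarrow>\<^sub>M prob_algebra borel"
  \<comment> \<open>Measurability may be tested on the intersection-stable generator
    \<open>\<A>\<close>, where \<open>L\<close> is given by the measurable densities off
    \<open>N\<close>.\<close>
  proof (rule measurable_prob_algebra_generated[OF gen])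
    show "Int_stable \<A>" by (auto simp: Int_stable_def)
    show "\<A> \<subseteq> Pow UNIV" by auto
    show "prob_space (L x)" "sets (L x) = sets borel" if "x \<in> space M" for x
      using that l[of x] \<nu>0.prob_space_axioms by (auto simp: L_def \<nu>0_def)
    fix A assume A[measurable]: "A \<in> \<A>"
    have "(\<lambda>x. if x \<in> N then emeasure \<nu>0 A else p A x) \<in> borel_measurable M" by measurable
    then show "(\<lambda>x. emeasure (L x) A) \<in> borel_measurable M"
      by (subst measurable_cong[of _ _ "\<lambda>x. if x \<in> N then emeasure \<nu>0 A else p A x"])
         (use l(3)[OF _ A] in \<open>auto simp: L_def\<close>)
  qed
  note [measurable] = measurable_prob_algebraD[OF L]
  have prob_L: "prob_space (L x)" "sets (L x) = sets borel" if "x \<in> space M" for x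
    using measurable_space[OF L that] by (auto simp: space_prob_algebra)
  have "emeasure m (A \<times> B) = (\<integral>\<^sup>+x\<in>A. emeasure (L x) B \<partial>\<mu>)"
    if A[measurable]: "A \<in> sets M" and "B \<in> sets borel" for A B
  proof -
    have "Int_stable \<A>" "\<A> \<subseteq> Pow UNIV" "B \<in> sigma_sets UNIV \<A>"
      using that(2) gen by (auto simp: Int_stable_def)
    then show ?thesis
    proof (induction rule: sigma_sets_induct_disjoint)
      case (basic B)
      have "AE x in \<mu>. x \<notin> N" by (rule AE_not_in) fact
      then have "AE x in \<mu>. p B x * indicator A x = emeasure (L x) B * indicator A x"
        by (rule AE_mp) (use l(3)[OF _ basic] in \<open>auto intro!: AE_I2 simp: L_def\<close>)
      then show ?case using basic by (subst p) (auto intro!: nn_integral_cong_AE)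
    next
      case (compl B)
      then have B[measurable]: "B \<in> sets borel" using gen by simp
      have "emeasure m (A \<times> (UNIV - B)) = emeasure m (A \<times> UNIV - A \<times> B)"
        by (rule arg_cong[where f="emeasure m"]) auto
      also have "\<dots> = emeasure \<mu> A - emeasure m (A \<times> B)"
        unfolding em_\<mu>[OF A] by (intro emeasure_Diff em_times) auto
      also have "\<dots> = (\<integral>\<^sup>+x. indicator A x \<partial>\<mu>) - (\<integral>\<^sup>+x\<in>A. emeasure (L x) B \<partial>\<mu>)"
        by (simp add: compl)
      also have "\<dots> = (\<integral>\<^sup>+x. indicator A x - emeasure (L x) B * indicator A x \<partial>\<mu>)"
      proof (rule nn_integral_diff[symmetric])
        show "(\<integral>\<^sup>+x\<in>A. emeasure (L x) B \<partial>\<mu>) \<noteq> \<infinity>"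
          unfolding compl(2)[symmetric] by simp
        show "AE x in \<mu>. emeasure (L x) B * indicator A x \<le> indicator A x"
          by (intro AE_I2) (auto simp: indicator_def intro!: prob_space.measure_le_1 prob_L)
      qed auto
      also have "\<dots> = (\<integral>\<^sup>+x\<in>A. emeasure (L x) (UNIV - B) \<partial>\<mu>)"
      proof (rule nn_integral_cong)
        fix x assume "x \<in> space \<mu>"
        then interpret prob_space "L x" by (intro prob_L) simp
        have [simp]: "sets (L x) = sets borel" "space (L x) = UNIV"
          using \<open>x \<in> space \<mu>\<close> prob_L sets_eq_imp_space_eq[of "L x" borel] by auto
        have "emeasure (L x) (UNIV - B) = 1 - emeasure (L x) B"
          using emeasure_compl[of B "L x"] emeasure_space_1 by simp
        then show "indicator A x - emeasure (L x) B * indicator A x = emeasure (L x) (UNIV - B) * indicator A x"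
          by (simp add: indicator_def)
      qed
      finally show ?case .
    next
      case empty show ?case by simp
    next
      case (union B)
      then have B[measurable]: "\<And>i. B i \<in> sets borel" using gen by auto
      have "emeasure m (A \<times> (\<Union>i. B i)) = emeasure m (\<Union>i. A \<times> B i)"
        by (rule arg_cong[where f="emeasure m"]) auto
      also have "\<dots> = (\<Sum>i. emeasure m (A \<times> B i))"
        using union(1) by (intro suminf_emeasure[symmetric])
          (auto simp: disjoint_family_on_def intro!: em_times)
      also have "\<dots> = (\<integral>\<^sup>+x. (\<Sum>i. emeasure (L x) (B i) * indicator A x) \<partial>\<mu>)"
        unfolding union(3) by (rule nn_integral_suminf[symmetric]) measurable
      also have "\<dots> = (\<integral>\<^sup>+x\<in>A. emeasure (L x) (\<Union>i. B i) \<partial>\<mu>)"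
        using union(1)
        by (intro nn_integral_cong) (auto simp: indicator_def prob_L(2) intro!: suminf_emeasure)
      finally show ?case .
    qed
  qed
  then show thesis unfolding \<mu>_def by (intro that[OF L])
qed

text \<open>Prepares the replacement of arbitrary Borel sets by finite unions of basic open sets, of
  which a countable basis has only countably many.\<close>

lemma compact_between_finite_basis_union:
  assumes "topological_basis S" "compact C" "open U" "C \<subseteq> U"
  obtains F where "finite F" "F \<subseteq> S" "C \<subseteq> \<Union>F" "\<Union>F \<subseteq> U"
proof -
  have "C \<subseteq> \<Union>{s\<in>S. s \<subseteq> U}"
  proof
    fix x assume "x \<in> C"
    then have "x \<in> U" using assms(4) by blast
    from topological_basisE[OF assms(1,3) this] show "x \<in> \<Union>{s\<in>S. s \<subseteq> U}" by blast
  qed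
  moreover have "open s" if "s \<in> {s\<in>S. s \<subseteq> U}" for s
    using that topological_basis_open[OF assms(1)] by blast
  ultimately obtain F where "F \<subseteq> {s\<in>S. s \<subseteq> U}" "finite F" "C \<subseteq> \<Union>F"
    by (rule compactE[OF assms(2)])
  then show thesis using that[of F] by blast
qed

text \<open>Uses inner regularity of \<open>\<mu>\<close> and outer regularity of \<open>\<nu>\<close>.\<close>

lemma measure_diff_le_of_basis_unions:
  fixes \<mu> \<nu> :: "'y::polish_space measure"
  assumes "prob_space \<mu>" "prob_space \<nu>" and s: "sets \<mu> = sets borel" "sets \<nu> = sets borel"
    and S: "topological_basis S"
    and c: "\<And>F. finite F \<Longrightarrow> F \<subseteq> S \<Longrightarrow> measure \<mu> (\<Union>F) - measure \<nu> (\<Union>F) \<le> c"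
    and B: "B \<in> sets borel"
  shows "measure \<mu> B - measure \<nu> B \<le> c"
proof (rule field_le_epsilon)
  interpret \<mu>: prob_space \<mu> by fact
  interpret \<nu>: prob_space \<nu> by fact
  fix e :: real assume "0 < e"
  then have e: "0 < e / 2" by simp
  obtain C where C: "compact C" "C \<subseteq> B" "emeasure \<mu> (B - C) \<le> ennreal (e/2)"
    by (rule compact_inner_approximation[OF \<mu>.finite_measure_axioms s(1) B e])
  \<comment> \<open>Outer approximation of \<open>B\<close> under \<open>\<nu>\<close> is obtained
    from a compact \<open>D\<close> inside the complement: \<open>- D\<close> is open and exceeds
    \<open>B\<close> by at most \<open>e / 2\<close>. A basic union squeezed between
    \<open>C\<close> and \<open>- D\<close> then costs \<open>e / 2\<close> for each of the two
    measures.\<close>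
  have "- B \<in> sets borel" using B by auto
  then obtain D where D: "compact D" "D \<subseteq> - B" "emeasure \<nu> (- B - D) \<le> ennreal (e/2)"
    by (rule compact_inner_approximation[OF \<nu>.finite_measure_axioms s(2) _ e])
  have Cs: "C \<in> sets borel" and Ds: "D \<in> sets borel" using C D by (simp_all add: borel_compact)
  have "open (- D)" using compact_imp_closed[OF D(1)] by auto
  then obtain F where F: "finite F" "F \<subseteq> S" "C \<subseteq> \<Union>F" "\<Union>F \<subseteq> - D"
    by (rule compact_between_finite_basis_union[OF S C(1)]) (use C D in auto)
  have Fs: "\<Union>F \<in> sets borel"
    using F(2) topological_basis_open[OF S] by (intro borel_open open_Union) auto
  have "measure \<mu> B = measure \<mu> C + measure \<mu> (B - C)"
    using \<mu>.finite_measure_Diff[of B C] B Cs C(2) s by simp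
  moreover have "measure \<mu> (B - C) \<le> e/2" using C(3) e by (simp add: \<mu>.emeasure_eq_measure)
  moreover have "measure \<mu> C \<le> measure \<mu> (\<Union>F)"
    using F Fs s by (intro \<mu>.finite_measure_mono) auto
  moreover have "measure \<nu> (\<Union>F) \<le> measure \<nu> (- D)"
    using F Ds s by (intro \<nu>.finite_measure_mono) auto
  moreover have "measure \<nu> (- D) = measure \<nu> B + measure \<nu> (- B - D)"
  proof -
    have "- D = B \<union> (- B - D)" using D(2) by auto
    then show ?thesis
      using \<nu>.finite_measure_Union[of B "- B - D"] B Ds s by auto
  qed
  moreover have "measure \<nu> (- B - D) \<le> e/2" using D(3) e by (simp add: \<nu>.emeasure_eq_measure)
  moreover have "measure \<mu> (\<Union>F) - measure \<nu> (\<Union>F) \<le> c" by (rule c) fact+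
  ultimately show "measure \<mu> B - measure \<nu> B \<le> c + e" by linarith
qed

text \<open>The hypothesis \<open>osc\<close> is the integrated form of "the conditional probability
  of \<open>B\<close> almost surely lies in \<open>[a, a + c]\<close>". Only the length
  \<open>c\<close> is uniform; both \<open>a\<close> and the exceptional null set may depend on
  \<open>B\<close>, so countably many events have to do the work for the pointwise bound.\<close>

lemma disintegration_bounded_oscillation:
  fixes m :: "('x \<times> 'y::polish_space) measure" and M :: "'x measure"
  assumes pm: "prob_space m" and sm: "sets m = sets (M \<Otimes>\<^sub>M borel)"
    and osc: "\<And>B. B \<in> sets borel \<Longrightarrow> \<exists>a. \<forall>A\<in>sets M.
      a * measure m (A \<times> UNIV) \<le> measure m (A \<times> B) \<and> measure m (A \<times> B) \<le> (a + c) * measure m (A \<times> UNIV)"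
  obtains L where "L \<in> M \<rightarrow>\<^sub>M prob_algebra borel"
    "\<And>A B. A \<in> sets M \<Longrightarrow> B \<in> sets borel \<Longrightarrow>
      emeasure m (A \<times> B) = (\<integral>\<^sup>+x\<in>A. emeasure (L x) B \<partial>distr m M fst)"
    "\<And>x x' B. x \<in> space M \<Longrightarrow> x' \<in> space M \<Longrightarrow> B \<in> sets borel \<Longrightarrow> measure (L x) B - measure (L x') B \<le> c"
proof -
  interpret m: prob_space m by fact
  define \<mu> where "\<mu> = distr m M fst"
  have fst_m[measurable]: "fst \<in> m \<rightarrow>\<^sub>M M"
    by (auto simp: measurable_cong_sets[OF sm refl])
  have s\<mu>[measurable_cong, simp]: "sets \<mu> = sets M" by (simp add: \<mu>_def)
  have sp\<mu>[simp]: "space \<mu> = space M" by (simp add: \<mu>_def)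
  interpret \<mu>: prob_space \<mu> unfolding \<mu>_def by (rule m.prob_space_distr) measurable
  obtain L where L: "L \<in> M \<rightarrow>\<^sub>M prob_algebra borel"
    and Lm: "\<And>A B. A \<in> sets M \<Longrightarrow> B \<in> sets borel \<Longrightarrow>
      emeasure m (A \<times> B) = (\<integral>\<^sup>+x\<in>A. emeasure (L x) B \<partial>\<mu>)"
    unfolding \<mu>_def by (rule disintegration[OF pm sm]) blast
  note [measurable] = measurable_prob_algebraD[OF L]
  have prob_L: "prob_space (L x)" "sets (L x) = sets borel" if "x \<in> space M" for x
    using measurable_space[OF L that] by (auto simp: space_prob_algebra)
  have Lint: "measure m (A \<times> B) = (\<integral>x. indicator A x * measure (L x) B \<partial>\<mu>)"
    if [measurable]: "A \<in> sets M" "B \<in> sets borel" for A B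
  proof -
    have "(\<integral>x. indicator A x * measure (L x) B \<partial>\<mu>) = enn2real (\<integral>\<^sup>+x. ennreal (indicator A x * measure (L x) B) \<partial>\<mu>)"
      by (intro integral_eq_nn_integral) auto
    also have "(\<integral>\<^sup>+x. ennreal (indicator A x * measure (L x) B) \<partial>\<mu>) = (\<integral>\<^sup>+x\<in>A. emeasure (L x) B \<partial>\<mu>)"
    proof (rule nn_integral_cong)
      fix x assume "x \<in> space \<mu>"
      then interpret prob_space "L x" by (intro prob_L) simp
      show "ennreal (indicator A x * measure (L x) B) = emeasure (L x) B * indicator A x"
        by (simp add: emeasure_eq_measure indicator_def)
    qed
    finally show ?thesis by (simp add: Lm[symmetric] measure_def)
  qed
  have bnd: "\<bar>measure (L x) B\<bar> \<le> 1" if "x \<in> space M" for x B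
    using prob_space.prob_le_1[OF prob_L(1)[OF that]] by simp
  have int: "integrable \<mu> (\<lambda>x. indicator A x * measure (L x) B)"
    if [measurable]: "A \<in> sets M" "B \<in> sets borel" for A B
    using bnd by (intro \<mu>.integrable_const_bound[of _ 1]) (auto simp: indicator_def)
  have int1: "integrable \<mu> (indicator A :: _ \<Rightarrow> real)" if "A \<in> sets M" for A
    using that by (intro integrable_real_indicator) (auto simp: less_top[symmetric])
  have mA: "measure m (A \<times> UNIV) = (\<integral>x. indicator A x \<partial>\<mu>)" if A[measurable]: "A \<in> sets M" for A
  proof -
    have "measure m (A \<times> UNIV) = (\<integral>x. indicator A x * measure (L x) UNIV \<partial>\<mu>)" using A by (intro Lint) auto
    also have "\<dots> = (\<integral>x. indicator A x \<partial>\<mu>)"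
    proof (rule Bochner_Integration.integral_cong)
      fix x assume "x \<in> space \<mu>"
      then have x: "x \<in> space M" by simp
      interpret prob_space "L x" by (intro prob_L x)
      have "space (L x) = UNIV" using sets_eq_imp_space_eq[OF prob_L(2)[OF x]] by simp
      then show "indicator A x * measure (L x) UNIV = (indicator A x :: real)" using prob_space by simp
    qed simp
    finally show ?thesis .
  qed
  define a where "a B = (SOME a. \<forall>A\<in>sets M.
      a * measure m (A \<times> UNIV) \<le> measure m (A \<times> B) \<and> measure m (A \<times> B) \<le> (a + c) * measure m (A \<times> UNIV))" for B
  have a: "a B * measure m (A \<times> UNIV) \<le> measure m (A \<times> B)"
      "measure m (A \<times> B) \<le> (a B + c) * measure m (A \<times> UNIV)" if "A \<in> sets M" "B \<in> sets borel" for A B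
    using someI_ex[OF osc[OF that(2)]] that(1) unfolding a_def[symmetric] by auto
  have AE_0: "AE x in \<mu>. f x = 0"
    if "integrable \<mu> f" "\<And>x. x \<in> space M \<Longrightarrow> 0 \<le> f x" "(\<integral>x. f x \<partial>\<mu>) \<le> 0" for f :: "'x \<Rightarrow> real"
  proof -
    have "(\<integral>x. f x \<partial>\<mu>) = 0" using that by (intro antisym integral_nonneg_AE AE_I2) auto
    then show ?thesis using that by (subst (asm) integral_nonneg_eq_0_iff_AE) (auto intro!: AE_I2)
  qed
  have AE_bounds: "AE x in \<mu>. a B \<le> measure (L x) B \<and> measure (L x) B \<le> a B + c" if B[measurable]: "B \<in> sets borel" for B
  proof -
    \<comment> \<open>The hypothesis is tested on the set where the lower bound fails. There the
      integrand below is nonnegative with integral at most 0, so it vanishes almost surely.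
      \<open>E\<close> plays the same part for the upper bound.\<close>
    define D where "D = {x \<in> space M. measure (L x) B < a B}"
    have D[measurable]: "D \<in> sets M" unfolding D_def by measurable
    have "AE x in \<mu>. a B * indicator D x - indicator D x * measure (L x) B = 0"
    proof (rule AE_0)
      show "integrable \<mu> (\<lambda>x. a B * indicator D x - indicator D x * measure (L x) B)"
        using int[OF D B] int1[OF D] by auto
      show "(\<integral>x. (a B * indicator D x - indicator D x * measure (L x) B) \<partial>\<mu>) \<le> 0"
        using int[OF D B] int1[OF D] a(1)[OF D B] by (simp add: Lint[symmetric] mA)
    qed (auto simp: D_def indicator_def)
    moreover define E where "E = {x \<in> space M. a B + c < measure (L x) B}"
    have E[measurable]: "E \<in> sets M" unfolding E_def by measurable
    have "AE x in \<mu>. indicator E x * measure (L x) B - (a B + c) * indicator E x = 0"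
    proof (rule AE_0)
      show "integrable \<mu> (\<lambda>x. indicator E x * measure (L x) B - (a B + c) * indicator E x)"
        using int[OF E B] int1[OF E] by auto
      show "(\<integral>x. (indicator E x * measure (L x) B - (a B + c) * indicator E x) \<partial>\<mu>) \<le> 0"
        using int[OF E B] int1[OF E] a(2)[OF E B] by (simp add: Lint[symmetric] mA)
    qed (auto simp: E_def indicator_def)
    ultimately show ?thesis
      by (rule AE_mp[OF AE_conjI], intro AE_I2) (auto simp: D_def E_def indicator_def split: if_splits)
  qed
  obtain S :: "'y set set" where S: "countable S" "topological_basis S" using ex_countable_basis by blast
  define V where "V = Union ` {F. finite F \<and> F \<subseteq> S}"
  have Vb: "V \<subseteq> sets borel"
    unfolding V_def using topological_basis_open[OF S(2)] by (auto intro!: borel_open open_Union)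
  have "countable V" unfolding V_def using countable_Collect_finite_subset[OF S(1)] by (intro countable_image)
  then have "AE x in \<mu>. \<forall>B\<in>V. a B \<le> measure (L x) B \<and> measure (L x) B \<le> a B + c"
    using AE_bounds Vb by (subst AE_ball_countable) auto
  then obtain N where N: "N \<in> null_sets \<mu>"
    "\<And>x. x \<in> space \<mu> - N \<Longrightarrow> \<forall>B\<in>V. a B \<le> measure (L x) B \<and> measure (L x) B \<le> a B + c" by (rule AE_E3) blast
  have N_M[measurable]: "N \<in> sets M" using N(1) by auto
  have "space M - N \<noteq> {}"
  proof
    assume "space M - N = {}"
    then have "space \<mu> \<subseteq> N" by auto
    then have "emeasure \<mu> (space \<mu>) \<le> emeasure \<mu> N" by (intro emeasure_mono) auto
    then show False using N(1) \<mu>.emeasure_space_1 by auto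
  qed
  then obtain x0 where x0: "x0 \<in> space M - N" by blast
  \<comment> \<open>On \<open>N\<close> the law of one fixed point outside \<open>N\<close> is used.
    Every \<open>L' x\<close> is then one of the laws already under control, so the comparison holds
    at all pairs of points.\<close>
  define L' where "L' x = (if x \<in> N then L x0 else L x)" for x
  have L': "L' \<in> M \<rightarrow>\<^sub>M prob_algebra borel"
    unfolding L'_def using L measurable_space[OF L, of x0] x0 by (intro measurable_If_set) auto
  have L'_eq: "\<exists>y\<in>space M - N. L' x = L y" if "x \<in> space M" for x
    using that x0 by (auto simp: L'_def)
  have "measure (L' x) B - measure (L' x') B \<le> c"
    if x: "x \<in> space M" "x' \<in> space M" and B: "B \<in> sets borel" for x x' B
  proof -
    obtain y y' where y: "y \<in> space M - N" "L' x = L y" "y' \<in> space M - N" "L' x' = L y'"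
      using L'_eq x by meson
    have "measure (L y) B - measure (L y') B \<le> c"
    proof (rule measure_diff_le_of_basis_unions[OF _ _ _ _ S(2) _ B])
      fix F assume "finite F" "F \<subseteq> S"
      then have "\<Union>F \<in> V" unfolding V_def by blast
      then have "measure (L y) (\<Union>F) \<le> a (\<Union>F) + c" "a (\<Union>F) \<le> measure (L y') (\<Union>F)"
        using N(2)[of y] N(2)[of y'] y by auto
      then show "measure (L y) (\<Union>F) - measure (L y') (\<Union>F) \<le> c" by simp
    qed (use y prob_L in auto)
    then show ?thesis using y by simp
  qed
  moreover have "emeasure m (A \<times> B) = (\<integral>\<^sup>+x\<in>A. emeasure (L' x) B \<partial>\<mu>)"
    if "A \<in> sets M" "B \<in> sets borel" for A B
  proof -
    have "AE x in \<mu>. emeasure (L x) B * indicator A x = emeasure (L' x) B * indicator A x"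
      using AE_not_in[OF N(1)] by (rule AE_mp) (auto simp: L'_def)
    then have "(\<integral>\<^sup>+x\<in>A. emeasure (L x) B \<partial>\<mu>) = (\<integral>\<^sup>+x\<in>A. emeasure (L' x) B \<partial>\<mu>)"
      by (rule nn_integral_cong_AE)
    then show ?thesis by (simp add: Lm that)
  qed
  ultimately show thesis unfolding \<mu>_def by (intro that[OF L'])
qed

section \<open>The adaptive Markov chain\<close>

locale adaptive_kernels =
  fixes G :: "'c measure"
    and K :: "'c \<Rightarrow> 'a::polish_space \<Rightarrow> 'a measure"
    and g :: "nat \<Rightarrow> 'a \<Rightarrow> 'c \<Rightarrow> 'c measure"
    and n :: nat
  assumes K: "(\<lambda>(\<gamma>, x). K \<gamma> x) \<in> G \<Otimes>\<^sub>M borel \<rightarrow>\<^sub>M prob_algebra borel"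
    and g: "\<And>k. 1 \<le> k \<Longrightarrow> k < n \<Longrightarrow> (\<lambda>(x, \<gamma>). g k x \<gamma>) \<in> borel \<Otimes>\<^sub>M G \<rightarrow>\<^sub>M prob_algebra G"
begin

abbreviation E :: "('a \<times> 'c) measure" where "E \<equiv> borel \<Otimes>\<^sub>M G"

definition paths :: "nat \<Rightarrow> (nat \<Rightarrow> 'a \<times> 'c) measure" where
  "paths t = Pi\<^sub>M {1..t} (\<lambda>_. E)"

definition step :: "nat \<Rightarrow> 'a \<times> 'c \<Rightarrow> ('a \<times> 'c) measure" where
  "step k z = K (snd z) (fst z) \<Otimes>\<^sub>M g k (fst z) (snd z)"

lemma K_in_prob_algebra: "\<gamma> \<in> space G \<Longrightarrow> K \<gamma> x \<in> space (prob_algebra borel)"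
  using measurable_space[OF K, of "(\<gamma>, x)"] by (simp add: space_pair_measure)

lemma g_in_prob_algebra: "1 \<le> k \<Longrightarrow> k < n \<Longrightarrow> \<gamma> \<in> space G \<Longrightarrow> g k x \<gamma> \<in> space (prob_algebra G)"
  using measurable_space[OF g, of k "(x, \<gamma>)"] by (simp add: space_pair_measure)

lemma measurable_step: "1 \<le> k \<Longrightarrow> k < n \<Longrightarrow> step k \<in> E \<rightarrow>\<^sub>M prob_algebra E"
  unfolding step_def
proof (rule measurable_pair_prob)
  have "(\<lambda>z. (snd z, fst z)) \<in> E \<rightarrow>\<^sub>M G \<Otimes>\<^sub>M borel" by measurable
  from measurable_compose[OF this K] show "(\<lambda>z. K (snd z) (fst z)) \<in> E \<rightarrow>\<^sub>M prob_algebra borel" by simp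
  show "1 \<le> k \<Longrightarrow> k < n \<Longrightarrow> (\<lambda>z. g k (fst z) (snd z)) \<in> E \<rightarrow>\<^sub>M prob_algebra G"
    using g[of k] by (simp add: case_prod_unfold)
qed

lemma step_prob:
  assumes "1 \<le> k" "k < n" "z \<in> space E"
  shows "prob_space (step k z)" "sets (step k z) = sets E" "space (step k z) = space E"
  using measurable_space[OF measurable_step[OF assms(1,2)] assms(3)] sets_eq_imp_space_eq[of "step k z" E]
  by (auto simp: space_prob_algebra)

lemma measurable_extend:
  "(\<lambda>(h, z). h(Suc t := z)) \<in> paths t \<Otimes>\<^sub>M E \<rightarrow>\<^sub>M paths (Suc t)"
  unfolding paths_def case_prod_unfold
  by (rule measurable_fun_upd[where J = "{1..t}"]) auto

lemma extend_in_space: "h \<in> space (paths t) \<Longrightarrow> z \<in> space E \<Longrightarrow> h(Suc t := z) \<in> space (paths (Suc t))"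
  using measurable_space[OF measurable_extend, of "(h, z)" t] by (simp add: space_pair_measure)

lemma measurable_extend_at: "h \<in> space (paths t) \<Longrightarrow> (\<lambda>z. h(Suc t := z)) \<in> E \<rightarrow>\<^sub>M paths (Suc t)"
  using measurable_compose[OF measurable_Pair1' measurable_extend, of h t] by simp

lemma measurable_path_component: "1 \<le> s \<Longrightarrow> s \<le> t \<Longrightarrow> (\<lambda>h. h s) \<in> paths t \<rightarrow>\<^sub>M E"
  unfolding paths_def by (rule measurable_component_singleton) auto

lemma path_component_in_space: "h \<in> space (paths t) \<Longrightarrow> 1 \<le> s \<Longrightarrow> s \<le> t \<Longrightarrow> h s \<in> space E"
  using measurable_space[OF measurable_path_component] by blast

definition extension :: "nat \<Rightarrow> (nat \<Rightarrow> 'a \<times> 'c) \<Rightarrow> (nat \<Rightarrow> 'a \<times> 'c) measure" where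
  "extension t h = distr (step t (h t)) (paths (Suc t)) (\<lambda>z. h(Suc t := z))"

lemma measurable_extension:
  assumes "1 \<le> t" "t < n"
  shows "extension t \<in> paths t \<rightarrow>\<^sub>M prob_algebra (paths (Suc t))"
  unfolding extension_def
  by (rule measurable_distr_prob_space2[OF _ measurable_extend])
     (rule measurable_compose[OF measurable_path_component measurable_step], use assms in auto)

lemma adaptive_joint_Suc:
  "adaptive_joint G p0 K g (Suc t) = adaptive_joint G p0 K g t \<bind> extension (Suc t)"
  by (simp add: extension_def[abs_def] step_def paths_def case_prod_unfold)

lemma adaptive_joint_prob:
  assumes p0: "p0 \<in> space (prob_algebra E)" and "t < n"
  shows "adaptive_joint G p0 K g t \<in> space (prob_algebra (paths (Suc t)))"
  using assms(2)
proof (induction t)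
  case 0
  have "prob_space p0" and s: "sets p0 = sets E" using p0 by (auto simp: space_prob_algebra)
  moreover have "(\<lambda>z. \<lambda>s\<in>{1..Suc 0}. z) \<in> p0 \<rightarrow>\<^sub>M Pi\<^sub>M {1..Suc 0} (\<lambda>_. E)"
    using measurable_cong_sets[OF s refl] by (intro measurable_restrict) (auto simp: s cong: measurable_cong_sets)
  ultimately show ?case
    by (simp add: space_prob_algebra paths_def prob_space.prob_space_distr del: atLeastAtMost_singleton)
next
  case (Suc t)
  then have J: "adaptive_joint G p0 K g t \<in> space (prob_algebra (paths (Suc t)))" by simp
  have k: "extension (Suc t) \<in> paths (Suc t) \<rightarrow>\<^sub>M prob_algebra (paths (Suc (Suc t)))"
    using Suc.prems by (intro measurable_extension) auto
  show ?case
    unfolding adaptive_joint_Suc using sets_bind'[OF J k] prob_space_bind'[OF J k]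
    by (simp add: space_prob_algebra)
qed

text \<open>Peels off the last step of the chain. The backward recursion, the comparison of two
  chains and the positivity of boxes all rest on it.\<close>

lemma nn_integral_adaptive_joint_Suc:
  assumes p0: "p0 \<in> space (prob_algebra E)" and t: "Suc t < n"
    and H: "H \<in> borel_measurable (paths (Suc (Suc t)))"
  shows "(\<integral>\<^sup>+h. H h \<partial>adaptive_joint G p0 K g (Suc t)) =
    (\<integral>\<^sup>+h. (\<integral>\<^sup>+z. H (h(Suc (Suc t) := z)) \<partial>step (Suc t) (h (Suc t))) \<partial>adaptive_joint G p0 K g t)"
proof -
  let ?J = "adaptive_joint G p0 K g t"
  have J: "sets ?J = sets (paths (Suc t))"
    using adaptive_joint_prob[OF p0, of t] t by (simp add: space_prob_algebra)
  have k: "extension (Suc t) \<in> ?J \<rightarrow>\<^sub>M subprob_algebra (paths (Suc (Suc t)))"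
    using measurable_prob_algebraD[OF measurable_extension, of "Suc t"] t
    by (simp add: measurable_cong_sets[OF J refl])
  have "(\<integral>\<^sup>+h. H h \<partial>adaptive_joint G p0 K g (Suc t)) = (\<integral>\<^sup>+h. (\<integral>\<^sup>+x. H x \<partial>extension (Suc t) h) \<partial>?J)"
    unfolding adaptive_joint_Suc by (rule nn_integral_bind[OF H k])
  also have "\<dots> = (\<integral>\<^sup>+h. (\<integral>\<^sup>+z. H (h(Suc (Suc t) := z)) \<partial>step (Suc t) (h (Suc t))) \<partial>?J)"
  proof (rule nn_integral_cong)
    fix h assume "h \<in> space ?J"
    then have h: "h \<in> space (paths (Suc t))" using sets_eq_imp_space_eq[OF J] by simp
    have s: "sets (step (Suc t) (h (Suc t))) = sets E"
      using t by (intro step_prob path_component_in_space[OF h]) auto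
    show "(\<integral>\<^sup>+x. H x \<partial>extension (Suc t) h) = (\<integral>\<^sup>+z. H (h(Suc (Suc t) := z)) \<partial>step (Suc t) (h (Suc t)))"
      unfolding extension_def using measurable_extend_at[OF h] H
      by (intro nn_integral_distr) (simp_all add: measurable_cong_sets[OF s refl])
  qed
  finally show ?thesis .
qed

section \<open>Conditional probabilities of future events by backward recursion\<close>

definition states :: "nat \<Rightarrow> nat \<Rightarrow> (nat \<Rightarrow> 'a \<times> 'c) \<Rightarrow> nat \<Rightarrow> 'a" where
  "states a b h = (\<lambda>s\<in>{a..b}. fst (h s))"

lemma measurable_states: "1 \<le> a \<Longrightarrow> b \<le> t \<Longrightarrow> states a b \<in> paths t \<rightarrow>\<^sub>M state_seqs {a..b}"
  unfolding states_def[abs_def] state_seqs_def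
  by (intro measurable_restrict measurable_compose[OF measurable_path_component measurable_fst]) auto

lemma states_in_space: "states a b h \<in> space (state_seqs {a..b})"
  by (auto simp: states_def state_seqs_def space_PiM)

text \<open>The conditional probability of \<open>X\<^sub>j, \<dots>, X\<^sub>n \<in> B\<close> given the path up to time \<open>n - s\<close>.\<close>

primrec future :: "nat \<Rightarrow> (nat \<Rightarrow> 'a) set \<Rightarrow> nat \<Rightarrow> (nat \<Rightarrow> 'a \<times> 'c) \<Rightarrow> real" where
  "future j B 0 h = indicator B (states j n h)"
| "future j B (Suc s) h = (\<integral>z. future j B s (h(n - s := z)) \<partial>step (n - Suc s) (h (n - Suc s)))"

lemma future_measurable_bounded:
  assumes B: "B \<in> sets (state_seqs {j..n})" and "1 \<le> j" and "s < n"
  shows "future j B s \<in> borel_measurable (paths (n - s)) \<and>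
    (\<forall>h\<in>space (paths (n - s)). 0 \<le> future j B s h \<and> future j B s h \<le> 1)"
  using assms(3)
proof (induction s)
  case 0
  have [measurable]: "B \<in> sets (state_seqs {j..n})" "states j n \<in> paths n \<rightarrow>\<^sub>M state_seqs {j..n}"
    using B assms(2) by (auto intro: measurable_states)
  have "(\<lambda>h. indicator B (states j n h) :: real) \<in> borel_measurable (paths n)" by measurable
  then show ?case by (auto simp: indicator_def)
next
  case (Suc s)
  define t where "t = n - Suc s"
  have t: "n - s = Suc t" "1 \<le> t" "t < n" "t \<le> t" using Suc.prems by (auto simp: t_def)
  from Suc have IH: "future j B s \<in> borel_measurable (paths (Suc t))"
    "\<And>h. h \<in> space (paths (Suc t)) \<Longrightarrow> 0 \<le> future j B s h \<and> future j B s h \<le> 1" by (auto simp: t)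
  \<comment> \<open>Written against \<open>extension\<close>, which is already known to be a
    measurable kernel, the recursion yields measurability in the path and the bounds 0 and
    1.\<close>
  have eq: "future j B (Suc s) h = integral\<^sup>L (extension t h) (future j B s)" if h: "h \<in> space (paths t)" for h
  proof -
    have st: "sets (step t (h t)) = sets E" using t by (intro step_prob path_component_in_space[OF h]) auto
    show ?thesis
      unfolding extension_def using measurable_extend_at[OF h] IH(1) t
      by (subst integral_distr) (simp_all add: measurable_cong_sets[OF st refl] t_def[symmetric])
  qed
  have ext: "extension t \<in> paths t \<rightarrow>\<^sub>M prob_algebra (paths (Suc t))"
    using t by (intro measurable_extension) auto
  have "(\<lambda>h. integral\<^sup>L (extension t h) (future j B s)) \<in> borel_measurable (paths t)"
    by (rule measurable_compose[OF measurable_prob_algebraD[OF ext] integral_measurable_subprob_algebra[OF IH(1)]])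
  then have "future j B (Suc s) \<in> borel_measurable (paths t)"
    by (subst measurable_cong[OF eq])
  moreover have "0 \<le> future j B (Suc s) h \<and> future j B (Suc s) h \<le> 1" if h: "h \<in> space (paths t)" for h
  proof -
    have "extension t h \<in> space (prob_algebra (paths (Suc t)))" by (rule measurable_space[OF ext h])
    then interpret prob_space "extension t h" by (simp add: space_prob_algebra)
    have s: "sets (extension t h) = sets (paths (Suc t))" by (simp add: extension_def)
    have sp: "space (extension t h) = space (paths (Suc t))" by (rule sets_eq_imp_space_eq[OF s])
    have "integrable (extension t h) (future j B s)"
      using IH by (intro integrable_const_bound[of _ 1]) (auto simp: sp measurable_cong_sets[OF s refl])
    then show ?thesis using IH(2) unfolding eq[OF h]
      by (auto intro!: integral_nonneg_AE integral_le_const AE_I2 simp: sp)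
  qed
  ultimately show ?case unfolding t_def by blast
qed

text \<open>The Markov property: besides the present pair only coordinates from \<open>j\<close> on
  that are already realised matter. Up to time \<open>j\<close> there are none apart from the
  present pair.\<close>

lemma future_cong:
  assumes "s < n" and "h (n - s) = h' (n - s)" and "\<And>r. j \<le> r \<Longrightarrow> r \<le> n - s \<Longrightarrow> h r = h' r"
  shows "future j B s h = future j B s h'"
  using assms
proof (induction s arbitrary: h h')
  case 0
  then show ?case by (auto simp: states_def intro!: arg_cong[where f = "indicator B"])
next
  case (Suc s)
  then have ns: "n - s = Suc (n - Suc s)" by simp
  have "future j B s (h(n - s := z)) = future j B s (h'(n - s := z))" for z
    using Suc.prems by (intro Suc.IH) (auto simp: ns)
  then show ?case using Suc.prems(2) by simp
qed

text \<open>Lets the law of the first segment alone be read off from the joint formula, with the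
  whole space as \<open>B\<close>.\<close>

lemma future_whole_space:
  assumes "s < n" "h \<in> space (paths (n - s))"
  shows "future j (space (state_seqs {j..n})) s h = 1"
  using assms
proof (induction s arbitrary: h)
  case 0
  then show ?case by (simp add: states_in_space)
next
  case (Suc s)
  define t where "t = n - Suc s"
  have t: "n - s = Suc t" "1 \<le> t" "t < n" "t \<le> t" using Suc.prems by (auto simp: t_def)
  have h: "h \<in> space (paths t)" using Suc.prems by (simp add: t_def)
  have ht: "h t \<in> space E" by (rule path_component_in_space[OF h t(2,4)])
  interpret prob_space "step t (h t)" by (rule step_prob[OF t(2,3) ht])
  have "future j (space (state_seqs {j..n})) (Suc s) h =
      (\<integral>z. future j (space (state_seqs {j..n})) s (h(Suc t := z)) \<partial>step t (h t))"
    by (simp add: t(1) t_def)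
  also have "\<dots> = (\<integral>z. 1 \<partial>step t (h t))"
  proof (rule Bochner_Integration.integral_cong)
    fix z assume "z \<in> space (step t (h t))"
    then have "h(Suc t := z) \<in> space (paths (Suc t))"
      by (intro extend_in_space[OF h]) (simp add: step_prob(3)[OF t(2,3) ht])
    then show "future j (space (state_seqs {j..n})) s (h(Suc t := z)) = 1"
      using Suc.prems by (intro Suc.IH) (auto simp only: t)
  qed simp
  finally show ?case by (simp add: prob_space)
qed

text \<open>The tower property, integrating out one coordinate at a time from time \<open>n\<close>
  downwards. The indicator of \<open>A\<close> can be pulled out because every coordinate integrated
  out lies after \<open>i\<close>.\<close>

lemma nn_integral_future:
  assumes p0: "p0 \<in> space (prob_algebra E)" and B: "B \<in> sets (state_seqs {j..n})" and "1 \<le> j"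
    and A: "A \<in> sets (state_seqs {1..i})" and "1 \<le> i" "i + s \<le> n"
  shows "(\<integral>\<^sup>+h. indicator A (states 1 i h) * ennreal (future j B s h) \<partial>adaptive_joint G p0 K g (n - s - 1)) =
    (\<integral>\<^sup>+h. indicator A (states 1 i h) * indicator B (states j n h) \<partial>adaptive_joint G p0 K g (n - 1))"
  using assms(6)
proof (induction s)
  case 0
  show ?case by (auto intro!: nn_integral_cong simp: indicator_def)
next
  case (Suc s)
  define t where "t = n - Suc (Suc s)"
  have t: "n - s = Suc (Suc t)" "Suc t < n" "i \<le> Suc t" "n - Suc s = Suc t" "s < n"
    using Suc.prems assms(5) by (auto simp: t_def)
  have [measurable]: "states 1 i \<in> paths (Suc (Suc t)) \<rightarrow>\<^sub>M state_seqs {1..i}" "A \<in> sets (state_seqs {1..i})"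
    using t A by (auto intro!: measurable_states)
  have f: "future j B s \<in> borel_measurable (paths (Suc (Suc t)))"
    "\<And>h. h \<in> space (paths (Suc (Suc t))) \<Longrightarrow> 0 \<le> future j B s h \<and> future j B s h \<le> 1"
    using future_measurable_bounded[OF B assms(3), of s] t by auto
  have H: "(\<lambda>h. indicator A (states 1 i h) * ennreal (future j B s h)) \<in> borel_measurable (paths (Suc (Suc t)))"
    using f(1) by measurable
  have sp: "space (adaptive_joint G p0 K g t) = space (paths (Suc t))"
    using adaptive_joint_prob[OF p0, of t] t(2) by (intro sets_eq_imp_space_eq) (simp add: space_prob_algebra)
  have "(\<integral>\<^sup>+h. indicator A (states 1 i h) * ennreal (future j B s h) \<partial>adaptive_joint G p0 K g (n - s - 1)) =
    (\<integral>\<^sup>+h. (\<integral>\<^sup>+z. indicator A (states 1 i (h(Suc (Suc t) := z))) * ennreal (future j B s (h(Suc (Suc t) := z)))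
       \<partial>step (Suc t) (h (Suc t))) \<partial>adaptive_joint G p0 K g t)"
    using nn_integral_adaptive_joint_Suc[OF p0 t(2) H] by (simp add: t)
  also have "\<dots> = (\<integral>\<^sup>+h. indicator A (states 1 i h) * ennreal (future j B (Suc s) h) \<partial>adaptive_joint G p0 K g t)"
  proof (rule nn_integral_cong)
    fix h assume "h \<in> space (adaptive_joint G p0 K g t)"
    then have h: "h \<in> space (paths (Suc t))" by (simp add: sp)
    have ht: "h (Suc t) \<in> space E" by (rule path_component_in_space[OF h]) auto
    have st: "prob_space (step (Suc t) (h (Suc t)))" "sets (step (Suc t) (h (Suc t))) = sets E"
      "space (step (Suc t) (h (Suc t))) = space E"
      by (rule step_prob[OF _ t(2) ht], simp)+
    interpret prob_space "step (Suc t) (h (Suc t))" by fact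
    have fm: "(\<lambda>z. future j B s (h(Suc (Suc t) := z))) \<in> borel_measurable (step (Suc t) (h (Suc t)))"
      using measurable_compose[OF measurable_extend_at[OF h] f(1)] by (simp add: measurable_cong_sets[OF st(2) refl])
    have b: "0 \<le> future j B s (h(Suc (Suc t) := z)) \<and> future j B s (h(Suc (Suc t) := z)) \<le> 1" if "z \<in> space E" for z
      by (rule f(2)[OF extend_in_space[OF h that]])
    have "states 1 i (h(Suc (Suc t) := z)) = states 1 i h" for z
      using t(3) by (auto simp: states_def)
    then have "(\<integral>\<^sup>+z. indicator A (states 1 i (h(Suc (Suc t) := z))) * ennreal (future j B s (h(Suc (Suc t) := z)))
        \<partial>step (Suc t) (h (Suc t))) =
      indicator A (states 1 i h) * (\<integral>\<^sup>+z. ennreal (future j B s (h(Suc (Suc t) := z))) \<partial>step (Suc t) (h (Suc t)))"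
      using fm by (simp add: nn_integral_cmult)
    also have "(\<integral>\<^sup>+z. ennreal (future j B s (h(Suc (Suc t) := z))) \<partial>step (Suc t) (h (Suc t))) =
      ennreal (\<integral>z. future j B s (h(Suc (Suc t) := z)) \<partial>step (Suc t) (h (Suc t)))"
      using fm b st by (intro nn_integral_eq_integral integrable_const_bound[of _ 1] AE_I2) auto
    finally show "(\<integral>\<^sup>+z. indicator A (states 1 i (h(Suc (Suc t) := z))) * ennreal (future j B s (h(Suc (Suc t) := z)))
        \<partial>step (Suc t) (h (Suc t))) = indicator A (states 1 i h) * ennreal (future j B (Suc s) h)"
      by (simp only: future.simps t)
  qed
  finally show ?case using Suc by (simp add: t_def)
qed

text \<open>Backward induction that starts at time \<open>j\<close>, where the product is empty and
  the bound 1 holds because probabilities lie in \<open>[0, 1]\<close>. Each earlier step integrates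
  a function of known oscillation against two product kernels, which multiplies the bound by one
  factor.\<close>

lemma future_oscillation:
  assumes B: "B \<in> sets (state_seqs {j..n})" and j: "1 \<le> j" "j \<le> n"
    and \<kappa>: "\<kappa> \<le> 1" "\<And>w w' \<gamma> \<gamma>'. \<gamma> \<in> space G \<Longrightarrow> \<gamma>' \<in> space G \<Longrightarrow> tv_dist (K \<gamma> w) (K \<gamma>' w') \<le> \<kappa>"
    and l: "\<And>k. 1 \<le> k \<Longrightarrow> k < n \<Longrightarrow> l k \<le> 1"
      "\<And>k w w' \<gamma> \<gamma>'. 1 \<le> k \<Longrightarrow> k < n \<Longrightarrow> \<gamma> \<in> space G \<Longrightarrow> \<gamma>' \<in> space G \<Longrightarrow> tv_dist (g k w \<gamma>) (g k w' \<gamma>') \<le> l k"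
    and "s < n" "n - s \<le> j" "h \<in> space (paths (n - s))" "h' \<in> space (paths (n - s))"
  shows "future j B s h - future j B s h' \<le> (\<Prod>k=n-s..<j. \<kappa> + l k - \<kappa> * l k)"
  using assms(8-11)
proof (induction s arbitrary: h h')
  case 0
  have "(\<Prod>k=n-0..<j. \<kappa> + l k - \<kappa> * l k) = 1" using j by simp
  then show ?case by (simp only:) (simp add: indicator_def)
next
  case (Suc s)
  show ?case
  proof (cases "n - Suc s = j")
    case True
    have "0 \<le> future j B (Suc s) h' \<and> future j B (Suc s) h \<le> 1"
      using future_measurable_bounded[OF B j(1) Suc.prems(1)] Suc.prems by blast
    then show ?thesis using True by (simp del: future.simps)
  next
    case False
    define t where "t = n - Suc s"
    have t: "n - s = Suc t" "1 \<le> t" "t < n" "t < j" "t \<le> t" "s < n" "n - Suc s = t"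
      using Suc.prems False by (auto simp: t_def)
    have h: "h \<in> space (paths t)" "h' \<in> space (paths t)" using Suc.prems by (auto simp: t_def)
    have ht: "h t \<in> space E" "h' t \<in> space E"
      using path_component_in_space h t(2,5) by blast+
    define \<psi> where "\<psi> z = future j B s (h(Suc t := z))" for z
    \<comment> \<open>As \<open>t < j\<close>, the next conditional probability sees only the new
      pair \<open>z\<close>. Both paths therefore integrate the same function \<open>\<psi>\<close>,
      and only the kernels differ.\<close>
    have "future j B s (h'(Suc t := z)) = \<psi> z" for z
      unfolding \<psi>_def using t by (intro future_cong) auto
    then have eq: "future j B (Suc s) h - future j B (Suc s) h' =
        integral\<^sup>L (step t (h t)) \<psi> - integral\<^sup>L (step t (h' t)) \<psi>"
      by (simp add: t(1,7) \<psi>_def[abs_def])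
    have f: "future j B s \<in> borel_measurable (paths (Suc t))"
      "\<And>h. h \<in> space (paths (Suc t)) \<Longrightarrow> 0 \<le> future j B s h"
      using future_measurable_bounded[OF B j(1) t(6)] unfolding t(1) by auto
    have \<psi>m: "\<psi> \<in> borel_measurable E"
      unfolding \<psi>_def by (rule measurable_compose[OF measurable_extend_at[OF h(1)] f(1)])
    obtain w \<gamma> w' \<gamma>' where z: "h t = (w, \<gamma>)" "h' t = (w', \<gamma>')" by fastforce
    have \<gamma>: "\<gamma> \<in> space G" "\<gamma>' \<in> space G" using ht by (auto simp: z space_pair_measure)
    have st: "step t (h t) = K \<gamma> w \<Otimes>\<^sub>M g t w \<gamma>" "step t (h' t) = K \<gamma>' w' \<Otimes>\<^sub>M g t w' \<gamma>'"
      by (auto simp: step_def z)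
    have KK: "prob_space (K \<gamma> w)" "prob_space (K \<gamma>' w')" "sets (K \<gamma>' w') = sets (K \<gamma> w)"
      using K_in_prob_algebra \<gamma> by (auto simp: space_prob_algebra)
    have gg: "prob_space (g t w \<gamma>)" "prob_space (g t w' \<gamma>')" "sets (g t w' \<gamma>') = sets (g t w \<gamma>)"
      using g_in_prob_algebra[OF t(2,3)] \<gamma> by (auto simp: space_prob_algebra)
    have sE: "sets (K \<gamma> w \<Otimes>\<^sub>M g t w \<gamma>) = sets E" "space (K \<gamma> w \<Otimes>\<^sub>M g t w \<gamma>) = space E"
      using step_prob[OF t(2,3) ht(1)] by (simp_all add: st)
    have "integral\<^sup>L (step t (h t)) \<psi> - integral\<^sup>L (step t (h' t)) \<psi> \<le>
        (\<kappa> + l t - \<kappa> * l t) * (\<Prod>k=Suc t..<j. \<kappa> + l k - \<kappa> * l k)"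
      unfolding st
    proof (rule pair_integral_diff_le[OF KK \<kappa>(2)[OF \<gamma>] \<kappa>(1) gg l(2)[OF t(2,3) \<gamma>] l(1)[OF t(2,3)]])
      show "\<psi> \<in> borel_measurable (K \<gamma> w \<Otimes>\<^sub>M g t w \<gamma>)"
        using \<psi>m by (simp add: measurable_cong_sets[OF sE(1) refl])
      show "0 \<le> \<psi> z" if "z \<in> space (K \<gamma> w \<Otimes>\<^sub>M g t w \<gamma>)" for z
        unfolding \<psi>_def by (intro f extend_in_space[OF h(1)]) (use that sE in simp)
      show "\<psi> z - \<psi> z' \<le> (\<Prod>k=Suc t..<j. \<kappa> + l k - \<kappa> * l k)"
        if "z \<in> space (K \<gamma> w \<Otimes>\<^sub>M g t w \<gamma>)" "z' \<in> space (K \<gamma> w \<Otimes>\<^sub>M g t w \<gamma>)" for z z'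
      proof -
        have "z \<in> space E" "z' \<in> space E" using that sE by auto
        note z = extend_in_space[OF h(1) this(1)] extend_in_space[OF h(1) this(2)]
        have "n - s \<le> j" using t(1,4) by simp
        from Suc.IH[OF t(6) this, unfolded t(1), OF z] show ?thesis unfolding \<psi>_def .
      qed
    qed
    also have "\<dots> = (\<Prod>k=t..<j. \<kappa> + l k - \<kappa> * l k)"
      using t(4) by (simp add: prod.atLeast_Suc_lessThan)
    finally show ?thesis unfolding eq t(7) .
  qed
qed

section \<open>The law of the state process\<close>

lemma adaptive_markov_eq:
  "adaptive_markov G p0 K g n = distr (adaptive_joint G p0 K g (n - 1)) (state_seqs {1..n}) (states 1 n)"
  by (simp add: adaptive_markov_def states_def[abs_def])

lemma measurable_states_joint:
  assumes "p0 \<in> space (prob_algebra E)" "1 \<le> n"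
  shows "states 1 n \<in> adaptive_joint G p0 K g (n - 1) \<rightarrow>\<^sub>M state_seqs {1..n}"
proof -
  have "sets (adaptive_joint G p0 K g (n - 1)) = sets (paths n)"
    using adaptive_joint_prob[OF assms(1), of "n - 1"] assms(2) by (simp add: space_prob_algebra)
  then show ?thesis using measurable_states[of 1 n n] measurable_cong_sets by blast
qed

lemma adaptive_markov_prob:
  assumes "p0 \<in> space (prob_algebra E)" "1 \<le> n"
  shows "adaptive_markov G p0 K g n \<in> space (prob_algebra (state_seqs {1..n}))"
  using adaptive_joint_prob[OF assms(1), of "n - 1"] assms(2) measurable_states_joint[OF assms]
  unfolding adaptive_markov_eq by (simp add: space_prob_algebra prob_space.prob_space_distr)

lemma emeasure_adaptive_markov_eq_nn_integral:
  assumes "p0 \<in> space (prob_algebra E)" "1 \<le> n" and S: "S \<in> sets (state_seqs {1..n})"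
  shows "emeasure (adaptive_markov G p0 K g n) S = (\<integral>\<^sup>+h. indicator S (states 1 n h) \<partial>adaptive_joint G p0 K g (n - 1))"
proof -
  have "(\<integral>\<^sup>+h. indicator S (states 1 n h) \<partial>adaptive_joint G p0 K g (n - 1)) =
      (\<integral>\<^sup>+x. indicator S x \<partial>adaptive_markov G p0 K g n)"
    unfolding adaptive_markov_eq
    by (rule nn_integral_distr[OF measurable_states_joint[OF assms(1,2)], symmetric]) (use S in simp)
  also have "\<dots> = emeasure (adaptive_markov G p0 K g n) S"
    by (rule nn_integral_indicator) (use S in \<open>simp add: adaptive_markov_def\<close>)
  finally show ?thesis by (rule sym)
qed

text \<open>The history on the right contains the indices. Thus joint probabilities of the two
  segments are computed without conditioning on the states alone.\<close>

lemma emeasure_adaptive_markov: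
  assumes p0: "p0 \<in> space (prob_algebra E)" and ij: "1 \<le> i" "i \<le> n" "1 \<le> j"
    and A: "A \<in> sets (state_seqs {1..i})" and B: "B \<in> sets (state_seqs {j..n})"
  defines "Q \<equiv> adaptive_markov G p0 K g n"
  shows "emeasure Q {x \<in> space Q. restrict x {1..i} \<in> A \<and> restrict x {j..n} \<in> B} =
    (\<integral>\<^sup>+h. indicator A (states 1 i h) * ennreal (future j B (n - i) h) \<partial>adaptive_joint G p0 K g (i - 1))"
proof -
  let ?J = "adaptive_joint G p0 K g (n - 1)"
  let ?W = "{x \<in> space (state_seqs {1..n}). restrict x {1..i} \<in> A \<and> restrict x {j..n} \<in> B}"
  have n: "1 \<le> n" using ij by simp
  note m[measurable] = measurable_states_joint[OF p0 n]
  have [measurable]: "(\<lambda>x. restrict x {1..i}) \<in> state_seqs {1..n} \<rightarrow>\<^sub>M state_seqs {1..i}"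
    "(\<lambda>x. restrict x {j..n}) \<in> state_seqs {1..n} \<rightarrow>\<^sub>M state_seqs {j..n}"
    unfolding state_seqs_def using ij by (auto intro!: measurable_restrict_subset)
  note [measurable] = A B
  have W: "?W \<in> sets (state_seqs {1..n})" by measurable
  have restr: "restrict (states 1 n h) {1..i} = states 1 i h" "restrict (states 1 n h) {j..n} = states j n h" for h
    using ij by (auto simp: states_def)
  have "emeasure Q ?W = (\<integral>\<^sup>+h. indicator ?W (states 1 n h) \<partial>?J)"
    unfolding Q_def by (rule emeasure_adaptive_markov_eq_nn_integral[OF p0 n W])
  also have "\<dots> = (\<integral>\<^sup>+h. indicator A (states 1 i h) * indicator B (states j n h) \<partial>?J)"
    by (intro nn_integral_cong) (auto simp: indicator_def restr[simplified] states_in_space[of "Suc 0", simplified])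
  also have "\<dots> = (\<integral>\<^sup>+h. indicator A (states 1 i h) * ennreal (future j B (n - i) h) \<partial>adaptive_joint G p0 K g (n - (n - i) - 1))"
    using ij by (intro nn_integral_future[symmetric] p0 A B) auto
  finally show ?thesis using ij by (simp add: Q_def adaptive_markov_eq)
qed

text \<open>\<open>future\<close> stays pointwise in an interval of the length given by the product.
  Integrating over the event that the first segment lies in \<open>A\<close> averages out the index
  and keeps the interval, the same one for all \<open>A\<close>.\<close>

lemma adaptive_markov_oscillation:
  assumes p0: "p0 \<in> space (prob_algebra E)" and ij: "1 \<le> i" "i < j" "j \<le> n"
    and \<kappa>: "\<kappa> \<le> 1" "\<And>w w' \<gamma> \<gamma>'. \<gamma> \<in> space G \<Longrightarrow> \<gamma>' \<in> space G \<Longrightarrow> tv_dist (K \<gamma> w) (K \<gamma>' w') \<le> \<kappa>"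
    and l: "\<And>k. 1 \<le> k \<Longrightarrow> k < n \<Longrightarrow> l k \<le> 1"
      "\<And>k w w' \<gamma> \<gamma>'. 1 \<le> k \<Longrightarrow> k < n \<Longrightarrow> \<gamma> \<in> space G \<Longrightarrow> \<gamma>' \<in> space G \<Longrightarrow> tv_dist (g k w \<gamma>) (g k w' \<gamma>') \<le> l k"
    and B: "B \<in> sets (state_seqs {j..n})"
  defines "Q \<equiv> adaptive_markov G p0 K g n"
  shows "\<exists>a. \<forall>A\<in>sets (state_seqs {1..i}).
    a * measure Q {x \<in> space Q. restrict x {1..i} \<in> A} \<le>
      measure Q {x \<in> space Q. restrict x {1..i} \<in> A \<and> restrict x {j..n} \<in> B} \<and>
    measure Q {x \<in> space Q. restrict x {1..i} \<in> A \<and> restrict x {j..n} \<in> B} \<le>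
      (a + (\<Prod>k=i..<j. \<kappa> + l k - \<kappa> * l k)) * measure Q {x \<in> space Q. restrict x {1..i} \<in> A}"
proof -
  let ?J = "adaptive_joint G p0 K g (i - 1)"
  let ?f = "future j B (n - i)"
  define c where "c = (\<Prod>k=i..<j. \<kappa> + l k - \<kappa> * l k)"
  have i: "n - (n - i) = i" "n - i < n" "i \<le> n" "1 \<le> j" "Suc (i - 1) = i" using ij by auto
  have Jp: "?J \<in> space (prob_algebra (paths i))"
    using adaptive_joint_prob[OF p0, of "i - 1"] ij i(5) by simp
  then interpret J: prob_space ?J by (simp add: space_prob_algebra)
  have sJ: "sets ?J = sets (paths i)" using Jp by (simp add: space_prob_algebra)
  have spJ: "space ?J = space (paths i)" by (rule sets_eq_imp_space_eq[OF sJ])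
  have mJ: "f \<in> borel_measurable ?J" if "f \<in> borel_measurable (paths i)" for f :: "_ \<Rightarrow> real"
    using that measurable_cong_sets[OF sJ refl] by blast
  have f: "?f \<in> borel_measurable (paths i)" "\<And>h. h \<in> space (paths i) \<Longrightarrow> 0 \<le> ?f h" "\<And>h. h \<in> space (paths i) \<Longrightarrow> ?f h \<le> 1"
    using future_measurable_bounded[OF B i(4,2)] unfolding i(1) by auto
  have osc: "?f h - ?f h' \<le> c" if "h \<in> space (paths i)" "h' \<in> space (paths i)" for h h'
    using future_oscillation[OF B i(4) ij(3) \<kappa> l i(2), of h h'] ij that unfolding i(1) c_def by auto
  \<comment> \<open>The infimum runs over all histories of pairs, which is why \<open>a\<close>
    depends on \<open>B\<close> but not on \<open>A\<close>.\<close>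
  define a where "a = (INF h\<in>space (paths i). ?f h)"
  have "bdd_below (?f ` space (paths i))" using f(2) by (auto intro!: bdd_belowI[of _ 0])
  then have ah: "a \<le> ?f h" if "h \<in> space (paths i)" for h unfolding a_def using that by (rule cINF_lower)
  have ac: "?f h \<le> a + c" if "h \<in> space (paths i)" for h
  proof -
    have "?f h - c \<le> a" unfolding a_def using osc that by (intro cINF_greatest) (auto simp: algebra_simps)
    then show ?thesis by simp
  qed
  interpret Q: prob_space Q
    unfolding Q_def using adaptive_markov_prob[OF p0] ij by (simp add: space_prob_algebra)
  have "a * measure Q {x \<in> space Q. restrict x {1..i} \<in> A} \<le>
      measure Q {x \<in> space Q. restrict x {1..i} \<in> A \<and> restrict x {j..n} \<in> B} \<and>
    measure Q {x \<in> space Q. restrict x {1..i} \<in> A \<and> restrict x {j..n} \<in> B} \<le>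
      (a + c) * measure Q {x \<in> space Q. restrict x {1..i} \<in> A}"
    if A: "A \<in> sets (state_seqs {1..i})" for A
  proof -
    define u :: "_ \<Rightarrow> real" where "u h = indicator A (states 1 i h)" for h
    have um: "u \<in> borel_measurable (paths i)"
      unfolding u_def using A measurable_states[of 1 i i] by measurable
    have u01: "0 \<le> u h" "u h \<le> 1" for h by (auto simp: u_def indicator_def)
    have "integrable ?J u"
      using u01 by (intro J.integrable_const_bound[of _ 1] AE_I2 mJ um) simp
    moreover have "integrable ?J (\<lambda>h. u h * ?f h)"
      using u01 f spJ
      by (intro J.integrable_const_bound[of _ 1] AE_I2 mJ borel_measurable_times um)
         (simp_all add: abs_mult mult_le_one)
    ultimately have int: "integrable ?J u" "integrable ?J (\<lambda>h. u h * ?f h)" by blast+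
    have meas: "measure Q {x \<in> space Q. restrict x {1..i} \<in> A \<and> restrict x {j..n} \<in> B'} = (\<integral>h. u h * future j B' (n - i) h \<partial>?J)"
      if B': "B' \<in> sets (state_seqs {j..n})" for B'
    proof -
      have f': "future j B' (n - i) \<in> borel_measurable (paths i)"
          "\<And>h. h \<in> space (paths i) \<Longrightarrow> 0 \<le> future j B' (n - i) h"
        using future_measurable_bounded[OF B' i(4,2)] unfolding i(1) by auto
      have "(\<integral>h. u h * future j B' (n - i) h \<partial>?J) = enn2real (\<integral>\<^sup>+h. ennreal (u h * future j B' (n - i) h) \<partial>?J)"
        using f' u01 spJ by (intro integral_eq_nn_integral AE_I2 mJ borel_measurable_times um) auto
      also have "(\<integral>\<^sup>+h. ennreal (u h * future j B' (n - i) h) \<partial>?J) =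
          (\<integral>\<^sup>+h. indicator A (states 1 i h) * ennreal (future j B' (n - i) h) \<partial>?J)"
        by (intro nn_integral_cong) (auto simp: u_def indicator_def)
      also have "\<dots> = emeasure Q {x \<in> space Q. restrict x {1..i} \<in> A \<and> restrict x {j..n} \<in> B'}"
        unfolding Q_def by (rule emeasure_adaptive_markov[OF p0 ij(1) i(3,4) A B', symmetric])
      finally show ?thesis by (simp add: measure_def)
    qed
    \<comment> \<open>Taking the whole space for the future event brings the marginal under the same
      formula \<open>meas\<close>.\<close>
    have "{x \<in> space Q. restrict x {1..i} \<in> A} =
        {x \<in> space Q. restrict x {1..i} \<in> A \<and> restrict x {j..n} \<in> space (state_seqs {j..n})}"
      by (auto simp: state_seqs_def space_PiM)
    then have "measure Q {x \<in> space Q. restrict x {1..i} \<in> A} =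
        (\<integral>h. u h * future j (space (state_seqs {j..n})) (n - i) h \<partial>?J)"
      using meas[OF sets.top] by simp
    also have "\<dots> = (\<integral>h. u h \<partial>?J)"
      using future_whole_space[OF i(2)] unfolding i(1) by (intro Bochner_Integration.integral_cong) (auto simp: spJ[simplified])
    finally have QA: "measure Q {x \<in> space Q. restrict x {1..i} \<in> A} = (\<integral>h. u h \<partial>?J)" .
    have "(\<integral>h. a * u h \<partial>?J) \<le> (\<integral>h. u h * ?f h \<partial>?J)"
      using int ah u01 by (intro integral_mono) (auto simp: spJ[simplified] mult.commute[of a] intro!: mult_left_mono)
    moreover have "(\<integral>h. u h * ?f h \<partial>?J) \<le> (\<integral>h. (a + c) * u h \<partial>?J)"
      using int ac u01 by (intro integral_mono) (auto simp: spJ[simplified] mult.commute[of "a + c"] intro!: mult_left_mono)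
    ultimately show ?thesis unfolding meas[OF B] QA by simp
  qed
  then show ?thesis unfolding c_def by blast
qed

end

section \<open>Mixing coefficients and strictly positive perturbations\<close>

text \<open>Disintegration asks for a Polish type, while segments form only a subset of one. They
  are embedded into the type of all sequences, with \<open>undefined\<close> outside the index set;
  measurability is checked coordinate by coordinate.\<close>

lemma measurable_restrict_borel:
  assumes "I \<subseteq> J"
  shows "(\<lambda>x. restrict x I) \<in> (state_seqs J :: (nat \<Rightarrow> 'a::polish_space) measure) \<rightarrow>\<^sub>M borel"
proof (rule measurable_coordinatewise_then_product)
  fix s
  show "(\<lambda>x. restrict x I s) \<in> (state_seqs J :: (nat \<Rightarrow> 'a) measure) \<rightarrow>\<^sub>M borel"
    using assms by (cases "s \<in> I") (auto simp: state_seqs_def intro!: measurable_component_singleton)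
qed

text \<open>The way back from the Polish type to segments; it holds because coordinates are
  continuous.\<close>

lemma measurable_restrict_from_borel:
  "(\<lambda>x. restrict x I) \<in> borel \<rightarrow>\<^sub>M (state_seqs I :: (nat \<Rightarrow> 'a::polish_space) measure)"
  unfolding state_seqs_def
proof (rule measurable_restrict)
  fix s
  have "continuous_on UNIV (\<lambda>x :: nat \<Rightarrow> 'a. x s)"
    using continuous_on_product_then_coordinatewise[of UNIV "\<lambda>x :: nat \<Rightarrow> 'a. x" s] by simp
  then show "(\<lambda>x :: nat \<Rightarrow> 'a. x s) \<in> borel_measurable borel" by (rule borel_measurable_continuous_onI)
qed

lemma measurable_restrict_state_seqs:
  assumes "I \<subseteq> J"
  shows "(\<lambda>x. restrict x I) \<in> (state_seqs J :: (nat \<Rightarrow> 'a::polish_space) measure) \<rightarrow>\<^sub>M state_seqs I"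
  unfolding state_seqs_def by (rule measurable_restrict_subset[OF assms])

text \<open>The later segment is viewed in the Polish type of sequences, disintegrated there with
  controlled oscillation, and the resulting laws are pushed back by restriction. Events of segments
  pull back to Borel sets, so the bound survives, and it then applies in particular to pasts that
  differ in the last state only.\<close>

lemma eta_direct_le:
  fixes Q :: "(nat \<Rightarrow> 'a::polish_space) measure"
  assumes Q: "Q \<in> space (prob_algebra (state_seqs {1..n}))" and ij: "1 \<le> i" "i < j" "j \<le> n"
    and osc: "\<And>B. B \<in> sets (state_seqs {j..n}) \<Longrightarrow> \<exists>a. \<forall>A\<in>sets (state_seqs {1..i}).
      a * measure Q {x \<in> space Q. restrict x {1..i} \<in> A} \<le>
        measure Q {x \<in> space Q. restrict x {1..i} \<in> A \<and> restrict x {j..n} \<in> B} \<and>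
      measure Q {x \<in> space Q. restrict x {1..i} \<in> A \<and> restrict x {j..n} \<in> B} \<le>
        (a + c) * measure Q {x \<in> space Q. restrict x {1..i} \<in> A}"
  shows "eta_direct n Q i j \<le> ereal c"
proof -
  interpret Q: prob_space Q using Q by (simp add: space_prob_algebra)
  have sQ: "sets Q = sets (state_seqs {1..n})" using Q by (simp add: space_prob_algebra)
  let ?M = "state_seqs {1..i} :: (nat \<Rightarrow> 'a) measure"
  let ?N = "state_seqs {j..n} :: (nat \<Rightarrow> 'a) measure"
  let ?X = "\<lambda>x :: nat \<Rightarrow> 'a. restrict x {1..i}" and ?Y = "\<lambda>x :: nat \<Rightarrow> 'a. restrict x {j..n}"
  have sub: "{1..i} \<subseteq> {1..n}" "{j..n} \<subseteq> {1..n}" using ij by auto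
  have X: "?X \<in> Q \<rightarrow>\<^sub>M ?M" and Y: "?Y \<in> Q \<rightarrow>\<^sub>M borel"
    unfolding measurable_cong_sets[OF sQ refl]
    by (rule measurable_restrict_state_seqs[OF sub(1)], rule measurable_restrict_borel[OF sub(2)])
  have XY: "(\<lambda>x. (?X x, ?Y x)) \<in> Q \<rightarrow>\<^sub>M ?M \<Otimes>\<^sub>M borel" by (rule measurable_Pair[OF X Y])
  define m where "m = distr Q (?M \<Otimes>\<^sub>M borel) (\<lambda>x. (?X x, ?Y x))"
  have pm: "prob_space m" unfolding m_def by (rule Q.prob_space_distr[OF XY])
  have sm: "sets m = sets (?M \<Otimes>\<^sub>M borel)" by (simp add: m_def)
  have em: "emeasure m (A \<times> B) = emeasure Q {x \<in> space Q. ?X x \<in> A \<and> ?Y x \<in> B}"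
    if "A \<in> sets ?M" "B \<in> sets borel" for A B
    unfolding m_def using that XY by (subst emeasure_distr) (auto intro!: arg_cong[where f = "emeasure Q"])
  have mm: "measure m (A \<times> B) = measure Q {x \<in> space Q. ?X x \<in> A \<and> ?Y x \<in> B}"
    if "A \<in> sets ?M" "B \<in> sets borel" for A B
    using em[OF that] by (simp add: measure_def)
  have "\<exists>a. \<forall>A\<in>sets ?M. a * measure m (A \<times> UNIV) \<le> measure m (A \<times> B) \<and>
      measure m (A \<times> B) \<le> (a + c) * measure m (A \<times> UNIV)" if B: "B \<in> sets borel" for B
  proof -
    have "?Y -` B \<inter> space ?N \<in> sets ?N" using measurable_sets[OF measurable_restrict_borel[OF subset_refl] B] .
    from osc[OF this] obtain a where a: "\<And>A. A \<in> sets ?M \<Longrightarrow>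
      a * measure Q {x \<in> space Q. ?X x \<in> A} \<le>
        measure Q {x \<in> space Q. ?X x \<in> A \<and> ?Y x \<in> ?Y -` B \<inter> space ?N} \<and>
      measure Q {x \<in> space Q. ?X x \<in> A \<and> ?Y x \<in> ?Y -` B \<inter> space ?N} \<le>
        (a + c) * measure Q {x \<in> space Q. ?X x \<in> A}" by blast
    have "?Y x \<in> ?Y -` B \<inter> space ?N \<longleftrightarrow> ?Y x \<in> B" for x
      by (auto simp: state_seqs_def space_PiM)
    then show ?thesis using a B by (intro exI[of _ a] ballI) (simp add: mm)
  qed
  then obtain L where L: "L \<in> ?M \<rightarrow>\<^sub>M prob_algebra borel"
    and Lm: "\<And>A B. A \<in> sets ?M \<Longrightarrow> B \<in> sets borel \<Longrightarrow>
      emeasure m (A \<times> B) = (\<integral>\<^sup>+x\<in>A. emeasure (L x) B \<partial>distr m ?M fst)"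
    and Lc: "\<And>x x' B. x \<in> space ?M \<Longrightarrow> x' \<in> space ?M \<Longrightarrow> B \<in> sets borel \<Longrightarrow> measure (L x) B - measure (L x') B \<le> c"
    by (rule disintegration_bounded_oscillation[OF pm sm]) blast+
  note R = measurable_restrict_from_borel[of "{j..n}", where 'a = 'a]
  define L' where "L' x = distr (L x) ?N ?Y" for x
  have L': "L' \<in> ?M \<rightarrow>\<^sub>M prob_algebra ?N"
    unfolding L'_def by (rule measurable_compose[OF L measurable_distr_prob_space[OF R]])
  have Lp: "prob_space (L x)" "sets (L x) = sets borel" if "x \<in> space ?M" for x
    using measurable_space[OF L that] by (auto simp: space_prob_algebra)
  have L'p: "prob_space (L' x)" "sets (L' x) = sets ?N" if "x \<in> space ?M" for x
    using measurable_space[OF L' that] by (auto simp: space_prob_algebra)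
  have RB: "?Y -` B \<in> sets borel" if "B \<in> sets ?N" for B
    using measurable_sets[OF R that] by simp
  have eL': "emeasure (L' x) B = emeasure (L x) (?Y -` B)" if "x \<in> space ?M" "B \<in> sets ?N" for x B
    unfolding L'_def using R that Lp(2)[OF that(1)] sets_eq_imp_space_eq[OF Lp(2)[OF that(1)]]
    by (subst emeasure_distr) (auto simp: measurable_cong_sets[OF Lp(2)[OF that(1)] refl])
  have dm: "distr m ?M fst = distr Q ?M ?X"
    unfolding m_def using XY by (subst distr_distr) (auto simp: comp_def)
  have "is_cond_law n Q i j L'"
    unfolding is_cond_law_def
  proof (intro conjI ballI L')
    fix A B assume A: "A \<in> sets ?M" and B: "B \<in> sets ?N"
    have "emeasure Q {x \<in> space Q. ?X x \<in> A \<and> ?Y x \<in> B} = emeasure m (A \<times> (?Y -` B))"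
      using A RB[OF B] by (subst em) auto
    also have "\<dots> = (\<integral>\<^sup>+x\<in>A. emeasure (L x) (?Y -` B) \<partial>distr Q ?M ?X)"
      using Lm[OF A RB[OF B]] unfolding dm .
    also have "\<dots> = (\<integral>\<^sup>+x\<in>A. emeasure (L' x) B \<partial>distr Q ?M ?X)"
      by (intro nn_integral_cong) (simp add: eL' B)
    finally show "emeasure Q {x \<in> space Q. ?X x \<in> A \<and> ?Y x \<in> B} = (\<integral>\<^sup>+x\<in>A. emeasure (L' x) B \<partial>distr Q ?M ?X)" .
  qed
  then have "eta_direct n Q i j \<le> eta_sup i L'"
    unfolding eta_direct_def by (intro Inf_lower) blast
  also have "eta_sup i L' \<le> ereal c"
    unfolding eta_sup_def
  proof (intro SUP_least)
    fix y :: "nat \<Rightarrow> 'a" and w w' assume y: "y \<in> space (state_seqs {1..<i})"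
    have sp: "y(i := v) \<in> space ?M" for v
      using y ij by (auto simp: state_seqs_def space_PiM PiE_iff extensional_def)
    have "tv_dist (L' (y(i := w))) (L' (y(i := w'))) \<le> c"
    proof (rule tv_dist_leI)
      fix B assume "B \<in> sets (L' (y(i := w)))"
      then have B: "B \<in> sets ?N" using L'p(2)[OF sp] by simp
      show "measure (L' (y(i := w))) B - measure (L' (y(i := w'))) B \<le> c"
        using Lc[OF sp sp RB[OF B], of w w'] by (simp add: measure_def eL'[OF sp B])
    qed (use L'p[OF sp] in auto)
    then show "ereal (tv_dist (L' (y(i := w))) (L' (y(i := w')))) \<le> ereal c" by simp
  qed
  finally show ?thesis .
qed

section \<open>Scaled comparison of chains and positivity on boxes\<close>

lemma nn_integral_scaled_mono:
  assumes s: "sets M = sets N" and le: "\<And>A. A \<in> sets M \<Longrightarrow> c * emeasure M A \<le> emeasure N A"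
    and u: "u \<in> borel_measurable M"
  shows "c * (\<integral>\<^sup>+x. u x \<partial>M) \<le> (\<integral>\<^sup>+x. u x \<partial>N)"
proof -
  have "scale_measure c M \<le> N" by (rule measure_leI) (use s le in auto)
  then have "(\<integral>\<^sup>+x. u x \<partial>scale_measure c M) \<le> (\<integral>\<^sup>+x. u x \<partial>N)"
    by (intro nn_integral_mono_measure) (use s in auto)
  then show ?thesis by (simp add: nn_integral_scale_measure[OF u])
qed

text \<open>The factor \<open>c\<close> is paid once for the initial law and once for each of the
  \<open>t\<close> transitions, hence the exponent \<open>Suc t\<close>.\<close>

lemma adaptive_joint_scaled_mono:
  assumes "adaptive_kernels G K g n" "adaptive_kernels G K' g n"
    and p0: "p0 \<in> space (prob_algebra (borel \<Otimes>\<^sub>M G))" "p0' \<in> space (prob_algebra (borel \<Otimes>\<^sub>M G))"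
    and p_le: "\<And>A. A \<in> sets (borel \<Otimes>\<^sub>M G) \<Longrightarrow> c * emeasure p0 A \<le> emeasure p0' A"
    and K_le: "\<And>\<gamma> x A. \<gamma> \<in> space G \<Longrightarrow> A \<in> sets borel \<Longrightarrow> c * emeasure (K \<gamma> x) A \<le> emeasure (K' \<gamma> x) A"
    and "t < n" and "H \<in> borel_measurable (adaptive_kernels.paths G (Suc t))"
  shows "c ^ Suc t * (\<integral>\<^sup>+h. H h \<partial>adaptive_joint G p0 K g t) \<le> (\<integral>\<^sup>+h. H h \<partial>adaptive_joint G p0' K' g t)"
  using assms(7,8)
proof (induction t arbitrary: H)
  case 0
  have s: "sets p0 = sets (borel \<Otimes>\<^sub>M G)" "sets p0' = sets (borel \<Otimes>\<^sub>M G)" using p0 by (auto simp: space_prob_algebra)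
  interpret A: adaptive_kernels G K g n by fact
  let ?r = "\<lambda>z. \<lambda>s\<in>{1..Suc 0}. z"
  have r: "?r \<in> borel \<Otimes>\<^sub>M G \<rightarrow>\<^sub>M Pi\<^sub>M {1..Suc 0} (\<lambda>_. borel \<Otimes>\<^sub>M G)" by (intro measurable_restrict) simp
  have r1: "?r \<in> p0 \<rightarrow>\<^sub>M Pi\<^sub>M {1..Suc 0} (\<lambda>_. borel \<Otimes>\<^sub>M G)" and r2: "?r \<in> p0' \<rightarrow>\<^sub>M Pi\<^sub>M {1..Suc 0} (\<lambda>_. borel \<Otimes>\<^sub>M G)"
    using r measurable_cong_sets[OF s(1) refl] measurable_cong_sets[OF s(2) refl] by blast+
  have H: "H \<in> borel_measurable (Pi\<^sub>M {1..Suc 0} (\<lambda>_. borel \<Otimes>\<^sub>M G))" using 0 by (simp add: A.paths_def)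
  have "(\<integral>\<^sup>+h. H h \<partial>adaptive_joint G p0 K g 0) = (\<integral>\<^sup>+z. H (?r z) \<partial>p0)"
    unfolding adaptive_joint.simps by (rule nn_integral_distr[OF r1]) (use H in simp)
  moreover have "(\<integral>\<^sup>+h. H h \<partial>adaptive_joint G p0' K' g 0) = (\<integral>\<^sup>+z. H (?r z) \<partial>p0')"
    unfolding adaptive_joint.simps by (rule nn_integral_distr[OF r2]) (use H in simp)
  moreover have "c * (\<integral>\<^sup>+z. H (?r z) \<partial>p0) \<le> (\<integral>\<^sup>+z. H (?r z) \<partial>p0')"
  proof (rule nn_integral_scaled_mono)
    show "(\<lambda>z. H (?r z)) \<in> borel_measurable p0"
      using measurable_compose[OF r H] measurable_cong_sets[OF s(1) refl] by blast
  qed (use s p_le in auto)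
  ultimately show ?case by simp
next
  case (Suc t)
  interpret A: adaptive_kernels G K g n by fact
  interpret A': adaptive_kernels G K' g n by fact
  note H = Suc.prems(2)
  let ?S = "\<lambda>h. \<integral>\<^sup>+z. H (h(Suc (Suc t) := z)) \<partial>A.step (Suc t) (h (Suc t))"
  let ?S' = "\<lambda>h. \<integral>\<^sup>+z. H (h(Suc (Suc t) := z)) \<partial>A'.step (Suc t) (h (Suc t))"
  have "?S \<in> borel_measurable (A.paths (Suc t))"
  proof -
    have "(\<lambda>h. \<integral>\<^sup>+x. H x \<partial>A.extension (Suc t) h) \<in> borel_measurable (A.paths (Suc t))"
      using Suc.prems(1)
      by (intro measurable_compose[OF measurable_prob_algebraD[OF A.measurable_extension] nn_integral_measurable_subprob_algebra[OF H]]) auto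
    moreover have "(\<integral>\<^sup>+x. H x \<partial>A.extension (Suc t) h) = ?S h" if h: "h \<in> space (A.paths (Suc t))" for h
    proof -
      have s: "sets (A.step (Suc t) (h (Suc t))) = sets (borel \<Otimes>\<^sub>M G)"
        using Suc.prems(1) by (intro A.step_prob A.path_component_in_space[OF h]) auto
      show ?thesis
        unfolding A.extension_def using A.measurable_extend_at[OF h] H
        by (intro nn_integral_distr) (simp_all add: measurable_cong_sets[OF s refl])
    qed
    ultimately show ?thesis by (subst measurable_cong[where g = "\<lambda>h. \<integral>\<^sup>+x. H x \<partial>A.extension (Suc t) h"]) auto
  qed
  note S = this
  have t: "t < n" "1 \<le> Suc t" "Suc t < n" using Suc.prems(1) by auto
  have sp: "space (adaptive_joint G p0' K' g t) = space (A.paths (Suc t))"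
    using A'.adaptive_joint_prob[OF p0(2) t(1)] by (intro sets_eq_imp_space_eq) (simp add: space_prob_algebra)
  have step_le: "c * ?S h \<le> ?S' h" if h: "h \<in> space (A.paths (Suc t))" for h
  proof -
    have ht: "h (Suc t) \<in> space (borel \<Otimes>\<^sub>M G)" using t by (intro A.path_component_in_space[OF h]) auto
    obtain x \<gamma> where z: "h (Suc t) = (x, \<gamma>)" by fastforce
    have \<gamma>: "\<gamma> \<in> space G" using ht by (simp add: z space_pair_measure)
    have st: "A.step (Suc t) (h (Suc t)) = K \<gamma> x \<Otimes>\<^sub>M g (Suc t) x \<gamma>"
      "A'.step (Suc t) (h (Suc t)) = K' \<gamma> x \<Otimes>\<^sub>M g (Suc t) x \<gamma>"
      by (simp_all add: A.step_def A'.step_def z)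
    have sE: "sets (K \<gamma> x \<Otimes>\<^sub>M g (Suc t) x \<gamma>) = sets (borel \<Otimes>\<^sub>M G)"
      "sets (K' \<gamma> x \<Otimes>\<^sub>M g (Suc t) x \<gamma>) = sets (borel \<Otimes>\<^sub>M G)"
      using A.step_prob[OF t(2,3) ht] A'.step_prob[OF t(2,3) ht] by (simp_all add: st)
    have KK: "sets (K \<gamma> x) = sets borel" "sets (K' \<gamma> x) = sets borel"
      using A.K_in_prob_algebra[OF \<gamma>] A'.K_in_prob_algebra[OF \<gamma>] by (auto simp: space_prob_algebra)
    interpret g: prob_space "g (Suc t) x \<gamma>"
      using A.g_in_prob_algebra[OF t(2,3) \<gamma>] by (simp add: space_prob_algebra)
    let ?u = "\<lambda>z. H (h(Suc (Suc t) := z))"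
    have u: "?u \<in> borel_measurable (borel \<Otimes>\<^sub>M G)"
      by (rule measurable_compose[OF A.measurable_extend_at[OF h] H])
    have u1: "?u \<in> borel_measurable (K \<gamma> x \<Otimes>\<^sub>M g (Suc t) x \<gamma>)" "?u \<in> borel_measurable (K' \<gamma> x \<Otimes>\<^sub>M g (Suc t) x \<gamma>)"
      using u measurable_cong_sets[OF sE(1) refl] measurable_cong_sets[OF sE(2) refl] by blast+
    \<comment> \<open>The index kernel is common to both chains. Integrating it out first leaves a
      comparison of \<open>K\<close> with \<open>K'\<close>.\<close>
    show ?thesis
      unfolding st g.nn_integral_fst[OF u1(1), symmetric] g.nn_integral_fst[OF u1(2), symmetric]
      by (rule nn_integral_scaled_mono) (use KK K_le \<gamma> g.borel_measurable_nn_integral_fst[OF u1(1)] in auto)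
  qed
  have "c ^ Suc (Suc t) * (\<integral>\<^sup>+h. H h \<partial>adaptive_joint G p0 K g (Suc t)) = c * (c ^ Suc t * (\<integral>\<^sup>+h. ?S h \<partial>adaptive_joint G p0 K g t))"
    unfolding A.nn_integral_adaptive_joint_Suc[OF p0(1) t(3) H] by (simp only: power_Suc mult.assoc)
  also have "\<dots> \<le> c * (\<integral>\<^sup>+h. ?S h \<partial>adaptive_joint G p0' K' g t)"
    by (intro mult_left_mono Suc.IH t S) auto
  also have "\<dots> = (\<integral>\<^sup>+h. c * ?S h \<partial>adaptive_joint G p0' K' g t)"
  proof (rule nn_integral_cmult[symmetric])
    have "sets (adaptive_joint G p0' K' g t) = sets (A.paths (Suc t))"
      using A'.adaptive_joint_prob[OF p0(2) t(1)] by (simp add: space_prob_algebra)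
    from measurable_cong_sets[OF this refl] S
    show "?S \<in> borel_measurable (adaptive_joint G p0' K' g t)" by blast
  qed
  also have "\<dots> \<le> (\<integral>\<^sup>+h. ?S' h \<partial>adaptive_joint G p0' K' g t)"
    by (intro nn_integral_mono step_le) (simp add: sp)
  also have "\<dots> = (\<integral>\<^sup>+h. H h \<partial>adaptive_joint G p0' K' g (Suc t))"
    by (rule A'.nn_integral_adaptive_joint_Suc[OF p0(2) t(3) H, symmetric])
  finally show ?case .
qed

text \<open>The bound \<open>e s\<close> is uniform in the current state and index. It can therefore
  be pulled out of each step whatever the index kernel does, since the new state and the new index
  are independent given the present.\<close>

lemma (in adaptive_kernels) adaptive_joint_box_ge:
  assumes p0: "p0 \<in> space (prob_algebra E)"
    and A: "\<And>s. A s \<in> sets borel"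
    and e1: "e 1 \<le> emeasure p0 (A 1 \<times> space G)"
    and e: "\<And>s \<gamma> x. \<gamma> \<in> space G \<Longrightarrow> e s \<le> emeasure (K \<gamma> x) (A s)"
    and "t < n"
  shows "(\<Prod>s=1..Suc t. e s) \<le> (\<integral>\<^sup>+h. (\<Prod>s=1..Suc t. indicator (A s) (fst (h s))) \<partial>adaptive_joint G p0 K g t)"
  using assms(5)
proof (induction t)
  case 0
  have s: "sets p0 = sets E" using p0 by (simp add: space_prob_algebra)
  have sp: "space p0 = space E" by (rule sets_eq_imp_space_eq[OF s])
  let ?r = "\<lambda>z. \<lambda>s\<in>{1..Suc 0}. z"
  have "?r \<in> E \<rightarrow>\<^sub>M Pi\<^sub>M {1..Suc 0} (\<lambda>_. E)" by (intro measurable_restrict) simp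
  then have r: "?r \<in> p0 \<rightarrow>\<^sub>M Pi\<^sub>M {1..Suc 0} (\<lambda>_. E)" using measurable_cong_sets[OF s refl] by blast
  have "(\<integral>\<^sup>+h. indicator (A 1) (fst (h 1)) \<partial>adaptive_joint G p0 K g 0) = (\<integral>\<^sup>+z. indicator (A 1) (fst (?r z 1)) \<partial>p0)"
    unfolding adaptive_joint.simps
  proof (rule nn_integral_distr[OF r])
    have [measurable]: "A 1 \<in> sets borel" by (rule A)
    have [measurable]: "(\<lambda>h. h 1) \<in> Pi\<^sub>M {1..Suc 0} (\<lambda>_. E) \<rightarrow>\<^sub>M E" by (rule measurable_component_singleton) simp
    have "(\<lambda>h. indicator (A 1) (fst (h 1)) :: ennreal) \<in> borel_measurable (Pi\<^sub>M {1..Suc 0} (\<lambda>_. E))" by measurable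
    then show "(\<lambda>h. indicator (A 1) (fst (h 1)) :: ennreal) \<in> borel_measurable (distr p0 (Pi\<^sub>M {1..Suc 0} (\<lambda>_. E)) ?r)"
      by simp
  qed
  also have "\<dots> = (\<integral>\<^sup>+z. indicator (A 1 \<times> space G) z \<partial>p0)"
    by (intro nn_integral_cong) (auto simp: indicator_def sp space_pair_measure)
  also have "\<dots> = emeasure p0 (A 1 \<times> space G)"
    using A by (intro nn_integral_indicator) (simp add: s)
  finally show ?case using e1 by simp
next
  case (Suc t)
  have t: "t < n" "1 \<le> Suc t" "Suc t < n" using Suc.prems by auto
  define H :: "nat \<Rightarrow> (nat \<Rightarrow> 'a \<times> 'c) \<Rightarrow> ennreal" where "H r h = (\<Prod>s=1..r. indicator (A s) (fst (h s)))" for r h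
  have Hm: "H r \<in> borel_measurable (paths r)" for r
    unfolding H_def
  proof (rule borel_measurable_prod_ennreal)
    fix s assume "s \<in> {1..r}"
    then have [measurable]: "(\<lambda>h. h s) \<in> paths r \<rightarrow>\<^sub>M E" by (intro measurable_path_component) auto
    have [measurable]: "A s \<in> sets borel" by (rule A)
    show "(\<lambda>h. indicator (A s) (fst (h s)) :: ennreal) \<in> borel_measurable (paths r)" by measurable
  qed
  have sJ: "sets (adaptive_joint G p0 K g t) = sets (paths (Suc t))"
    using adaptive_joint_prob[OF p0 t(1)] by (simp add: space_prob_algebra)
  have sp: "space (adaptive_joint G p0 K g t) = space (paths (Suc t))" by (rule sets_eq_imp_space_eq[OF sJ])
  have "(\<Prod>s=1..Suc (Suc t). e s) = (\<Prod>s=1..Suc t. e s) * e (Suc (Suc t))" by simp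
  also have "\<dots> \<le> (\<integral>\<^sup>+h. H (Suc t) h \<partial>adaptive_joint G p0 K g t) * e (Suc (Suc t))"
    using Suc.IH t(1) unfolding H_def by (intro mult_right_mono) auto
  also have "\<dots> = (\<integral>\<^sup>+h. H (Suc t) h * e (Suc (Suc t)) \<partial>adaptive_joint G p0 K g t)"
    using Hm[of "Suc t"] measurable_cong_sets[OF sJ refl] by (intro nn_integral_multc[symmetric]) blast
  also have "\<dots> \<le> (\<integral>\<^sup>+h. (\<integral>\<^sup>+z. H (Suc (Suc t)) (h(Suc (Suc t) := z)) \<partial>step (Suc t) (h (Suc t))) \<partial>adaptive_joint G p0 K g t)"
  proof (rule nn_integral_mono)
    fix h assume "h \<in> space (adaptive_joint G p0 K g t)"
    then have h: "h \<in> space (paths (Suc t))" by (simp add: sp)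
    have ht: "h (Suc t) \<in> space E" using t by (intro path_component_in_space[OF h]) auto
    obtain x \<gamma> where z: "h (Suc t) = (x, \<gamma>)" by fastforce
    have \<gamma>: "\<gamma> \<in> space G" using ht by (simp add: z space_pair_measure)
    interpret g: prob_space "g (Suc t) x \<gamma>"
      using g_in_prob_algebra[OF t(2,3) \<gamma>] by (simp add: space_prob_algebra)
    have sK: "sets (K \<gamma> x) = sets borel"
      using K_in_prob_algebra[OF \<gamma>] by (simp add: space_prob_algebra)
    have spK: "space (K \<gamma> x) = UNIV" using sets_eq_imp_space_eq[OF sK] by simp
    have st: "step (Suc t) (h (Suc t)) = K \<gamma> x \<Otimes>\<^sub>M g (Suc t) x \<gamma>" by (simp add: step_def z)
    let ?B = "A (Suc (Suc t)) \<times> space (g (Suc t) x \<gamma>)"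
    have Bs: "?B \<in> sets (K \<gamma> x \<Otimes>\<^sub>M g (Suc t) x \<gamma>)" using A sK by (intro pair_measureI) auto
    have upd: "H (Suc (Suc t)) (h(Suc (Suc t) := z)) = H (Suc t) h * indicator (A (Suc (Suc t))) (fst z)" for z
      unfolding H_def by simp
    have "(\<integral>\<^sup>+z. H (Suc (Suc t)) (h(Suc (Suc t) := z)) \<partial>step (Suc t) (h (Suc t))) =
        (\<integral>\<^sup>+z. H (Suc t) h * indicator ?B z \<partial>(K \<gamma> x \<Otimes>\<^sub>M g (Suc t) x \<gamma>))"
      unfolding upd st by (intro nn_integral_cong) (auto simp: indicator_def space_pair_measure)
    also have "\<dots> = H (Suc t) h * emeasure (K \<gamma> x \<Otimes>\<^sub>M g (Suc t) x \<gamma>) ?B"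
      using Bs by (simp add: nn_integral_cmult)
    also have "emeasure (K \<gamma> x \<Otimes>\<^sub>M g (Suc t) x \<gamma>) ?B = emeasure (K \<gamma> x) (A (Suc (Suc t)))"
      using A sK by (subst g.emeasure_pair_measure_Times) (auto simp: g.emeasure_space_1)
    finally have eq: "(\<integral>\<^sup>+z. H (Suc (Suc t)) (h(Suc (Suc t) := z)) \<partial>step (Suc t) (h (Suc t))) =
        H (Suc t) h * emeasure (K \<gamma> x) (A (Suc (Suc t)))" .
    show "H (Suc t) h * e (Suc (Suc t)) \<le> (\<integral>\<^sup>+z. H (Suc (Suc t)) (h(Suc (Suc t) := z)) \<partial>step (Suc t) (h (Suc t)))"
      unfolding eq by (intro mult_left_mono e[OF \<gamma>]) simp
  qed
  also have "\<dots> = (\<integral>\<^sup>+h. H (Suc (Suc t)) h \<partial>adaptive_joint G p0 K g (Suc t))"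
    by (rule nn_integral_adaptive_joint_Suc[OF p0 t(3) Hm, symmetric])
  finally show ?case unfolding H_def .
qed

lemma (in adaptive_kernels) adaptive_markov_box_pos:
  assumes p0: "p0 \<in> space (prob_algebra E)" and n: "1 \<le> n"
    and A: "\<And>s. A s \<in> sets borel"
    and e1: "0 < emeasure p0 (A 1 \<times> space G)"
    and e: "\<And>s. 0 < e s" "\<And>s \<gamma> x. \<gamma> \<in> space G \<Longrightarrow> e s \<le> emeasure (K \<gamma> x) (A s)"
  shows "0 < emeasure (adaptive_markov G p0 K g n) (Pi\<^sub>E {1..n} A)"
proof -
  let ?J = "adaptive_joint G p0 K g (n - 1)"
  \<comment> \<open>At time 1 the number must bound the initial law, but the box estimate also
    demands the kernel bound at every \<open>s\<close>; the minimum meets both demands.\<close>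
  let ?e = "\<lambda>s. if s = 1 then min (e 1) (emeasure p0 (A 1 \<times> space G)) else e s"
  have n': "n - 1 < n" "Suc (n - 1) = n" using n by auto
  have box: "Pi\<^sub>E {1..n} A \<in> sets (state_seqs {1..n})"
    unfolding state_seqs_def using A by (intro sets_PiM_I_finite) auto
  have "0 < (\<Prod>s=1..n. ?e s)"
  proof -
    have "(\<Prod>s=1..n. ?e s) \<noteq> 0" using e(1) e1 by (auto simp: min_def less_le)
    then show ?thesis by (simp add: zero_less_iff_neq_zero)
  qed
  also have "\<dots> \<le> (\<integral>\<^sup>+h. (\<Prod>s=1..n. indicator (A s) (fst (h s))) \<partial>?J)"
    using adaptive_joint_box_ge[OF p0 A _ _ n'(1), of ?e] e(2) unfolding n'(2) by (auto simp: min.coboundedI1)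
  also have "\<dots> = (\<integral>\<^sup>+h. indicator (Pi\<^sub>E {1..n} A) (states 1 n h) \<partial>?J)"
  proof (rule nn_integral_cong)
    fix h
    show "(\<Prod>s=1..n. indicator (A s) (fst (h s))) = (indicator (Pi\<^sub>E {1..n} A) (states 1 n h) :: ennreal)"
    proof (cases "\<forall>s\<in>{1..n}. fst (h s) \<in> A s")
      case True
      then show ?thesis by (auto simp: states_def indicator_def intro!: prod.neutral)
    next
      case False
      then obtain s where s: "s \<in> {1..n}" "fst (h s) \<notin> A s" by blast
      then have "states 1 n h \<notin> Pi\<^sub>E {1..n} A" by (auto simp: states_def PiE_iff)
      moreover have "(\<Prod>s=1..n. indicator (A s) (fst (h s)) :: ennreal) = 0"
        using s by (intro prod_zero bexI[of _ s]) auto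
      ultimately show ?thesis by simp
    qed
  qed
  also have "\<dots> = (\<integral>\<^sup>+x. indicator (Pi\<^sub>E {1..n} A) x \<partial>distr ?J (state_seqs {1..n}) (states 1 n))"
    by (rule nn_integral_distr[OF measurable_states_joint[OF p0 n], symmetric]) (use box in simp)
  also have "\<dots> = emeasure (adaptive_markov G p0 K g n) (Pi\<^sub>E {1..n} A)"
    unfolding adaptive_markov_eq by (rule nn_integral_indicator) (use box in simp)
  finally show ?thesis .
qed

text \<open>The preimage under restriction is open, hence Borel, in the type of all sequences. Borel
  sets there pull back to measurable sets of segments, and restriction fixes every segment.\<close>

lemma openin_product_topology_measurable:
  assumes U: "openin (product_topology (\<lambda>_. euclidean) I) U"
  shows "U \<in> sets (state_seqs I :: (nat \<Rightarrow> 'a::polish_space) measure)"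
proof -
  let ?r = "\<lambda>x :: nat \<Rightarrow> 'a. restrict x I"
  have "continuous_map (euclidean :: (nat \<Rightarrow> 'a) topology) (product_topology (\<lambda>_. euclidean) I) ?r"
    unfolding continuous_map_componentwise
  proof (intro conjI ballI)
    fix k assume k: "k \<in> I"
    have "continuous_map (product_topology (\<lambda>_. euclidean) UNIV) euclidean (\<lambda>x :: nat \<Rightarrow> 'a. x k)"
      by (rule continuous_map_product_projection) simp
    then show "continuous_map (euclidean :: (nat \<Rightarrow> 'a) topology) euclidean (\<lambda>x. ?r x k)"
      using k by (simp add: euclidean_product_topology)
  qed auto
  from openin_continuous_map_preimage[OF this U] have "open (?r -` U)" by (simp add: vimage_def)
  then have "?r -` U \<in> sets borel" by (rule borel_open)
  from measurable_sets[OF measurable_restrict_borel[OF subset_refl] this]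
  have "?r -` (?r -` U) \<inter> space (state_seqs I) \<in> sets (state_seqs I)" .
  moreover have "?r -` (?r -` U) \<inter> space (state_seqs I) = U"
  proof -
    have "U \<subseteq> space (state_seqs I)"
      using openin_subset[OF U] by (simp add: state_seqs_def space_PiM)
    moreover have "?r x = x" if "x \<in> space (state_seqs I)" for x
      using that by (auto simp: state_seqs_def space_PiM PiE_def extensional_restrict)
    ultimately show ?thesis by auto
  qed
  ultimately show ?thesis by simp
qed

text \<open>Boxes suffice in both cases of the definition: for a countable type a point is the box
  of its coordinates, and a nonempty open set contains a box with nonempty open sides.\<close>

lemma strictly_positiveI:
  fixes M :: "(nat \<Rightarrow> 'a::polish_space) measure"
  assumes M: "M \<in> space (prob_algebra (state_seqs {1..n}))"
    and box: "\<And>A. (\<And>s. A s \<in> sets borel \<and> 0 < emeasure \<rho> (A s)) \<Longrightarrow> 0 < emeasure M (Pi\<^sub>E {1..n} A)"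
    and open_pos: "\<And>V. open V \<Longrightarrow> V \<noteq> {} \<Longrightarrow> 0 < emeasure \<rho> V"
    and pt_pos: "\<And>x. countable (UNIV :: 'a set) \<Longrightarrow> 0 < emeasure \<rho> {x}"
  shows "strictly_positive n M"
proof -
  interpret prob_space M using M by (simp add: space_prob_algebra)
  have sM: "sets M = sets (state_seqs {1..n})" using M by (simp add: space_prob_algebra)
  have pt: "0 < measure M {x}" if cnt: "countable (UNIV :: 'a set)" and x: "x \<in> space (state_seqs {1..n})" for x
  proof -
    have "0 < emeasure M (Pi\<^sub>E {1..n} (\<lambda>s. {x s}))" using pt_pos[OF cnt] by (intro box) auto
    moreover have "Pi\<^sub>E {1..n} (\<lambda>s. {x s}) = {x}"
      by (rule PiE_singleton) (use x in \<open>auto simp: state_seqs_def space_PiM PiE_def\<close>)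
    ultimately show ?thesis by (simp add: emeasure_eq_measure)
  qed
  have op: "0 < measure M U" if U: "openin (product_topology (\<lambda>_. euclidean) {1..n}) U" "U \<noteq> {}" for U
  proof -
    obtain x where "x \<in> U" using U(2) by blast
    with U(1)[unfolded openin_product_topology_alt]
    obtain V where "\<forall>i\<in>{1..n}. openin euclidean (V i)" and V2: "x \<in> Pi\<^sub>E {1..n} V" "Pi\<^sub>E {1..n} V \<subseteq> U"
      by meson
    then have V1: "open (V i)" if "i \<in> {1..n}" for i using that by (metis open_openin)
    note V = V1 V2
    \<comment> \<open>The topology says nothing about \<open>V\<close> outside
      \<open>{1..n}\<close>; filling in \<open>UNIV\<close> there makes every side open and nonempty
      and leaves the box unchanged.\<close>
    define V' where "V' i = (if i \<in> {1..n} then V i else UNIV)" for i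
    have V': "open (V' i)" "V' i \<noteq> {}" for i using V(1,2) by (auto simp: V'_def PiE_iff)
    have eq: "Pi\<^sub>E {1..n} V' = Pi\<^sub>E {1..n} V" by (rule PiE_cong) (simp add: V'_def)
    have "0 < emeasure M (Pi\<^sub>E {1..n} V')" using open_pos[OF V'] V'(1) by (intro box) auto
    also have "\<dots> \<le> emeasure M U"
      unfolding eq using V(3) openin_product_topology_measurable[OF U(1)]
      by (intro emeasure_mono) (simp_all add: sM)
    finally show ?thesis by (simp add: emeasure_eq_measure)
  qed
  show ?thesis
  proof (cases "countable (UNIV :: 'a set)")
    case True
    show ?thesis unfolding strictly_positive_def if_P[OF True] using pt[OF True] by (rule ballI)
  next
    case False
    show ?thesis unfolding strictly_positive_def if_not_P[OF False] using op by (intro allI impI) (elim conjE)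
  qed
qed

text \<open>An atomic law with positive weights on a countable dense set. For a countable type this
  set is taken to be the whole space, so that points are charged as well.\<close>

lemma exists_strictly_positive_prob:
  obtains \<rho> :: "'a::polish_space measure" where "\<rho> \<in> space (prob_algebra borel)"
    "\<And>V. open V \<Longrightarrow> V \<noteq> {} \<Longrightarrow> 0 < emeasure \<rho> V"
    "\<And>x. countable (UNIV :: 'a set) \<Longrightarrow> 0 < emeasure \<rho> {x}"
proof -
  obtain D0 :: "'a set" where D0: "countable D0" "\<And>X. open X \<Longrightarrow> X \<noteq> {} \<Longrightarrow> \<exists>d\<in>D0. d \<in> X"
    using countable_dense_setE by blast
  define D where "D = (if countable (UNIV :: 'a set) then UNIV else D0)"
  have D: "countable D" using D0 by (auto simp: D_def)
  have Dd: "\<exists>d\<in>D. d \<in> X" if "open X" "X \<noteq> {}" for X using D0(2)[OF that] that by (auto simp: D_def)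
  have Dne: "D \<noteq> {}" using Dd[of UNIV] by auto
  \<comment> \<open>\<open>from_nat_into D\<close> enumerates \<open>D\<close>, possibly with
    repetitions. Geometric weights are positive at every index, so the support is all of
    \<open>D\<close>.\<close>
  define p where "p = map_pmf (from_nat_into D) (geometric_pmf (1/2))"
  have sp: "set_pmf p = D"
    unfolding p_def using range_from_nat_into[OF Dne D] by (simp add: set_pmf_geometric)
  define \<rho> where "\<rho> = distr (measure_pmf p) borel (\<lambda>x. x)"
  have em: "emeasure \<rho> A = emeasure (measure_pmf p) A" if "A \<in> sets borel" for A
    unfolding \<rho>_def using that by (subst emeasure_distr) auto
  have pos: "0 < emeasure \<rho> A" if "A \<in> sets borel" "d \<in> A" "d \<in> D" for A d
  proof -
    have "0 < emeasure (measure_pmf p) {d}" using that sp by (simp add: emeasure_pmf_single pmf_positive)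
    also have "\<dots> \<le> emeasure (measure_pmf p) A" using that by (intro emeasure_mono) auto
    finally show ?thesis by (simp add: em that)
  qed
  show thesis
  proof
    show "\<rho> \<in> space (prob_algebra borel)"
      by (auto simp: space_prob_algebra \<rho>_def intro!: measure_pmf.prob_space_distr)
    show "0 < emeasure \<rho> V" if "open V" "V \<noteq> {}" for V
      using Dd[OF that] pos[of V] that by (auto intro: borel_open)
    show "0 < emeasure \<rho> {x}" if "countable (UNIV :: 'a set)" for x
      by (rule pos[of _ x]) (use that in \<open>auto simp: D_def\<close>)
  qed
qed

text \<open>Applied to the complement of \<open>A\<close>, the hypothesis gives
  \<open>\<mu> A - \<nu> A \<le> (1 - c) * (1 - \<nu> A)\<close>.\<close>

lemma tv_dist_le_of_scaled_le:
  assumes "prob_space \<mu>" "prob_space \<nu>" and s: "sets \<nu> = sets \<mu>" and c: "c \<le> 1"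
    and le: "\<And>A. A \<in> sets \<mu> \<Longrightarrow> c * measure \<nu> A \<le> measure \<mu> A"
  shows "tv_dist \<mu> \<nu> \<le> 1 - c"
proof (rule tv_dist_leI[OF assms(1,2) s])
  interpret \<mu>: prob_space \<mu> by fact
  interpret \<nu>: prob_space \<nu> by fact
  fix A assume A: "A \<in> sets \<mu>"
  have sp: "space \<nu> = space \<mu>" by (rule sets_eq_imp_space_eq[OF s])
  have "c * measure \<nu> (space \<mu> - A) \<le> measure \<mu> (space \<mu> - A)" using A by (intro le) auto
  then have "c * (1 - measure \<nu> A) \<le> 1 - measure \<mu> A"
    using A \<mu>.prob_compl[of A] \<nu>.prob_compl[of A] by (simp add: sp s)
  moreover have "(1 - c) * measure \<nu> A \<ge> 0" using c by simp
  ultimately show "measure \<mu> A - measure \<nu> A \<le> 1 - c" by (simp add: algebra_simps)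
qed

text \<open>A supremum of reals is meaningful only for a nonempty set of values that is bounded
  above. Nonemptiness comes from \<open>X\<close>, boundedness from total variation being at most
  1.\<close>

lemma SUP_tv_dist_bounds:
  assumes f: "\<And>x. x \<in> X \<Longrightarrow> f x \<in> space (prob_algebra M)" and "X \<noteq> {}"
  shows "(SUP (x, x')\<in>X \<times> X. tv_dist (f x) (f x')) \<le> 1"
    and "\<And>x x'. x \<in> X \<Longrightarrow> x' \<in> X \<Longrightarrow> tv_dist (f x) (f x') \<le> (SUP (x, x')\<in>X \<times> X. tv_dist (f x) (f x'))"
proof -
  have le: "tv_dist (f x) (f x') \<le> 1" if "x \<in> X" "x' \<in> X" for x x'
    using f[OF that(1)] f[OF that(2)] by (intro tv_dist_le_1) (auto simp: space_prob_algebra)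
  show "(SUP (x, x')\<in>X \<times> X. tv_dist (f x) (f x')) \<le> 1"
    using assms(2) le by (intro cSUP_least) auto
  show "tv_dist (f x) (f x') \<le> (SUP (x, x')\<in>X \<times> X. tv_dist (f x) (f x'))" if "x \<in> X" "x' \<in> X" for x x'
    using that le by (intro cSUP_upper2[of _ _ "(x, x')"] bdd_aboveI[of _ 1]) auto
qed

text \<open>Regroups the four parameters into two points, so that both contraction coefficients
  become suprema of distances over pairs of points.\<close>

lemma SUP_reindex_pairs:
  "(SUP (w, w', \<gamma>, \<gamma>') \<in> UNIV \<times> UNIV \<times> Y \<times> Y. h w w' \<gamma> \<gamma>') =
   (SUP ((w, \<gamma>), (w', \<gamma>')) \<in> (UNIV \<times> Y) \<times> (UNIV \<times> Y). h w w' \<gamma> \<gamma>' :: real)"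
proof (rule arg_cong[where f = Sup], intro set_eqI iffI)
  fix r assume "r \<in> (\<lambda>(w, w', \<gamma>, \<gamma>'). h w w' \<gamma> \<gamma>') ` (UNIV \<times> UNIV \<times> Y \<times> Y)"
  then obtain w w' \<gamma> \<gamma>' where "r = h w w' \<gamma> \<gamma>'" "\<gamma> \<in> Y" "\<gamma>' \<in> Y" by auto
  then show "r \<in> (\<lambda>((w, \<gamma>), (w', \<gamma>')). h w w' \<gamma> \<gamma>') ` ((UNIV \<times> Y) \<times> (UNIV \<times> Y))"
    by (intro image_eqI[of _ _ "((w, \<gamma>), (w', \<gamma>'))"]) simp_all
next
  fix r assume "r \<in> (\<lambda>((w, \<gamma>), (w', \<gamma>')). h w w' \<gamma> \<gamma>') ` ((UNIV \<times> Y) \<times> (UNIV \<times> Y))"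
  then obtain w w' \<gamma> \<gamma>' where "r = h w w' \<gamma> \<gamma>'" "\<gamma> \<in> Y" "\<gamma>' \<in> Y" by auto
  then show "r \<in> (\<lambda>(w, w', \<gamma>, \<gamma>'). h w w' \<gamma> \<gamma>') ` (UNIV \<times> UNIV \<times> Y \<times> Y)"
    by (intro image_eqI[of _ _ "(w, w', \<gamma>, \<gamma>')"]) simp_all
qed

lemma adaptive_markov_scaled_mono:
  assumes A: "adaptive_kernels G K g n" "adaptive_kernels G K' g n"
    and p0: "p0 \<in> space (prob_algebra (borel \<Otimes>\<^sub>M G))" "p0' \<in> space (prob_algebra (borel \<Otimes>\<^sub>M G))"
    and p_le: "\<And>A. A \<in> sets (borel \<Otimes>\<^sub>M G) \<Longrightarrow> c * emeasure p0 A \<le> emeasure p0' A"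
    and K_le: "\<And>\<gamma> x A. \<gamma> \<in> space G \<Longrightarrow> A \<in> sets borel \<Longrightarrow> c * emeasure (K \<gamma> x) A \<le> emeasure (K' \<gamma> x) A"
    and n: "1 \<le> n" and S: "S \<in> sets (state_seqs {1..n})"
  shows "c ^ n * emeasure (adaptive_markov G p0 K g n) S \<le> emeasure (adaptive_markov G p0' K' g n) S"
proof -
  interpret A: adaptive_kernels G K g n by fact
  interpret A': adaptive_kernels G K' g n by fact
  have n': "n - 1 < n" "Suc (n - 1) = n" using n by auto
  have "A.states 1 n \<in> A.paths n \<rightarrow>\<^sub>M state_seqs {1..n}" by (rule A.measurable_states) auto
  from measurable_compose[OF this borel_measurable_indicator[OF S]]
  have m: "(\<lambda>h. indicator S (A.states 1 n h) :: ennreal) \<in> borel_measurable (A.paths (Suc (n - 1)))"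
    unfolding n'(2) .
  show ?thesis
    using adaptive_joint_scaled_mono[OF A p0 p_le K_le n'(1) m]
    unfolding n'(2) A.emeasure_adaptive_markov_eq_nn_integral[OF p0(1) n S]
      A'.emeasure_adaptive_markov_eq_nn_integral[OF p0(2) n S] .
qed

theorem theoremA4:
  fixes G :: "'c measure"
    and p0 :: "('a::polish_space \<times> 'c) measure"
    and K :: "'c \<Rightarrow> 'a \<Rightarrow> 'a measure"
    and g :: "nat \<Rightarrow> 'a \<Rightarrow> 'c \<Rightarrow> 'c measure"
    and n i j :: nat
  assumes K: "(\<lambda>(\<gamma>, x). K \<gamma> x) \<in> G \<Otimes>\<^sub>M borel \<rightarrow>\<^sub>M prob_algebra borel"
    and g: "\<And>k. 1 \<le> k \<Longrightarrow> k < n \<Longrightarrow> (\<lambda>(x, \<gamma>). g k x \<gamma>) \<in> borel \<Otimes>\<^sub>M G \<rightarrow>\<^sub>M prob_algebra G"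
    and p0: "p0 \<in> space (prob_algebra (borel \<Otimes>\<^sub>M G))"
    and ij: "1 \<le> i" "i < j" "j \<le> n"
  shows "eta_bar n (adaptive_markov G p0 K g n) i j \<le> ereal (\<Prod>k=i..<j. theta G K g k)"
proof -
  let ?E = "borel \<Otimes>\<^sub>M G :: ('a \<times> 'c) measure"
  let ?Q = "adaptive_markov G p0 K g n"
  let ?c = "\<Prod>k=i..<j. theta G K g k"
  have n: "1 \<le> n" using ij by simp
  interpret A: adaptive_kernels G K g n by unfold_locales (fact K, fact g)
  interpret p0: prob_space p0 using p0 by (simp add: space_prob_algebra)
  have sp0: "sets p0 = sets ?E" using p0 by (simp add: space_prob_algebra)
  have "space p0 = space ?E" by (rule sets_eq_imp_space_eq[OF sp0])
  \<comment> \<open>Otherwise the suprema defining the contraction coefficients would range over the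
    empty set and be unspecified reals.\<close>
  then have G: "space G \<noteq> {}" using p0.not_empty by (auto simp: space_pair_measure)
  have KP: "(\<lambda>(w, \<gamma>). K \<gamma> w) z \<in> space (prob_algebra borel)" if "z \<in> UNIV \<times> space G" for z
    using that A.K_in_prob_algebra by auto
  have gP: "(\<lambda>(w, \<gamma>). g k w \<gamma>) z \<in> space (prob_algebra G)" if "1 \<le> k" "k < n" "z \<in> UNIV \<times> space G" for k z
    using that A.g_in_prob_algebra by auto
  have ne: "(UNIV :: 'a set) \<times> space G \<noteq> {}" using G by auto
  have kc: "kernel_contraction G K = (SUP (z, z')\<in>(UNIV \<times> space G) \<times> (UNIV \<times> space G). tv_dist ((\<lambda>(w, \<gamma>). K \<gamma> w) z) ((\<lambda>(w, \<gamma>). K \<gamma> w) z'))"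
    unfolding kernel_contraction_def SUP_reindex_pairs by (intro SUP_cong) auto
  have ic: "index_contraction G g k = (SUP (z, z')\<in>(UNIV \<times> space G) \<times> (UNIV \<times> space G). tv_dist ((\<lambda>(w, \<gamma>). g k w \<gamma>) z) ((\<lambda>(w, \<gamma>). g k w \<gamma>) z'))" for k
    unfolding index_contraction_def SUP_reindex_pairs by (intro SUP_cong) auto
  have kc1: "kernel_contraction G K \<le> 1"
    unfolding kc by (rule SUP_tv_dist_bounds(1)[OF KP ne])
  have ic1: "index_contraction G g k \<le> 1" if "1 \<le> k" "k < n" for k
    unfolding ic by (rule SUP_tv_dist_bounds(1)[OF gP[OF that] ne])
  have kc_tv: "tv_dist (K \<gamma> w) (K \<gamma>' w') \<le> kernel_contraction G K" if "\<gamma> \<in> space G" "\<gamma>' \<in> space G" for \<gamma> \<gamma>' w w'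
    using SUP_tv_dist_bounds(2)[where f = "\<lambda>(w, \<gamma>). K \<gamma> w", OF KP ne, where x = "(w, \<gamma>)" and x' = "(w', \<gamma>')"] that
    unfolding kc by simp
  have ic_tv: "tv_dist (g k w \<gamma>) (g k w' \<gamma>') \<le> index_contraction G g k"
    if "1 \<le> k" "k < n" "\<gamma> \<in> space G" "\<gamma>' \<in> space G" for k \<gamma> \<gamma>' w w'
    using SUP_tv_dist_bounds(2)[where f = "\<lambda>(w, \<gamma>). g k w \<gamma>", OF gP[OF that(1,2)] ne, where x = "(w, \<gamma>)" and x' = "(w', \<gamma>')"] that
    unfolding ic by simp

  obtain \<rho> :: "'a measure" where \<rho>: "\<rho> \<in> space (prob_algebra borel)"
    "\<And>V. open V \<Longrightarrow> V \<noteq> {} \<Longrightarrow> 0 < emeasure \<rho> V"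
    "\<And>x. countable (UNIV :: 'a set) \<Longrightarrow> 0 < emeasure \<rho> {x}"
    using exists_strictly_positive_prob by blast
  interpret \<rho>: prob_space \<rho> using \<rho>(1) by (simp add: space_prob_algebra)
  have s\<rho>: "sets \<rho> = sets borel" using \<rho>(1) by (simp add: space_prob_algebra)
  \<comment> \<open>Some probability measure on \<open>G\<close> is needed to turn
    \<open>\<rho>\<close> into an initial law of pairs; the index marginal of \<open>p0\<close> is
    at hand.\<close>
  define \<tau> where "\<tau> = distr p0 G snd"
  have snd: "snd \<in> p0 \<rightarrow>\<^sub>M G" using measurable_cong_sets[OF sp0 refl] measurable_snd by blast
  interpret \<tau>: prob_space \<tau> unfolding \<tau>_def by (rule p0.prob_space_distr[OF snd])
  interpret \<rho>\<tau>: pair_prob_space \<rho> \<tau> ..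
  have \<rho>\<tau>: "\<rho> \<Otimes>\<^sub>M \<tau> \<in> space (prob_algebra ?E)"
    using sets_pair_measure_cong[OF s\<rho>, of \<tau> G] \<rho>\<tau>.prob_space_axioms by (simp add: space_prob_algebra \<tau>_def)

  define \<epsilon> :: "nat \<Rightarrow> real" where "\<epsilon> k = 1 / real (Suc (Suc k))" for k
  have \<epsilon>: "0 < \<epsilon> k" "0 \<le> \<epsilon> k" "\<epsilon> k \<le> 1" for k by (auto simp: \<epsilon>_def)
  \<comment> \<open>The same \<open>\<rho>\<close> is mixed in for all states and indices, so it
    cancels whenever two perturbed kernels are compared, while it bounds all of them from
    below.\<close>
  define K' where "K' k \<gamma> x = mix (\<epsilon> k) \<rho> (K \<gamma> x)" for k \<gamma> x
  define p' where "p' k = mix (\<epsilon> k) (\<rho> \<Otimes>\<^sub>M \<tau>) p0" for k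
  define M where "M k = adaptive_markov G (p' k) (K' k) g n" for k
  have A': "adaptive_kernels G (K' k) g n" for k
  proof unfold_locales
    have "(\<lambda>z. mix (\<epsilon> k) \<rho> ((\<lambda>(\<gamma>, x). K \<gamma> x) z)) \<in> G \<Otimes>\<^sub>M borel \<rightarrow>\<^sub>M prob_algebra borel"
      using \<rho>(1) \<epsilon> K by (intro measurable_mix) auto
    then show "(\<lambda>(\<gamma>, x). K' k \<gamma> x) \<in> G \<Otimes>\<^sub>M borel \<rightarrow>\<^sub>M prob_algebra borel"
      by (simp add: K'_def case_prod_unfold)
  qed (fact g)
  have p': "p' k \<in> space (prob_algebra ?E)" for k
    unfolding p'_def by (rule mix_in_prob_algebra[OF \<epsilon>(2,3) \<rho>\<tau> p0])
  have em_p': "emeasure (p' k) S = ennreal (\<epsilon> k) * emeasure (\<rho> \<Otimes>\<^sub>M \<tau>) S + ennreal (1 - \<epsilon> k) * emeasure p0 S"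
    if "S \<in> sets ?E" for k S
    unfolding p'_def by (rule emeasure_mix[OF \<epsilon>(2,3) \<rho>\<tau> p0 that])
  have em_K': "emeasure (K' k \<gamma> x) S = ennreal (\<epsilon> k) * emeasure \<rho> S + ennreal (1 - \<epsilon> k) * emeasure (K \<gamma> x) S"
    if "\<gamma> \<in> space G" "S \<in> sets borel" for k \<gamma> x S
    unfolding K'_def by (rule emeasure_mix[OF \<epsilon>(2,3) \<rho>(1) A.K_in_prob_algebra[OF that(1)] that(2)])
  have Mp: "M k \<in> space (prob_algebra (state_seqs {1..n}))" for k
    unfolding M_def by (rule adaptive_kernels.adaptive_markov_prob[OF A' p' n])
  have Qp: "?Q \<in> space (prob_algebra (state_seqs {1..n}))"
    by (rule A.adaptive_markov_prob[OF p0 n])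

  have pos: "strictly_positive n (M k)" for k
  proof (rule strictly_positiveI[OF Mp _ \<rho>(2,3)])
    fix S :: "nat \<Rightarrow> 'a set" assume S: "\<And>s. S s \<in> sets borel \<and> 0 < emeasure \<rho> (S s)"
    show "0 < emeasure (M k) (Pi\<^sub>E {1..n} S)"
      unfolding M_def
    proof (rule adaptive_kernels.adaptive_markov_box_pos[OF A' p' n])
      have "emeasure (\<rho> \<Otimes>\<^sub>M \<tau>) (S 1 \<times> space G) = emeasure \<rho> (S 1) * emeasure \<tau> (space G)"
        using S s\<rho> by (intro \<tau>.emeasure_pair_measure_Times) (auto simp: \<tau>_def)
      also have "emeasure \<tau> (space G) = 1" using \<tau>.emeasure_space_1 by (simp add: \<tau>_def)
      finally have "0 < ennreal (\<epsilon> k) * emeasure (\<rho> \<Otimes>\<^sub>M \<tau>) (S 1 \<times> space G)"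
        using S \<epsilon>(1) by (simp add: ennreal_zero_less_mult_iff)
      then show "0 < emeasure (p' k) (S 1 \<times> space G)"
        using S by (subst em_p') (auto intro: add_pos_nonneg)
      show "0 < ennreal (\<epsilon> k) * emeasure \<rho> (S s)" for s
        using S \<epsilon>(1) by (simp add: ennreal_zero_less_mult_iff)
      show "ennreal (\<epsilon> k) * emeasure \<rho> (S s) \<le> emeasure (K' k \<gamma> x) (S s)" if "\<gamma> \<in> space G" for s \<gamma> x
        using S that by (subst em_K') auto
    qed (use S in auto)
  qed

  \<comment> \<open>Each perturbed ingredient dominates \<open>1 - \<epsilon> k\<close> times the
    original. There are \<open>n\<close> of them, the initial law and \<open>n - 1\<close>
    transitions.\<close>
  have tv: "tv_dist (M k) ?Q \<le> 1 - (1 - \<epsilon> k) ^ n" for k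
  proof (rule tv_dist_le_of_scaled_le)
    show "prob_space (M k)" "prob_space ?Q" "sets ?Q = sets (M k)"
      using Mp Qp by (auto simp: space_prob_algebra)
    then interpret M: prob_space "M k" + Q: prob_space ?Q by auto
    show "(1 - \<epsilon> k) ^ n \<le> 1" using \<epsilon> by (intro power_le_one) auto
    fix S assume "S \<in> sets (M k)"
    then have S: "S \<in> sets (state_seqs {1..n})" using Mp by (simp add: space_prob_algebra)
    have "ennreal (1 - \<epsilon> k) ^ n * emeasure ?Q S \<le> emeasure (M k) S"
      unfolding M_def
      by (rule adaptive_markov_scaled_mono[OF A.adaptive_kernels_axioms A' p0 p' _ _ n S])
         (auto simp: em_p' em_K')
    then show "(1 - \<epsilon> k) ^ n * measure ?Q S \<le> measure (M k) S"
      using \<epsilon>(3)[of k] by (simp add: M.emeasure_eq_measure Q.emeasure_eq_measure ennreal_power flip: ennreal_mult)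
  qed
  have tv_lim: "(\<lambda>k. tv_dist (M k) ?Q) \<longlonglongrightarrow> 0"
  proof (rule tendsto_sandwich[OF always_eventually always_eventually tendsto_const])
    show "\<forall>k. 0 \<le> tv_dist (M k) ?Q"
      using Mp Qp by (auto simp: space_prob_algebra intro!: tv_dist_nonneg)
    show "\<forall>k. tv_dist (M k) ?Q \<le> 1 - (1 - \<epsilon> k) ^ n" using tv by blast
    have "\<epsilon> \<longlonglongrightarrow> 0" unfolding \<epsilon>_def
      by (rule LIMSEQ_Suc[OF LIMSEQ_Suc[OF lim_1_over_n]])
    then have "(\<lambda>k. 1 - (1 - \<epsilon> k) ^ n) \<longlonglongrightarrow> 1 - (1 - 0) ^ n" by (intro tendsto_intros)
    then show "(\<lambda>k. 1 - (1 - \<epsilon> k) ^ n) \<longlonglongrightarrow> 0" by simp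
  qed

  have eta: "eta_direct n (M k) i j \<le> ereal ?c" for k
  proof (rule eta_direct_le[OF Mp ij])
    fix B :: "(nat \<Rightarrow> 'a) set" assume B: "B \<in> sets (state_seqs {j..n})"
    \<comment> \<open>The contraction coefficient of the original kernels is kept as bound for the
      perturbed ones. Thus the final product is the same for every \<open>k\<close>.\<close>
    have "tv_dist (K' k \<gamma> w) (K' k \<gamma>' w') \<le> kernel_contraction G K" if "\<gamma> \<in> space G" "\<gamma>' \<in> space G" for \<gamma> \<gamma>' w w'
      unfolding K'_def
      by (rule order_trans[OF tv_dist_mix_le[OF \<epsilon>(2,3) \<rho>(1)] kc_tv[OF that]]) (rule A.K_in_prob_algebra[OF that(1)] A.K_in_prob_algebra[OF that(2)])+
    from adaptive_kernels.adaptive_markov_oscillation[OF A' p' ij kc1 this ic1 ic_tv B]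
    show "\<exists>a. \<forall>A\<in>sets (state_seqs {1..i}).
      a * measure (M k) {x \<in> space (M k). restrict x {1..i} \<in> A} \<le>
        measure (M k) {x \<in> space (M k). restrict x {1..i} \<in> A \<and> restrict x {j..n} \<in> B} \<and>
      measure (M k) {x \<in> space (M k). restrict x {1..i} \<in> A \<and> restrict x {j..n} \<in> B} \<le>
        (a + ?c) * measure (M k) {x \<in> space (M k). restrict x {1..i} \<in> A}"
      unfolding M_def theta_def .
  qed

  \<comment> \<open>Nothing ensures that the coefficients converge along \<open>M\<close>, as
    \<open>eta_bar\<close> demands. The extended reals are compact, so a subsequence converges; it
    still approximates \<open>?Q\<close>, and its limit obeys the common bound.\<close>
  obtain l r where r: "strict_mono r" and l: "((\<lambda>k. eta_direct n (M k) i j) \<circ> r) \<longlonglongrightarrow> l"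
    using compact_complete_linorder by blast
  have "eta_bar n ?Q i j \<le> l"
    unfolding eta_bar_def
  proof (rule Inf_lower, rule CollectI, intro exI[of _ "M \<circ> r"] conjI allI)
    show "(\<lambda>k. tv_dist ((M \<circ> r) k) ?Q) \<longlonglongrightarrow> 0"
      using LIMSEQ_subseq_LIMSEQ[OF tv_lim r] by (simp add: comp_def)
    show "(\<lambda>k. eta_direct n ((M \<circ> r) k) i j) \<longlonglongrightarrow> l" using l by (simp add: comp_def)
  qed (use Mp pos in auto)
  also have "l \<le> ereal ?c"
    by (rule LIMSEQ_le_const2[OF l]) (use eta in auto)
  finally show ?thesis .
qed

end
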